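(* Given a finite set of tasks $\mathcal{J}$, each task $J_j$ having an integer deadline $d_j$ and an integer-valued nondecreasing execution-time function $p_j$ of its starting time, the problem of deciding whether there exists a feasible single-machine schedule for $\mathcal{J}$ is strongly NP-complete.
   Context: Time-dependent scheduling on a single machine: each task $J_j$ has a deadline $d_j$ and an execution time $p_j(t)$ depending on the time $t\ge 0$ at which its execution starts. A schedule assigns to each task a starting time $s_j\ge 0$; its completion time is $C_j=s_j+p_j(s_j)$. The schedule is feasible if the execution intervals $[s_j,C_j)$ of distinct tasks are pairwise disjoint and $C_j\le d_j$ for every task. Strong NP-completeness means the problem remains NP-complete when all numbers in the instance are bounded by a polynomial in the number of tasks. *)

theory Defs
  imports
    Complex_Main
    "HOL-Library.Disjoint_Sets"
    "HOL-Computational_Algebra.Polynomial"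
begin

section \<open>Polynomial-time Turing machines\<close>

text \<open>
  Deterministic multi-tape Turing machines with two-way infinite tapes.  A machine with
  \<open>tapes\<close> = k, \<open>states\<close> = Q, \<open>symbols\<close> = G has working states 0, ..., Q - 1, start state 0,
  the halting state Q, and tape alphabet 0, ..., G - 1, where 0 is the blank and 1, 2 are the
  input symbols.
\<close>

datatype move = Move_Left | Move_Stay | Move_Right

record tm =
  tapes :: nat
  states :: nat
  symbols :: nat
  trans :: "nat \<Rightarrow> nat list \<Rightarrow> nat \<times> (nat \<times> move) list"

text \<open>\<open>trans\<close> only matters on the finitely many arguments constrained here.\<close>

definition wf_tm :: "tm \<Rightarrow> bool" where
  "wf_tm M \<longleftrightarrow> tapes M \<ge> 1 \<and> symbols M \<ge> 3 \<and>
     (\<forall>q as. q < states M \<and> length as = tapes M \<and> (\<forall>a\<in>set as. a < symbols M) \<longrightarrow>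
        (case trans M q as of (q', acts) \<Rightarrow>
           q' \<le> states M \<and> length acts = tapes M \<and> (\<forall>(a, m)\<in>set acts. a < symbols M)))"

type_synonym tape = "(int \<Rightarrow> nat) \<times> int"
type_synonym config = "nat \<times> tape list"

fun move_head :: "move \<Rightarrow> int \<Rightarrow> int" where
  "move_head Move_Left h = h - 1"
| "move_head Move_Stay h = h"
| "move_head Move_Right h = h + 1"

fun act :: "nat \<times> move \<Rightarrow> tape \<Rightarrow> tape" where
  "act (a, m) (c, h) = (c(h := a), move_head m h)"

fun step :: "tm \<Rightarrow> config \<Rightarrow> config" where
  "step M (q, ts) =
     (if q = states M then (q, ts)
      else case trans M q (map (\<lambda>(c, h). c h) ts) of (q', acts) \<Rightarrow> (q', map2 act acts ts))"

definition bit_symbol :: "bool \<Rightarrow> nat" where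
  "bit_symbol b = (if b then 2 else 1)"

definition input_tape :: "bool list \<Rightarrow> tape" where
  "input_tape x =
     ((\<lambda>i. if 0 \<le> i \<and> i < int (length x) then bit_symbol (x ! nat i) else 0), 0)"

definition init_config :: "tm \<Rightarrow> bool list \<Rightarrow> config" where
  "init_config M x = (0, input_tape x # replicate (tapes M - 1) (\<lambda>_. 0, 0))"

text \<open>The output is read from the first tape, from the head rightwards up to the first blank.\<close>

definition has_output :: "tape \<Rightarrow> bool list \<Rightarrow> bool" where
  "has_output = (\<lambda>(c, h) y.
     (\<forall>i<length y. c (h + int i) = bit_symbol (y ! i)) \<and> c (h + int (length y)) = 0)"

definition halts_with :: "tm \<Rightarrow> config \<Rightarrow> bool list \<Rightarrow> bool" where
  "halts_with M = (\<lambda>(q, ts) y. q = states M \<and> has_output (hd ts) y)"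

definition polytime_computable :: "(bool list \<Rightarrow> bool list) \<Rightarrow> bool" where
  "polytime_computable f \<longleftrightarrow>
     (\<exists>M (p :: nat poly). wf_tm M \<and>
        (\<forall>x. \<exists>t \<le> poly p (length x). halts_with M ((step M ^^ t) (init_config M x)) (f x)))"


section \<open>NP-completeness\<close>

type_synonym lang = "bool list set"

definition polytime_decidable :: "lang \<Rightarrow> bool" where
  "polytime_decidable L \<longleftrightarrow> polytime_computable (\<lambda>x. [x \<in> L])"

definition enc_list :: "('a \<Rightarrow> bool list) \<Rightarrow> 'a list \<Rightarrow> bool list" where
  "enc_list e xs = concat (map (\<lambda>x. True # e x) xs) @ [False]"

definition enc_pair :: "bool list \<Rightarrow> bool list \<Rightarrow> bool list" where
  "enc_pair x w = enc_list (\<lambda>b. [b]) x @ w"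

definition in_NP :: "lang \<Rightarrow> bool" where
  "in_NP L \<longleftrightarrow>
     (\<exists>R (p :: nat poly). polytime_decidable R \<and>
        (\<forall>x. x \<in> L \<longleftrightarrow> (\<exists>w. length w \<le> poly p (length x) \<and> enc_pair x w \<in> R)))"

definition polytime_reducible :: "lang \<Rightarrow> lang \<Rightarrow> bool" where
  "polytime_reducible L L' \<longleftrightarrow> (\<exists>f. polytime_computable f \<and> (\<forall>x. x \<in> L \<longleftrightarrow> f x \<in> L'))"

definition NP_hard :: "lang \<Rightarrow> bool" where
  "NP_hard L \<longleftrightarrow> (\<forall>L'. in_NP L' \<longrightarrow> polytime_reducible L' L)"

definition NP_complete :: "lang \<Rightarrow> bool" where
  "NP_complete L \<longleftrightarrow> in_NP L \<and> NP_hard L"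

text \<open>
  A decision problem is given by the set \<open>Y\<close> of its yes-instances and a binary encoding \<open>enc\<close>
  of instances; \<open>len\<close> is the quantity in which the numbers \<open>nums I\<close> occurring in an
  instance \<open>I\<close> are to be polynomially bounded.
\<close>

definition strongly_NP_complete ::
    "('i \<Rightarrow> bool list) \<Rightarrow> ('i \<Rightarrow> nat) \<Rightarrow> ('i \<Rightarrow> nat set) \<Rightarrow> 'i set \<Rightarrow> bool" where
  "strongly_NP_complete enc len nums Y \<longleftrightarrow>
     NP_complete (enc ` Y) \<and>
     (\<exists>p :: nat poly. NP_complete (enc ` {I \<in> Y. \<forall>a\<in>nums I. a \<le> poly p (len I)}))"


section \<open>Time-dependent scheduling on a single machine\<close>

definition completion_time :: "(real \<Rightarrow> int) \<Rightarrow> real \<Rightarrow> real" where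
  "completion_time p s = s + real_of_int (p s)"

definition feasible_schedule ::
    "'j set \<Rightarrow> ('j \<Rightarrow> int) \<Rightarrow> ('j \<Rightarrow> real \<Rightarrow> int) \<Rightarrow> ('j \<Rightarrow> real) \<Rightarrow> bool" where
  "feasible_schedule J d p s \<longleftrightarrow>
     (\<forall>j\<in>J. 0 \<le> s j \<and> completion_time (p j) (s j) \<le> real_of_int (d j)) \<and>
     disjoint_family_on (\<lambda>j. {s j..<completion_time (p j) (s j)}) J"

text \<open>
  In an instance, a task is its deadline together with its execution-time function, the latter
  given by a list of pairs (b, v) with the meaning ``from time b on, the execution time is at
  least v''.  Every such list denotes a nondecreasing function; a nondecreasing step function is
  denoted by the list of its breakpoints and the values taken there.  By lemma
  \<open>every_task_set_has_instance\<close> below, for arbitrary nondecreasing functions of real time there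
  is an instance that agrees with them at all integer times up to the deadlines and is
  schedulable iff they are.
\<close>

type_synonym task = "int \<times> (nat \<times> nat) list"
type_synonym task_set = "task list"

definition exec_time :: "(nat \<times> nat) list \<Rightarrow> real \<Rightarrow> int" where
  "exec_time bvs t = Max (insert 0 {int v | b v. (b, v) \<in> set bvs \<and> real b \<le> t})"

definition schedulable :: "task_set \<Rightarrow> bool" where
  "schedulable I \<longleftrightarrow>
     (\<exists>s. feasible_schedule {..<length I} (\<lambda>j. fst (I ! j)) (\<lambda>j. exec_time (snd (I ! j))) s)"

fun binary_digits :: "nat \<Rightarrow> bool list" where
  "binary_digits n = (if n = 0 then [] else odd n # binary_digits (n div 2))"

declare binary_digits.simps [simp del]

definition enc_nat :: "nat \<Rightarrow> bool list" where
  "enc_nat n = enc_list (\<lambda>b. [b]) (binary_digits n)"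

definition enc_int :: "int \<Rightarrow> bool list" where
  "enc_int i = (i < 0) # enc_nat (nat \<bar>i\<bar>)"

definition enc_task :: "task \<Rightarrow> bool list" where
  "enc_task = (\<lambda>(d, bvs). enc_int d @ enc_list (\<lambda>(b, v). enc_nat b @ enc_nat v) bvs)"

definition enc_task_set :: "task_set \<Rightarrow> bool list" where
  "enc_task_set = enc_list enc_task"

definition numbers :: "task_set \<Rightarrow> nat set" where
  "numbers I = (\<Union>(d, bvs)\<in>set I. insert (nat \<bar>d\<bar>) (\<Union>(b, v)\<in>set bvs. {b, v}))"


subsection \<open>The encoding is injective\<close>

definition prefix_code :: "('a \<Rightarrow> bool list) \<Rightarrow> bool" where
  "prefix_code e \<longleftrightarrow> (\<forall>x y u v. e x @ u = e y @ v \<longrightarrow> x = y \<and> u = v)"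

lemma prefix_codeD: "prefix_code e \<Longrightarrow> e x @ u = e y @ v \<Longrightarrow> x = y \<and> u = v"
  by (simp add: prefix_code_def)

lemma prefix_code_enc_list:
  assumes "prefix_code e"
  shows "prefix_code (enc_list e)"
proof -
  have "xs = ys \<and> u = v" if "enc_list e xs @ u = enc_list e ys @ v" for xs ys u v
    using that
  proof (induction xs arbitrary: ys)
    case Nil
    then show ?case by (cases ys) (auto simp: enc_list_def)
  next
    case (Cons x xs)
    then obtain y ys' where ys: "ys = y # ys'" by (cases ys) (auto simp: enc_list_def)
    have "e x @ (enc_list e xs @ u) = e y @ (enc_list e ys' @ v)"
      using Cons.prems by (simp add: enc_list_def ys)
    then have "x = y" "enc_list e xs @ u = enc_list e ys' @ v"
      using assms unfolding prefix_code_def by blast+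
    then show ?case using Cons.IH ys by blast
  qed
  then show ?thesis unfolding prefix_code_def by blast
qed

lemma prefix_code_bit: "prefix_code (\<lambda>b. [b])"
  by (simp add: prefix_code_def)

lemma binary_digits_inject: "binary_digits m = binary_digits n \<Longrightarrow> m = n"
proof (induction m arbitrary: n rule: binary_digits.induct)
  case (1 m)
  show ?case
  proof (cases "m = 0 \<or> n = 0")
    case True
    then show ?thesis
      using "1.prems" by (auto simp: binary_digits.simps[of m] binary_digits.simps[of n] split: if_splits)
  next
    case False
    then have "odd m = odd n" "binary_digits (m div 2) = binary_digits (n div 2)"
      using "1.prems" by (auto simp: binary_digits.simps[of m] binary_digits.simps[of n])
    moreover from this have "m div 2 = n div 2" using "1.IH" False by blast
    ultimately show ?thesis by presburger
  qed
qed

lemma prefix_code_enc_nat: "prefix_code enc_nat"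
  using prefix_code_enc_list[OF prefix_code_bit] binary_digits_inject
  unfolding prefix_code_def enc_nat_def by blast

lemma prefix_code_enc_int: "prefix_code enc_int"
proof -
  have "x = y \<and> u = v" if "enc_int x @ u = enc_int y @ v" for x y u v
  proof -
    have "(x < 0) = (y < 0)" "enc_nat (nat \<bar>x\<bar>) @ u = enc_nat (nat \<bar>y\<bar>) @ v"
      using that by (auto simp: enc_int_def)
    moreover from this(2) have "nat \<bar>x\<bar> = nat \<bar>y\<bar>" "u = v"
      using prefix_code_enc_nat unfolding prefix_code_def by blast+
    ultimately show ?thesis by linarith
  qed
  then show ?thesis unfolding prefix_code_def by blast
qed

lemma prefix_code_prod:
  assumes "prefix_code e" "prefix_code f"
  shows "prefix_code (\<lambda>(x, y). e x @ f y)"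
  unfolding prefix_code_def
proof (intro allI impI)
  fix a b :: "'a \<times> 'b" and u v
  assume "(case a of (x, y) \<Rightarrow> e x @ f y) @ u = (case b of (x, y) \<Rightarrow> e x @ f y) @ v"
  then have "e (fst a) @ (f (snd a) @ u) = e (fst b) @ (f (snd b) @ v)"
    by (simp add: case_prod_beta)
  from prefix_codeD[OF assms(1) this] have "fst a = fst b" "f (snd a) @ u = f (snd b) @ v"
    by blast+
  with prefix_codeD[OF assms(2) this(2)] show "a = b \<and> u = v"
    by (simp add: prod_eq_iff)
qed

lemma inj_enc_task_set: "inj enc_task_set"
proof -
  have "prefix_code enc_task"
    unfolding enc_task_def
    by (intro prefix_code_prod prefix_code_enc_int prefix_code_enc_list prefix_code_enc_nat)
  then have "prefix_code enc_task_set"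
    unfolding enc_task_set_def by (rule prefix_code_enc_list)
  then show ?thesis by (intro injI) (use prefix_codeD[of enc_task_set _ "[]" _ "[]"] in simp)
qed


subsection \<open>Generality of the representation of execution times\<close>

lemma finite_exec_time_values: "finite {int v | b v. (b, v) \<in> set bvs \<and> real b \<le> t}"
  by (rule finite_subset[of _ "(int \<circ> snd) ` set bvs"]) force+

lemma exec_time_nonneg: "exec_time bvs t \<ge> 0"
  unfolding exec_time_def by (rule Max_ge) (simp_all add: finite_exec_time_values)

lemma exec_time_mono: "mono (exec_time bvs)"
  unfolding exec_time_def
  by (intro monoI Max_mono) (auto simp: finite_exec_time_values intro: order_trans)

lemma exec_time_table:
  fixes p :: "real \<Rightarrow> int"
  assumes nonneg: "\<And>t. t \<ge> 0 \<Longrightarrow> p t \<ge> 0" and mono: "mono_on {0..} p"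
    and t: "0 \<le> t" "t \<le> real_of_int d"
  shows "exec_time (map (\<lambda>b. (b, nat (p (real b)))) [0..<Suc (nat d)]) t = p (of_int \<lfloor>t\<rfloor>)"
proof -
  let ?bvs = "map (\<lambda>b. (b, nat (p (real b)))) [0..<Suc (nat d)]"
  let ?B = "{b. b < Suc (nat d) \<and> real b \<le> t}"
  have "{int v | b v. (b, v) \<in> set ?bvs \<and> real b \<le> t} = (\<lambda>b. int (nat (p (real b)))) ` ?B"
  proof -
    have "{int v | b v. (b, v) \<in> (\<lambda>b. (b, g b)) ` A \<and> Q b} = (\<lambda>b. int (g b)) ` {b \<in> A. Q b}"
      for g :: "nat \<Rightarrow> nat" and A Q
      by blast
    then show ?thesis by (simp only: set_map set_upt) (simp only: atLeastLessThan_iff zero_le simp_thms)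
  qed
  also have "\<dots> = (\<lambda>b. p (real b)) ` ?B"
    by (intro image_cong refl) (simp add: nonneg)
  finally have S: "exec_time ?bvs t = Max (insert 0 ((\<lambda>b. p (real b)) ` ?B))"
    unfolding exec_time_def by simp
  have fl: "real (nat \<lfloor>t\<rfloor>) = of_int \<lfloor>t\<rfloor>" using t by simp
  have "nat \<lfloor>t\<rfloor> \<le> nat d" using t by (intro nat_mono) linarith
  then have "nat \<lfloor>t\<rfloor> \<in> ?B" by (simp add: fl)
  then have mem: "p (of_int \<lfloor>t\<rfloor>) \<in> (\<lambda>b. p (real b)) ` ?B"
    by (rule rev_image_eqI) (simp only: fl)
  have le: "x \<le> p (of_int \<lfloor>t\<rfloor>)" if x: "x \<in> insert 0 ((\<lambda>b. p (real b)) ` ?B)" for x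
  proof (cases "x = 0")
    case True
    then show ?thesis using t nonneg[of "of_int \<lfloor>t\<rfloor>"] by simp
  next
    case False
    then obtain b where b: "x = p (real b)" "real b \<le> t" using x by blast
    then have "int b \<le> \<lfloor>t\<rfloor>" by (simp add: le_floor_iff)
    then have "real b \<le> of_int \<lfloor>t\<rfloor>" by linarith
    then show ?thesis unfolding b(1) using t by (intro mono_onD[OF mono]) simp_all
  qed
  have "finite ?B" by (rule finite_subset[of _ "{..<Suc (nat d)}"]) auto
  then have "finite (insert 0 ((\<lambda>b. p (real b)) ` ?B))" by simp
  then show ?thesis unfolding S using le mem by (intro Max_eqI) blast+
qed

lemma disjoint_intervals_iff:
  fixes a b c d :: real
  shows "{a..<b} \<inter> {c..<d} = {} \<longleftrightarrow> b \<le> a \<or> d \<le> c \<or> b \<le> c \<or> d \<le> a"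
  by (simp add: Int_atLeastLessThan) linarith

lemma feasible_schedule_mono:
  assumes "feasible_schedule J d p s"
    and "\<And>j. j \<in> J \<Longrightarrow> q j (s j) \<le> p j (s j)"
  shows "feasible_schedule J d q s"
proof -
  have "completion_time (q j) (s j) \<le> completion_time (p j) (s j)" if "j \<in> J" for j
    using assms(2)[OF that] by (simp add: completion_time_def)
  then have "{s j..<completion_time (q j) (s j)} \<subseteq> {s j..<completion_time (p j) (s j)}"
      "completion_time (q j) (s j) \<le> completion_time (p j) (s j)" if "j \<in> J" for j
    using that by auto
  then show ?thesis
    using assms(1) unfolding feasible_schedule_def disjoint_family_on_def
    by (blast intro: order_trans)
qed

lemma feasible_schedule_floor:
  assumes "feasible_schedule J d (\<lambda>j t. p j (of_int \<lfloor>t\<rfloor>)) s"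
  shows "feasible_schedule J d p (\<lambda>j. of_int \<lfloor>s j\<rfloor>)"
proof -
  have *: "of_int \<lfloor>x\<rfloor> + of_int k \<le> (of_int \<lfloor>y\<rfloor> :: real)" if "x + of_int k \<le> y"
    for x y :: real and k :: int
    using floor_mono[OF that] by (simp flip: of_int_add)
  have "of_int \<lfloor>s j\<rfloor> + of_int (p j (of_int \<lfloor>s j\<rfloor>)) \<le> (of_int (d j) :: real)" if "j \<in> J" for j
    using assms that *[of "s j" _ "of_int (d j)"]
    by (simp add: feasible_schedule_def completion_time_def)
  moreover have "0 \<le> (of_int \<lfloor>s j\<rfloor> :: real)" if "j \<in> J" for j
    using assms that by (simp add: feasible_schedule_def)
  moreover have "{of_int \<lfloor>s i\<rfloor>..<of_int \<lfloor>s i\<rfloor> + of_int (p i (of_int \<lfloor>s i\<rfloor>))} \<inter>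
      {of_int \<lfloor>s j\<rfloor>..<of_int \<lfloor>s j\<rfloor> + of_int (p j (of_int \<lfloor>s j\<rfloor>))} = ({} :: real set)"
    if "i \<in> J" "j \<in> J" "i \<noteq> j" for i j
  proof -
    let ?p = "\<lambda>j. real_of_int (p j (of_int \<lfloor>s j\<rfloor>))"
    have "{s i..<s i + ?p i} \<inter> {s j..<s j + ?p j} = {}"
      using assms that unfolding feasible_schedule_def disjoint_family_on_def completion_time_def
      by blast
    then have "?p i \<le> 0 \<or> ?p j \<le> 0 \<or> s i + ?p i \<le> s j \<or> s j + ?p j \<le> s i"
      unfolding disjoint_intervals_iff by linarith
    then show ?thesis
      using *[of "s i" _ "s j"] *[of "s j" _ "s i"] unfolding disjoint_intervals_iff by auto
  qed
  ultimately show ?thesis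
    unfolding feasible_schedule_def disjoint_family_on_def completion_time_def by blast
qed

lemma every_task_set_has_instance:
  fixes d :: "nat \<Rightarrow> int" and p :: "nat \<Rightarrow> real \<Rightarrow> int"
  assumes nonneg: "\<And>j t. j < n \<Longrightarrow> t \<ge> 0 \<Longrightarrow> p j t \<ge> 0"
    and mono: "\<And>j. j < n \<Longrightarrow> mono_on {0..} (p j)"
  obtains I :: task_set where "length I = n" "\<And>j. j < n \<Longrightarrow> fst (I ! j) = d j"
    "\<And>j k. j < n \<Longrightarrow> int k \<le> d j \<Longrightarrow> exec_time (snd (I ! j)) (real k) = p j (real k)"
    "schedulable I \<longleftrightarrow> (\<exists>s. feasible_schedule {..<n} d p s)"
proof
  define I :: task_set where
    "I = map (\<lambda>j. (d j, map (\<lambda>b. (b, nat (p j (real b)))) [0..<Suc (nat (d j))])) [0..<n]"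
  show len: "length I = n" by (simp add: I_def)
  show fst_I: "fst (I ! j) = d j" if "j < n" for j using that by (simp add: I_def)
  have table: "exec_time (snd (I ! j)) t = p j (of_int \<lfloor>t\<rfloor>)"
    if "j < n" "0 \<le> t" "t \<le> real_of_int (d j)" for j t
    using exec_time_table[OF nonneg[OF that(1)] mono[OF that(1)] that(2,3)] that(1)
    by (simp add: I_def del: upt_Suc)
  show "exec_time (snd (I ! j)) (real k) = p j (real k)" if "j < n" "int k \<le> d j" for j k
    using table[of j "real k"] that by simp
  let ?F = "feasible_schedule {..<n} d"
  let ?e = "\<lambda>j. exec_time (snd (I ! j))"
  have sched: "schedulable I \<longleftrightarrow> (\<exists>s. ?F ?e s)"
    unfolding schedulable_def len feasible_schedule_def using fst_I by simp
  have bound: "0 \<le> s j \<and> s j \<le> of_int (d j)"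
    if "?F q s" "j < n" "s j \<ge> 0 \<Longrightarrow> q j (s j) \<ge> 0" for q s j
    using that by (force simp: feasible_schedule_def completion_time_def)
  show "schedulable I \<longleftrightarrow> (\<exists>s. ?F p s)"
  proof
    assume "schedulable I"
    then obtain s where s: "?F ?e s" using sched by blast
    have "?F (\<lambda>j t. p j (of_int \<lfloor>t\<rfloor>)) s"
      using s by (rule feasible_schedule_mono)
        (use table bound[OF s] exec_time_nonneg in force)
    then show "\<exists>s. ?F p s" using feasible_schedule_floor by blast
  next
    assume "\<exists>s. ?F p s"
    then obtain s where s: "?F p s" by blast
    have "?F ?e s"
      using s
    proof (rule feasible_schedule_mono)
      fix j assume "j \<in> {..<n}"
      then have j: "j < n" by simp
      have b: "0 \<le> s j \<and> s j \<le> of_int (d j)" using bound[OF s j] nonneg[OF j] by blast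
      then have "p j (of_int \<lfloor>s j\<rfloor>) \<le> p j (s j)"
        by (intro mono_onD[OF mono[OF j]]) auto
      then show "?e j (s j) \<le> p j (s j)" using table[OF j] b by simp
    qed
    then show "schedulable I" using sched by blast
  qed
qed

end

theory Submission
  imports Defs
begin

text \<open>
  Polynomial-time computability is established through programs on stacks, which are compiled to
  Turing machines: a tape holds a stack whose top is under the head.  On top of these, a class of
  functions on binary trees (and, by encoding, on lists, pairs and unary numbers) closed under
  composition, case distinction and folds of polynomially bounded size makes polynomial time a
  matter of the shape of a definition.

  For membership in NP, execution times are integers that depend only on the integer part of the
  starting time, so the starting times of a schedule can be rounded down; they then serve as the
  certificate.

  For hardness, the run of a Turing machine on an input with an unknown witness is described by a
  formula in conjunctive normal form.  The formula is turned into a problem of filling bins exactly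
  with items, where a garbage bin takes the rest.  Finally, an item of size \<open>a\<close> becomes a task that
  takes time \<open>a * (k + 1)\<close> in the \<open>k\<close>-th bin, the bins being consecutive intervals of work; if the task no
  longer fits into a bin, it is charged at the rate of a later one.  With the rates increasing, a task
  that straddles the end of a bin costs strictly more than it would if the bin were filled
  exactly, so the common deadline can be met only by an exact packing.  Tasks of length 0
  are added until the number of tasks exceeds all numbers in the instance.
\<close>


text \<open>Numbers occur in two regimes. An arbitrary instance may contain numbers exponential in
  the length of its encoding, so the verifier works on binary digits; the reduction only creates
  numbers polynomial in its input, so it calculates in unary, where arithmetic is list manipulation,
  and it can afford to tabulate an execution time at every integer up to the common deadline.

  The packing problem descends from the classical reduction of satisfiability to three-dimensional
  matching: a wheel for each variable, whose two perfect coverings are the truth values. Matching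
  turns into arithmetic through sizes in a mixed radix without carries: the leading part forces two
  items into each bin, the next part their kinds, the rest their identities.

  The formula for a run is arranged so that a model has to assert everything true of the run but may
  assert more. Apart from the guess of the witness, its clauses only derive facts from facts, and
  acceptance forbids reading any symbol but 2 at the end.\<close>

definition polyb :: "(nat \<Rightarrow> nat) \<Rightarrow> bool" where
  "polyb T \<longleftrightarrow> (\<exists>p :: nat poly. \<forall>n. T n \<le> poly p n)"

text \<open>Coefficients in \<open>nat\<close> cannot be negative. Monotonicity allows a time bound
  to be evaluated at an upper bound for the size of an intermediate result.\<close>

lemma poly_nat_mono: "m \<le> n \<Longrightarrow> poly (p :: nat poly) m \<le> poly p n"
  by (induction p) (auto intro!: add_mono mult_mono)

lemma polyb_const: "polyb (\<lambda>_. c)"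
  unfolding polyb_def by (intro exI[of _ "[:c:]"]) simp

lemma polyb_id: "polyb (\<lambda>n. n)"
  unfolding polyb_def by (intro exI[of _ "[:0, 1:]"]) simp

lemma polyb_add: "polyb S \<Longrightarrow> polyb T \<Longrightarrow> polyb (\<lambda>n. S n + T n)"
  unfolding polyb_def by (metis add_mono poly_add)

lemma polyb_mult: "polyb S \<Longrightarrow> polyb T \<Longrightarrow> polyb (\<lambda>n. S n * T n)"
  unfolding polyb_def by (metis mult_le_mono poly_mult)

lemma polyb_comp:
  assumes "polyb S" "polyb T"
  shows "polyb (\<lambda>n. S (T n))"
proof -
  obtain p q :: "nat poly" where "\<forall>n. S n \<le> poly p n" "\<forall>n. T n \<le> poly q n"
    using assms unfolding polyb_def by blast
  then have "S (T n) \<le> poly (pcompose p q) n" for n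
    unfolding poly_pcompose by (meson le_trans poly_nat_mono)
  then show ?thesis unfolding polyb_def by blast
qed

lemma polyb_poly: "polyb T \<Longrightarrow> polyb (\<lambda>n. poly p (T n))"
  by (rule polyb_comp) (auto simp: polyb_def)

lemma polyb_Suc: "polyb T \<Longrightarrow> polyb (\<lambda>n. Suc (T n))"
  using polyb_add[OF polyb_const[of 1]] by simp

lemmas polyb_intros = polyb_const polyb_id polyb_add polyb_mult polyb_poly polyb_Suc


section \<open>Stack programs\<close>

datatype com = Skip | Push nat bool | Pop nat | Seq com com (infixr ";;" 60)
  | Case nat com com com | While nat com

type_synonym regs = "nat \<Rightarrow> bool list"

text \<open>The running time is the number of steps of the compiled Turing machine.\<close>

inductive exec :: "com \<Rightarrow> regs \<Rightarrow> nat \<Rightarrow> regs \<Rightarrow> bool" where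
  exec_Skip: "exec Skip s 1 s"
| exec_Push: "exec (Push r b) s 2 (s(r := b # s r))"
| exec_Pop: "exec (Pop r) s 1 (s(r := tl (s r)))"
| exec_Seq: "exec c s m s' \<Longrightarrow> exec d s' n s'' \<Longrightarrow> exec (c ;; d) s (m + n) s''"
| exec_Case_empty: "s r = [] \<Longrightarrow> exec c s n s' \<Longrightarrow> exec (Case r c d e) s (Suc n) s'"
| exec_Case_False: "s r = False # xs \<Longrightarrow> exec d s n s' \<Longrightarrow> exec (Case r c d e) s (Suc n) s'"
| exec_Case_True: "s r = True # xs \<Longrightarrow> exec e s n s' \<Longrightarrow> exec (Case r c d e) s (Suc n) s'"
| exec_While_empty: "s r = [] \<Longrightarrow> exec (While r c) s 1 s"
| exec_While: "s r \<noteq> [] \<Longrightarrow> exec c s m s' \<Longrightarrow> exec (While r c) s' n s'' \<Longrightarrow>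
    exec (While r c) s (Suc (m + n)) s''"

text \<open>A bound in place of the exact time of \<open>exec\<close>, so that branches of different
  lengths can share one bound.\<close>

definition runs :: "com \<Rightarrow> regs \<Rightarrow> nat \<Rightarrow> regs \<Rightarrow> bool" where
  "runs c s T s' \<longleftrightarrow> (\<exists>n\<le>T. exec c s n s')"

lemma runs_weaken: "runs c s T s' \<Longrightarrow> T \<le> T' \<Longrightarrow> s' = s'' \<Longrightarrow> runs c s T' s''"
  unfolding runs_def using le_trans by blast

lemma runs_Skip: "runs Skip s 1 s"
  unfolding runs_def using exec_Skip by blast

lemma runs_Push: "runs (Push r b) s 2 (s(r := b # s r))"
  unfolding runs_def using exec_Push by blast

lemma runs_Pop: "runs (Pop r) s 1 (s(r := tl (s r)))"
  unfolding runs_def using exec_Pop by blast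

lemma runs_Seq: "runs c s m s' \<Longrightarrow> runs d s' n s'' \<Longrightarrow> runs (c ;; d) s (m + n) s''"
  unfolding runs_def by (meson add_mono exec_Seq)

lemma runs_Case_empty: "s r = [] \<Longrightarrow> runs c s n s' \<Longrightarrow> runs (Case r c d e) s (Suc n) s'"
  unfolding runs_def by (meson Suc_le_mono exec_Case_empty)

lemma runs_Case_False: "s r = False # xs \<Longrightarrow> runs d s n s' \<Longrightarrow> runs (Case r c d e) s (Suc n) s'"
  unfolding runs_def by (meson Suc_le_mono exec_Case_False)

lemma runs_Case_True: "s r = True # xs \<Longrightarrow> runs e s n s' \<Longrightarrow> runs (Case r c d e) s (Suc n) s'"
  unfolding runs_def by (meson Suc_le_mono exec_Case_True)

lemma runs_While_empty: "s r = [] \<Longrightarrow> runs (While r c) s 1 s"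
  unfolding runs_def using exec_While_empty by blast

lemma runs_While: "s r \<noteq> [] \<Longrightarrow> runs c s m s' \<Longrightarrow> runs (While r c) s' n s'' \<Longrightarrow>
    runs (While r c) s (Suc (m + n)) s''"
  unfolding runs_def by (meson Suc_le_mono add_mono exec_While)

text \<open>A step adds at most one symbol to a stack. This is how a time bound becomes a bound on
  the size of the output, in \<open>PT_size\<close>.\<close>

lemma exec_length: "exec c s n s' \<Longrightarrow> length (s' r) \<le> length (s r) + n"
  by (induction rule: exec.induct) auto

lemma runs_length: "runs c s T s' \<Longrightarrow> length (s' r) \<le> length (s r) + T"
  unfolding runs_def using exec_length[of c s _ s' r] by fastforce

text \<open>\<open>Skip\<close> is charged with register 0 because its instruction names tape 0,
  which then has to exist.\<close>

primrec com_regs :: "com \<Rightarrow> nat set" where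
  "com_regs Skip = {0}"
| "com_regs (Push r b) = {r}"
| "com_regs (Pop r) = {r}"
| "com_regs (c ;; d) = com_regs c \<union> com_regs d"
| "com_regs (Case r c d e) = insert r (com_regs c \<union> com_regs d \<union> com_regs e)"
| "com_regs (While r c) = insert r (com_regs c)"

lemma finite_com_regs: "finite (com_regs c)"
  by (induction c) auto


section \<open>Compilation to Turing machines\<close>

text \<open>
  An instruction names a tape and maps the symbol read there to the symbol written, the head
  move, and the next address.  A stack is stored on a tape with its top under the head.
\<close>

type_synonym instr = "nat \<times> (nat \<Rightarrow> nat \<times> move \<times> nat)"

primrec com_size :: "com \<Rightarrow> nat" where
  "com_size Skip = 1"
| "com_size (Push r b) = 2"
| "com_size (Pop r) = 1"
| "com_size (c ;; d) = com_size c + com_size d"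
| "com_size (Case r c d e) = Suc (com_size c + com_size d + com_size e)"
| "com_size (While r c) = Suc (com_size c)"

text \<open>\<open>compile c l next\<close> is the code of \<open>c\<close> at address \<open>l\<close>, continuing at \<open>next\<close>.\<close>

primrec compile :: "com \<Rightarrow> nat \<Rightarrow> nat \<Rightarrow> instr list" where
  "compile Skip l next = [(0, \<lambda>a. (a, Move_Stay, next))]"
| "compile (Push r b) l next =
    [(r, \<lambda>a. (a, Move_Left, Suc l)), (r, \<lambda>a. (bit_symbol b, Move_Stay, next))]"
| "compile (Pop r) l next = [(r, \<lambda>a. (a, if a = 0 then Move_Stay else Move_Right, next))]"
| "compile (c ;; d) l next = compile c l (l + com_size c) @ compile d (l + com_size c) next"
| "compile (Case r c d e) l next =
    (let lc = Suc l; ld = lc + com_size c; le = ld + com_size d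
     in (r, \<lambda>a. (a, Move_Stay, if a = 0 then lc else if a = 1 then ld else le)) #
        compile c lc next @ compile d ld next @ compile e le next)"
| "compile (While r c) l next =
    (r, \<lambda>a. (a, Move_Stay, if a = 0 then next else Suc l)) # compile c (Suc l) l"

lemma length_compile [simp]: "length (compile c l next) = com_size c"
  by (induction c arbitrary: l "next") (auto simp: Let_def)

lemma com_size_pos: "com_size c > 0"
  by (induction c) auto

text \<open>Used for \<open>wf_tm\<close>: written symbols stay below 3, and when
  \<open>next\<close> is the end of the whole code, no jump leads beyond it.\<close>

lemma compile_targets:
  assumes "(r, f) \<in> set (compile c l next)" "a < 3"
  shows "r \<in> com_regs c \<and> (case f a of (w, m, l') \<Rightarrow> w < 3 \<and> (l' = next \<or> l' < l + com_size c))"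
  using assms
proof (induction c arbitrary: l "next")
  case (Seq c d)
  from Seq.prems(1) consider "(r, f) \<in> set (compile c l (l + com_size c))"
    | "(r, f) \<in> set (compile d (l + com_size c) next)" by auto
  then show ?case
  proof cases
    case 1
    from Seq.IH(1)[OF this Seq.prems(2)] com_size_pos[of d] show ?thesis by (auto split: prod.splits)
  next
    case 2
    from Seq.IH(2)[OF this Seq.prems(2)] show ?thesis by (auto split: prod.splits)
  qed
next
  case (Case x1 c d e)
  let ?l = "Suc l" let ?m = "?l + com_size c" let ?n = "?m + com_size d"
  from Case.prems(1) consider
      "r = x1" "f = (\<lambda>a. (a, Move_Stay, if a = 0 then ?l else if a = 1 then ?m else ?n))"
    | "(r, f) \<in> set (compile c ?l next)" | "(r, f) \<in> set (compile d ?m next)"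
    | "(r, f) \<in> set (compile e ?n next)"
    by (auto simp: Let_def)
  then show ?case
  proof cases
    case 1
    then show ?thesis using Case.prems com_size_pos[of c] com_size_pos[of d] com_size_pos[of e] by auto
  next
    case 2
    from Case.IH(1)[OF this Case.prems(2)] show ?thesis by (auto split: prod.splits)
  next
    case 3
    from Case.IH(2)[OF this Case.prems(2)] show ?thesis by (auto split: prod.splits)
  next
    case 4
    from Case.IH(3)[OF this Case.prems(2)] show ?thesis by (auto split: prod.splits)
  qed
next
  case (While x1 c)
  from While.prems(1) consider "r = x1" "f = (\<lambda>a. (a, Move_Stay, if a = 0 then next else Suc l))"
    | "(r, f) \<in> set (compile c (Suc l) l)" by auto
  then show ?case
  proof cases
    case 1
    then show ?thesis using While.prems com_size_pos[of c] by auto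
  next
    case 2
    from While.IH[OF this While.prems(2)] show ?thesis by (auto split: prod.splits)
  qed
qed (auto simp: bit_symbol_def)

text \<open>States are addresses, so the address just behind the code is the halting state. Tapes
  other than \<open>r\<close> rewrite the symbol that they read.\<close>

definition machine :: "nat \<Rightarrow> instr list \<Rightarrow> tm" where
  "machine k P = \<lparr>tapes = k, states = length P, symbols = 3,
     trans = \<lambda>q as. let (r, f) = P ! q; (w, m, q') = f (as ! r)
       in (q', (map (\<lambda>a. (a, Move_Stay)) as)[r := (w, m)])\<rparr>"

fun stack_symbol :: "bool list \<Rightarrow> nat \<Rightarrow> nat" where
  "stack_symbol [] i = 0"
| "stack_symbol (b # bs) 0 = bit_symbol b"
| "stack_symbol (b # bs) (Suc i) = stack_symbol bs i"

text \<open>Only the cells from the head rightwards count. A pop leaves its symbol behind, to the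
  left of the head, and a push overwrites whatever is there.\<close>

definition holds_stack :: "tape \<Rightarrow> bool list \<Rightarrow> bool" where
  "holds_stack = (\<lambda>(c, h) xs. \<forall>i. c (h + int i) = stack_symbol xs i)"

definition holds_regs :: "nat \<Rightarrow> tape list \<Rightarrow> regs \<Rightarrow> bool" where
  "holds_regs k ts s \<longleftrightarrow> length ts = k \<and> (\<forall>r<k. holds_stack (ts ! r) (s r))"

lemma map2_act_stay:
  "map2 act (map (\<lambda>a. (a, Move_Stay)) (map (\<lambda>(c, h). c h) ts)) ts = ts"
  by (induction ts) auto

lemma map2_act_update:
  "map2 act ((map (\<lambda>a. (a, Move_Stay)) (map (\<lambda>(c, h). c h) ts))[r := x]) ts =
   (if r < length ts then ts[r := act x (ts ! r)] else ts)"
  by (rule nth_equalityI) (auto simp: nth_list_update split: prod.splits)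

lemma step_machine:
  assumes "l < length P" "P ! l = (r, f)" "f (fst (ts ! r) (snd (ts ! r))) = (w, m, l')" "r < length ts"
  shows "step (machine k P) (l, ts) = (l', ts[r := act (w, m) (ts ! r)])"
  using assms map2_act_update[of ts r "(w, m)"]
  by (auto simp: machine_def Let_def case_prod_beta simp del: map_map)

declare step.simps [simp del]

lemma holds_regs_update:
  assumes "holds_regs k ts s" "holds_stack T xs"
  shows "holds_regs k (ts[r := T]) (s(r := xs))"
  using assms by (auto simp: holds_regs_def nth_list_update)

lemma holds_regs_nth: "holds_regs k ts s \<Longrightarrow> r < k \<Longrightarrow> holds_stack (ts ! r) (s r)"
  by (simp add: holds_regs_def)

lemma holds_stack_top: "holds_stack T xs \<Longrightarrow> fst T (snd T) = stack_symbol xs 0"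
  unfolding holds_stack_def by (auto split: prod.splits dest: spec[of _ 0])

lemma holds_stack_stay: "holds_stack T xs \<Longrightarrow> act (fst T (snd T), Move_Stay) T = T"
  by (cases T) simp

lemma holds_stack_pop:
  assumes "holds_stack T xs" "xs \<noteq> []"
  shows "holds_stack (act (a, Move_Right) T) (tl xs)"
proof -
  obtain c h where T: "T = (c, h)" by force
  obtain y ys where xs: "xs = y # ys" using assms by (cases xs) auto
  have "(c(h := a)) (h + 1 + int i) = stack_symbol ys i" for i
    using assms(1) unfolding holds_stack_def T xs by (auto dest!: spec[of _ "Suc i"] simp: algebra_simps)
  then show ?thesis unfolding holds_stack_def T xs by simp
qed

lemma holds_stack_push:
  assumes "holds_stack T xs"
  shows "holds_stack (act (bit_symbol b, Move_Stay) (act (fst T (snd T), Move_Left) T)) (b # xs)"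
proof -
  obtain c h where T: "T = (c, h)" by force
  have "(c(h - 1 := bit_symbol b)) (h - 1 + int i) = stack_symbol (b # xs) i" for i
    using assms unfolding holds_stack_def T by (cases i) (auto simp: algebra_simps)
  then show ?thesis unfolding holds_stack_def T by simp
qed

lemma funpow_Suc_app: "(f ^^ Suc n) x = (f ^^ n) (f x)"
  by (simp add: funpow_swap1)

lemma funpow_add_app: "(f ^^ (m + n)) x = (f ^^ n) ((f ^^ m) x)"
  by (metis add.commute comp_apply funpow_add)

definition has_code :: "instr list \<Rightarrow> nat \<Rightarrow> instr list \<Rightarrow> bool" where
  "has_code P l cs \<longleftrightarrow> (\<exists>us vs. P = us @ cs @ vs \<and> length us = l)"

lemma has_code_append:
  "has_code P l (cs @ ds) \<Longrightarrow> has_code P l cs \<and> has_code P (l + length cs) ds"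
  unfolding has_code_def by (metis append.assoc length_append)

lemma has_code_Cons:
  assumes "has_code P l (i # is)"
  shows "l < length P \<and> P ! l = i \<and> has_code P (Suc l) is"
proof -
  obtain us vs where P: "P = us @ (i # is) @ vs" and l: "length us = l"
    using assms unfolding has_code_def by blast
  have "P = (us @ [i]) @ is @ vs" "length (us @ [i]) = Suc l" using P l by auto
  then have "has_code P (Suc l) is" unfolding has_code_def by blast
  then show ?thesis using P l by auto
qed

lemma step_machine_stay:
  assumes "l < length P" "P ! l = (r, \<lambda>a. (a, Move_Stay, g a))" "r < k" "holds_regs k ts s"
  shows "step (machine k P) (l, ts) = (g (stack_symbol (s r) 0), ts)"
proof -
  have h: "holds_stack (ts ! r) (s r)" and len: "r < length ts"
    using assms(3,4) holds_regs_nth by (auto simp: holds_regs_def)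
  show ?thesis
    using step_machine[OF assms(1,2) _ len] holds_stack_stay[OF h] holds_stack_top[OF h] by simp
qed

lemma compile_correct:
  assumes "exec c s n s'" "has_code P l (compile c l next)" "com_regs c \<subseteq> {..<k}"
    "holds_regs k ts s"
  shows "\<exists>ts'. (step (machine k P) ^^ n) (l, ts) = (next, ts') \<and> holds_regs k ts' s'"
  using assms
proof (induction arbitrary: l "next" ts rule: exec.induct)
  case (exec_Skip s)
  then have "l < length P" "P ! l = (0, \<lambda>a. (a, Move_Stay, next))" "0 < k"
    using has_code_Cons by auto
  from step_machine_stay[OF this exec_Skip.prems(3)] exec_Skip.prems(3) show ?case by simp
next
  case (exec_Push r b s)
  let ?f = "\<lambda>a :: nat. (a, Move_Left, Suc l)"
  let ?g = "\<lambda>a :: nat. (bit_symbol b, Move_Stay, next)"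
  have c: "l < length P" "P ! l = (r, ?f)" "Suc l < length P" "P ! Suc l = (r, ?g)" "r < k"
    using exec_Push by (auto dest!: has_code_Cons)
  have len: "length ts = k" and h: "holds_stack (ts ! r) (s r)"
    using exec_Push.prems c holds_regs_nth by (auto simp: holds_regs_def)
  define T where "T = act (fst (ts ! r) (snd (ts ! r)), Move_Left) (ts ! r)"
  have 1: "step (machine k P) (l, ts) = (Suc l, ts[r := T])"
    using step_machine[OF c(1,2)] c(5) len by (simp add: T_def)
  have 2: "step (machine k P) (Suc l, ts[r := T]) = (next, ts[r := act (bit_symbol b, Move_Stay) T])"
    using step_machine[OF c(3,4), where ts = "ts[r := T]"] c(5) len by simp
  have "(step (machine k P) ^^ 2) (l, ts) = (next, ts[r := act (bit_symbol b, Move_Stay) T])"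
    using 1 2 by (simp add: numeral_2_eq_2)
  moreover have "holds_regs k (ts[r := act (bit_symbol b, Move_Stay) T]) (s(r := b # s r))"
    using holds_regs_update[OF exec_Push.prems(3) holds_stack_push[OF h, of b]] by (simp add: T_def)
  ultimately show ?case by blast
next
  case (exec_Pop r s)
  let ?f = "\<lambda>a :: nat. (a, if a = 0 then Move_Stay else Move_Right, next)"
  have c: "l < length P" "P ! l = (r, ?f)" "r < k" using exec_Pop has_code_Cons[of P l] by auto
  have len: "length ts = k" and h: "holds_stack (ts ! r) (s r)"
    using exec_Pop.prems c holds_regs_nth by (auto simp: holds_regs_def)
  define a where "a = fst (ts ! r) (snd (ts ! r))"
  define T where "T = act (a, if a = 0 then Move_Stay else Move_Right) (ts ! r)"
  have st: "step (machine k P) (l, ts) = (next, ts[r := T])"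
    using step_machine[OF c(1,2)] c(3) len by (simp add: T_def a_def)
  have "holds_stack T (tl (s r))"
  proof (cases "s r")
    case Nil
    then show ?thesis using holds_stack_top[OF h] holds_stack_stay[OF h] h by (auto simp: T_def a_def)
  next
    case (Cons b bs)
    then have "a \<noteq> 0" using holds_stack_top[OF h] by (simp add: bit_symbol_def a_def)
    then show ?thesis using holds_stack_pop[OF h] Cons by (simp add: T_def)
  qed
  from holds_regs_update[OF exec_Pop.prems(3) this, of r] show ?case using st by (simp add: fun_upd_def)
next
  case (exec_Seq c s m s' d n s'')
  let ?m = "l + com_size c"
  have code: "has_code P l (compile c l ?m)" "has_code P ?m (compile d ?m next)"
    using has_code_append[of P l "compile c l ?m"] exec_Seq.prems(1) by auto
  obtain ts1 where 1: "(step (machine k P) ^^ m) (l, ts) = (?m, ts1)" "holds_regs k ts1 s'"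
    using exec_Seq.IH(1)[OF code(1) _ exec_Seq.prems(3)] exec_Seq.prems by auto
  obtain ts2 where "(step (machine k P) ^^ n) (?m, ts1) = (next, ts2)" "holds_regs k ts2 s''"
    using exec_Seq.IH(2)[OF code(2) _ 1(2)] exec_Seq.prems by auto
  then show ?case using 1 by (auto simp: funpow_add_app)
next
  case (exec_Case_empty s r c n s' d e)
  let ?l = "Suc l" let ?m = "?l + com_size c" let ?n = "?m + com_size d"
  let ?f = "\<lambda>a :: nat. (a, Move_Stay, if a = 0 then ?l else if a = 1 then ?m else ?n)"
  have code: "l < length P" "P ! l = (r, ?f)" "has_code P ?l (compile c ?l next)"
    using exec_Case_empty.prems(1)
    by (auto simp: Let_def dest!: has_code_Cons has_code_append)
  have "step (machine k P) (l, ts) = (?l, ts)"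
    using step_machine_stay[OF code(1,2) _ exec_Case_empty.prems(3)] exec_Case_empty.prems(2) exec_Case_empty.hyps(1)
    by (simp add: bit_symbol_def)
  then show ?case
    using exec_Case_empty.IH[OF code(3) _ exec_Case_empty.prems(3)] exec_Case_empty.prems by (simp add: funpow_Suc_app del: funpow.simps)
next
  case (exec_Case_False s r xs d n s' c e)
  let ?l = "Suc l" let ?m = "?l + com_size c" let ?n = "?m + com_size d"
  let ?f = "\<lambda>a :: nat. (a, Move_Stay, if a = 0 then ?l else if a = 1 then ?m else ?n)"
  have code: "l < length P" "P ! l = (r, ?f)" "has_code P ?m (compile d ?m next)"
    using exec_Case_False.prems(1)
    by (auto simp: Let_def dest!: has_code_Cons has_code_append)
  have "step (machine k P) (l, ts) = (?m, ts)"
    using step_machine_stay[OF code(1,2) _ exec_Case_False.prems(3)] exec_Case_False.prems(2) exec_Case_False.hyps(1)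
    by (simp add: bit_symbol_def)
  then show ?case
    using exec_Case_False.IH[OF code(3) _ exec_Case_False.prems(3)] exec_Case_False.prems by (simp add: funpow_Suc_app del: funpow.simps)
next
  case (exec_Case_True s r xs e n s' c d)
  let ?l = "Suc l" let ?m = "?l + com_size c" let ?n = "?m + com_size d"
  let ?f = "\<lambda>a :: nat. (a, Move_Stay, if a = 0 then ?l else if a = 1 then ?m else ?n)"
  have code: "l < length P" "P ! l = (r, ?f)" "has_code P ?n (compile e ?n next)"
    using exec_Case_True.prems(1)
    by (auto simp: Let_def dest!: has_code_Cons has_code_append)
  have "step (machine k P) (l, ts) = (?n, ts)"
    using step_machine_stay[OF code(1,2) _ exec_Case_True.prems(3)] exec_Case_True.prems(2) exec_Case_True.hyps(1)
    by (simp add: bit_symbol_def)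
  then show ?case
    using exec_Case_True.IH[OF code(3) _ exec_Case_True.prems(3)] exec_Case_True.prems by (simp add: funpow_Suc_app del: funpow.simps)
next
  case (exec_While_empty s r c)
  let ?f = "\<lambda>a :: nat. (a, Move_Stay, if a = 0 then next else Suc l)"
  have code: "l < length P" "P ! l = (r, ?f)"
    using exec_While_empty.prems(1) has_code_Cons[of P l] by auto
  have "step (machine k P) (l, ts) = (next, ts)"
    using step_machine_stay[OF code _ exec_While_empty.prems(3)] exec_While_empty by simp
  then show ?case using exec_While_empty.prems by simp
next
  case (exec_While s r c m s' n s'')
  let ?f = "\<lambda>a :: nat. (a, Move_Stay, if a = 0 then next else Suc l)"
  have code: "l < length P" "P ! l = (r, ?f)" "has_code P (Suc l) (compile c (Suc l) l)"
    using exec_While.prems(1) has_code_Cons[of P l] by auto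
  have "stack_symbol (s r) 0 \<noteq> 0"
    using exec_While.hyps(1) by (cases "s r") (auto simp: bit_symbol_def)
  then have "step (machine k P) (l, ts) = (Suc l, ts)"
    using step_machine_stay[OF code(1,2) _ exec_While.prems(3)] exec_While.prems(2) by simp
  moreover obtain ts1 where 1: "(step (machine k P) ^^ m) (Suc l, ts) = (l, ts1)" "holds_regs k ts1 s'"
    using exec_While.IH(1)[OF code(3) _ exec_While.prems(3)] exec_While.prems by auto
  \<comment> \<open>The body is compiled with continuation \<open>l\<close>: the run is back at the
    test, with the same code to execute.\<close>
  moreover obtain ts2 where "(step (machine k P) ^^ n) (l, ts1) = (next, ts2)" "holds_regs k ts2 s''"
    using exec_While.IH(2)[OF exec_While.prems(1,2) 1(2)] by auto
  ultimately show ?case by (auto simp: funpow_Suc_app funpow_add_app simp del: funpow.simps)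
qed

definition input_regs :: "bool list \<Rightarrow> regs" where
  "input_regs x = (\<lambda>_. [])(0 := x)"

lemma stack_symbol_nth:
  "stack_symbol xs i = (if i < length xs then bit_symbol (xs ! i) else 0)"
  by (induction xs i rule: stack_symbol.induct) auto

lemma polytime_computable_if_runs:
  assumes "polyb T" and "\<And>x. \<exists>s. runs c (input_regs x) (T (length x)) s \<and> s 0 = f x"
  shows "polytime_computable f"
proof -
  obtain p :: "nat poly" where p: "\<And>n. T n \<le> poly p n" using assms(1) unfolding polyb_def by blast
  obtain k where k: "com_regs c \<subseteq> {..<k}" "k \<ge> 1"
  proof -
    obtain b where "com_regs c \<subseteq> {..<b}" using finite_com_regs[of c] finite_nat_iff_bounded by blast
    then show ?thesis using that[of "Suc b"] by fastforce
  qed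
  define P where "P = compile c 0 (com_size c)"
  let ?M = "machine k P"
  have sel [simp]: "tapes ?M = k" "states ?M = com_size c" "symbols ?M = 3"
    by (simp_all add: machine_def P_def)
  have wf: "wf_tm ?M"
    unfolding wf_tm_def
  proof (intro conjI allI impI)
    fix q as
    assume as: "q < states ?M \<and> length as = tapes ?M \<and> (\<forall>a\<in>set as. a < symbols ?M)"
    obtain r f where rf: "P ! q = (r, f)" by force
    have mem: "(r, f) \<in> set (compile c 0 (com_size c))"
      using as rf nth_mem[of q P] unfolding sel by (simp add: P_def)
    have "r < k" using compile_targets[OF mem, of 0] k by auto
    then have "as ! r < 3" using as by simp
    from compile_targets[OF mem this] obtain w m q' where
      f: "f (as ! r) = (w, m, q')" and b: "w < 3" "q' \<le> com_size c"
      by (auto split: prod.splits)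
    show "case trans ?M q as of (q', acts) \<Rightarrow>
        q' \<le> states ?M \<and> length acts = tapes ?M \<and> (\<forall>(a, m)\<in>set acts. a < symbols ?M)"
      using as b f rf unfolding sel by (auto simp: machine_def dest!: set_update_subset_insert[THEN subsetD])
  qed (use k in auto)
  have "\<exists>t\<le>poly p (length x). halts_with ?M ((step ?M ^^ t) (init_config ?M x)) (f x)" for x
  proof -
    obtain n s where s: "exec c (input_regs x) n s" "n \<le> T (length x)" "s 0 = f x"
      using assms(2)[of x] unfolding runs_def by blast
    let ?ts = "input_tape x # replicate (k - 1) (\<lambda>_. 0, 0)"
    have "holds_regs k ?ts (input_regs x)"
      using k(2) by (auto simp: holds_regs_def holds_stack_def input_regs_def input_tape_def
        nth_Cons' stack_symbol_nth)
    moreover have "has_code P 0 (compile c 0 (com_size c))"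
      unfolding has_code_def P_def by auto
    ultimately obtain ts where ts: "(step ?M ^^ n) (0, ?ts) = (com_size c, ts)" "holds_regs k ts s"
      using compile_correct[OF s(1) _ k(1)] by blast
    have "holds_stack (hd ts) (f x)"
      using ts(2) k(2) s(3) holds_regs_nth[of k ts s 0] by (cases ts) (auto simp: holds_regs_def)
    then have "has_output (hd ts) (f x)"
      unfolding has_output_def holds_stack_def by (auto simp: stack_symbol_nth)
    then have "halts_with ?M ((step ?M ^^ n) (init_config ?M x)) (f x)"
      using ts by (simp add: halts_with_def init_config_def)
    then show ?thesis using s(2) p[of "length x"] le_trans by blast
  qed
  then show ?thesis unfolding polytime_computable_def using wf by blast
qed


section \<open>Polynomial-time functions on trees\<close>

datatype tree = Leaf | Node tree tree

text \<open>Preorder with one bit per node. The code is self-delimiting, so concatenated trees on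
  one stack can be told apart without separators.\<close>

primrec ser :: "tree \<Rightarrow> bool list" where
  "ser Leaf = [False]"
| "ser (Node a b) = True # ser a @ ser b"

primrec left :: "tree \<Rightarrow> tree" where
  "left Leaf = Leaf"
| "left (Node a b) = a"

primrec right :: "tree \<Rightarrow> tree" where
  "right Leaf = Leaf"
| "right (Node a b) = b"

abbreviation tsize :: "tree \<Rightarrow> nat" where
  "tsize t \<equiv> length (ser t)"

text \<open>Both ends are \<open>input_regs\<close>: scratch registers are handed back empty, so
  that programs can be run one after the other.\<close>

definition PT :: "(tree \<Rightarrow> tree) \<Rightarrow> bool" where
  "PT f \<longleftrightarrow> (\<exists>c T. polyb T \<and> (\<forall>t. runs c (input_regs (ser t)) (T (tsize t)) (input_regs (ser (f t)))))"

lemma tsize_pos: "tsize t > 0"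
  by (cases t) auto

lemma ser_inject: "ser s @ u = ser t @ v \<Longrightarrow> s = t \<and> u = v"
proof (induction s arbitrary: t u v)
  case Leaf
  then show ?case by (cases t) auto
next
  case (Node a b)
  obtain a' b' where t: "t = Node a' b'" using Node.prems by (cases t) auto
  then have "ser a @ ser b @ u = ser a' @ ser b' @ v" using Node.prems by simp
  from Node.IH(1)[OF this] have "a = a'" "ser b @ u = ser b' @ v" by blast+
  with Node.IH(2)[OF this(2)] t show ?case by simp
qed


subsection \<open>Register transfer\<close>

definition mv :: "nat \<Rightarrow> nat \<Rightarrow> com" where
  "mv a b = While a (Case a Skip (Pop a ;; Push b False) (Pop a ;; Push b True))"

lemma runs_mv_step:
  assumes "s a = x # xs"
  shows "runs (Case a Skip (Pop a ;; Push b False) (Pop a ;; Push b True)) s 4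
    ((s(a := xs))(b := x # (s(a := xs)) b))"
proof -
  have "runs (Pop a ;; Push b x) s 3 ((s(a := xs))(b := x # (s(a := xs)) b))"
    by (rule runs_weaken[OF runs_Seq[OF runs_Pop runs_Push]]) (use assms in auto)
  then show ?thesis using assms by (cases x) (auto dest: runs_Case_False runs_Case_True)
qed

lemma runs_mv:
  assumes "a \<noteq> b"
  shows "runs (mv a b) s (5 * length (s a) + 1) (s(a := [], b := rev (s a) @ s b))"
proof (induction "s a" arbitrary: s)
  case Nil
  then show ?case
    unfolding mv_def by (intro runs_weaken[OF runs_While_empty]) (auto simp: fun_eq_iff)
next
  case (Cons x xs)
  define s' where "s' = s(a := xs, b := x # s b)"
  have 1: "runs (Case a Skip (Pop a ;; Push b False) (Pop a ;; Push b True)) s 4 s'"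
    using runs_mv_step[of s a x xs b] Cons(2) assms by (simp add: s'_def)
  have 2: "runs (mv a b) s' (5 * length xs + 1) (s'(a := [], b := rev xs @ s' b))"
    using Cons(1)[of s'] assms by (simp add: s'_def)
  show ?case
    unfolding mv_def
    by (rule runs_weaken[OF runs_While[OF _ 1 2[unfolded mv_def]]])
      (use Cons(2)[symmetric] assms in \<open>auto simp: s'_def\<close>)
qed

definition mv2 :: "nat \<Rightarrow> nat \<Rightarrow> nat \<Rightarrow> com" where
  "mv2 a b d = While a (Case a Skip (Pop a ;; Push b False ;; Push d False)
     (Pop a ;; Push b True ;; Push d True))"

lemma runs_mv2:
  assumes "a \<noteq> b" "a \<noteq> d" "b \<noteq> d"
  shows "runs (mv2 a b d) s (7 * length (s a) + 1)
    (s(a := [], b := rev (s a) @ s b, d := rev (s a) @ s d))"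
proof (induction "s a" arbitrary: s)
  case Nil
  then show ?case
    unfolding mv2_def by (intro runs_weaken[OF runs_While_empty]) (auto simp: fun_eq_iff)
next
  case (Cons x xs)
  define s' where "s' = s(a := xs, b := x # s b, d := x # s d)"
  have "runs (Pop a ;; Push b x ;; Push d x) s 5 s'"
    using runs_Seq[OF runs_Pop[of a s] runs_Seq[OF runs_Push[of b x] runs_Push[of d x]]]
      Cons(2)[symmetric] assms by (simp add: s'_def)
  then have 1: "runs (Case a Skip (Pop a ;; Push b False ;; Push d False)
      (Pop a ;; Push b True ;; Push d True)) s 6 s'"
    using Cons(2)[symmetric] by (cases x) (auto dest: runs_Case_False runs_Case_True)
  have 2: "runs (mv2 a b d) s' (7 * length xs + 1)
      (s'(a := [], b := rev xs @ s' b, d := rev xs @ s' d))"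
    using Cons(1)[of s'] assms by (simp add: s'_def)
  show ?case
    unfolding mv2_def
    by (rule runs_weaken[OF runs_While[OF _ 1 2[unfolded mv2_def]]])
      (use Cons(2)[symmetric] assms in \<open>auto simp: s'_def\<close>)
qed

definition clr :: "nat \<Rightarrow> com" where
  "clr a = While a (Pop a)"

lemma runs_clr: "runs (clr a) s (2 * length (s a) + 1) (s(a := []))"
proof (induction "s a" arbitrary: s)
  case Nil
  then show ?case
    unfolding clr_def by (intro runs_weaken[OF runs_While_empty]) (auto simp: fun_eq_iff)
next
  case (Cons x xs)
  define s' where "s' = s(a := xs)"
  have 1: "runs (Pop a) s 1 s'" using runs_Pop[of a s] Cons(2)[symmetric] by (simp add: s'_def)
  have 2: "runs (clr a) s' (2 * length xs + 1) (s'(a := []))"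
    using Cons(1)[of s'] by (simp add: s'_def)
  show ?case
    unfolding clr_def
    by (rule runs_weaken[OF runs_While[OF _ 1 2[unfolded clr_def]]])
      (use Cons(2)[symmetric] in \<open>auto simp: s'_def\<close>)
qed

text \<open>Moving reverses a stack; the second move, into both \<open>a\<close> and
  \<open>b\<close>, restores the order.\<close>

definition copy :: "nat \<Rightarrow> nat \<Rightarrow> nat \<Rightarrow> com" where
  "copy a b d = mv a d ;; mv2 d a b"

lemma runs_copy:
  assumes "a \<noteq> b" "a \<noteq> d" "b \<noteq> d" "s b = []" "s d = []"
  shows "runs (copy a b d) s (12 * length (s a) + 2) (s(b := s a))"
  unfolding copy_def
  by (rule runs_weaken[OF runs_Seq[OF runs_mv runs_mv2]]) (use assms in \<open>auto simp: fun_eq_iff\<close>)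

primrec pushes :: "nat \<Rightarrow> bool list \<Rightarrow> com" where
  "pushes r [] = Skip"
| "pushes r (x # xs) = Push r x ;; pushes r xs"

lemma runs_pushes: "runs (pushes r xs) s (2 * length xs + 1) (s(r := rev xs @ s r))"
proof (induction xs arbitrary: s)
  case Nil
  show ?case using runs_Skip[of s] by simp
next
  case (Cons x xs)
  show ?case
    unfolding pushes.simps by (rule runs_weaken[OF runs_Seq[OF runs_Push Cons]]) (auto simp: fun_eq_iff)
qed


subsection \<open>Renaming of registers\<close>

primrec ren :: "(nat \<Rightarrow> nat) \<Rightarrow> com \<Rightarrow> com" where
  "ren \<rho> Skip = Skip"
| "ren \<rho> (Push r b) = Push (\<rho> r) b"
| "ren \<rho> (Pop r) = Pop (\<rho> r)"
| "ren \<rho> (c ;; d) = ren \<rho> c ;; ren \<rho> d"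
| "ren \<rho> (Case r c d e) = Case (\<rho> r) (ren \<rho> c) (ren \<rho> d) (ren \<rho> e)"
| "ren \<rho> (While r c) = While (\<rho> r) (ren \<rho> c)"

text \<open>A frame rule: a program written for register 0 and some scratch registers can run amid
  other data, as registers outside the range of \<open>\<rho>\<close> keep their contents.\<close>

lemma exec_ren:
  assumes "exec c s n s'" "inj \<rho>" "\<And>r. S (\<rho> r) = s r"
  shows "\<exists>S'. exec (ren \<rho> c) S n S' \<and> (\<forall>r. S' (\<rho> r) = s' r) \<and> (\<forall>r. r \<notin> range \<rho> \<longrightarrow> S' r = S r)"
  using assms
proof (induction arbitrary: S rule: exec.induct)
  case (exec_Skip s)
  then show ?case using exec.exec_Skip by auto
next
  case (exec_Push r b s)
  then show ?case
    using exec.exec_Push[of "\<rho> r" b S]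
    by (intro exI[of _ "S(\<rho> r := b # S (\<rho> r))"]) (auto simp: inj_eq simp del: fun_upd_apply simp: fun_upd_def)
next
  case (exec_Pop r s)
  then show ?case
    using exec.exec_Pop[of "\<rho> r" S]
    by (intro exI[of _ "S(\<rho> r := tl (S (\<rho> r)))"]) (auto simp: inj_eq simp del: fun_upd_apply simp: fun_upd_def)
next
  case (exec_Seq c s m s' d n s'')
  obtain S1 where S1: "exec (ren \<rho> c) S m S1" "\<forall>r. S1 (\<rho> r) = s' r" "\<forall>r. r \<notin> range \<rho> \<longrightarrow> S1 r = S r"
    using exec_Seq.IH(1)[OF exec_Seq.prems] by blast
  obtain S2 where S2: "exec (ren \<rho> d) S1 n S2" "\<forall>r. S2 (\<rho> r) = s'' r"
      "\<forall>r. r \<notin> range \<rho> \<longrightarrow> S2 r = S1 r"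
    using exec_Seq.IH(2)[OF exec_Seq.prems(1) S1(2)[rule_format]] by blast
  from exec.exec_Seq[OF S1(1) S2(1)] S1 S2 show ?case by auto
next
  case (exec_Case_empty s r c n s' d e)
  from exec_Case_empty.IH[OF exec_Case_empty.prems] obtain S' where S': "exec (ren \<rho> c) S n S'"
      "\<forall>r. S' (\<rho> r) = s' r" "\<forall>r. r \<notin> range \<rho> \<longrightarrow> S' r = S r"
    by blast
  have "exec (ren \<rho> (Case r c d e)) S (Suc n) S'"
    unfolding ren.simps by (rule exec.exec_Case_empty[OF _ S'(1)]) (use exec_Case_empty in simp)
  then show ?case using S'(2,3) by blast
next
  case (exec_Case_False s r xs d n s' c e)
  from exec_Case_False.IH[OF exec_Case_False.prems] obtain S' where S': "exec (ren \<rho> d) S n S'"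
      "\<forall>r. S' (\<rho> r) = s' r" "\<forall>r. r \<notin> range \<rho> \<longrightarrow> S' r = S r"
    by blast
  have "exec (ren \<rho> (Case r c d e)) S (Suc n) S'"
    unfolding ren.simps by (rule exec.exec_Case_False[OF _ S'(1)]) (use exec_Case_False in simp)
  then show ?case using S'(2,3) by blast
next
  case (exec_Case_True s r xs e n s' c d)
  from exec_Case_True.IH[OF exec_Case_True.prems] obtain S' where S': "exec (ren \<rho> e) S n S'"
      "\<forall>r. S' (\<rho> r) = s' r" "\<forall>r. r \<notin> range \<rho> \<longrightarrow> S' r = S r"
    by blast
  have "exec (ren \<rho> (Case r c d e)) S (Suc n) S'"
    unfolding ren.simps by (rule exec.exec_Case_True[OF _ S'(1)]) (use exec_Case_True in simp)
  then show ?case using S'(2,3) by blast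
next
  case (exec_While_empty s r c)
  have "exec (ren \<rho> (While r c)) S 1 S"
    unfolding ren.simps by (rule exec.exec_While_empty) (use exec_While_empty in simp)
  then show ?case using exec_While_empty.prems by blast
next
  case (exec_While s r c m s' n s'')
  obtain S1 where S1: "exec (ren \<rho> c) S m S1" "\<forall>r. S1 (\<rho> r) = s' r" "\<forall>r. r \<notin> range \<rho> \<longrightarrow> S1 r = S r"
    using exec_While.IH(1)[OF exec_While.prems] by blast
  obtain S2 where S2: "exec (ren \<rho> (While r c)) S1 n S2" "\<forall>r. S2 (\<rho> r) = s'' r"
      "\<forall>r. r \<notin> range \<rho> \<longrightarrow> S2 r = S1 r"
    using exec_While.IH(2)[OF exec_While.prems(1) S1(2)[rule_format]] by blast
  have "S (\<rho> r) \<noteq> []" using exec_While.hyps(1) exec_While.prems(2) by simp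
  from exec.exec_While[OF this S1(1)] S1 S2 show ?case by auto
qed

text \<open>\<open>on_reg a b c\<close> runs \<open>c\<close> on register \<open>a\<close>, with the registers beyond \<open>b\<close> as scratch space.\<close>

definition on_reg :: "nat \<Rightarrow> nat \<Rightarrow> com \<Rightarrow> com" where
  "on_reg a b c = ren (\<lambda>i. if i = 0 then a else i + b) c"

lemma runs_on_reg:
  assumes "runs c (input_regs (s a)) T (input_regs y)" "a \<le> b" "\<And>r. r > b \<Longrightarrow> s r = []"
  shows "runs (on_reg a b c) s T (s(a := y))"
proof -
  let ?\<rho> = "\<lambda>i. if i = 0 then a else i + b"
  obtain n where n: "n \<le> T" "exec c (input_regs (s a)) n (input_regs y)"
    using assms(1) unfolding runs_def by blast
  have "inj ?\<rho>" using assms(2) by (auto simp: inj_def)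
  have s: "s (?\<rho> r) = input_regs (s a) r" for r
    using assms(3) by (simp add: input_regs_def)
  obtain S' where S': "exec (on_reg a b c) s n S'" "\<And>r. S' (?\<rho> r) = input_regs y r"
      "\<And>r. r \<notin> range ?\<rho> \<Longrightarrow> S' r = s r"
    unfolding on_reg_def
    using exec_ren[OF n(2) \<open>inj ?\<rho>\<close>, of s] s by blast
  have "S' r = (s(a := y)) r" for r
  proof -
    consider "r = a" | "r \<noteq> a" "r \<le> b" | "r > b" using assms(2) by linarith
    then show ?thesis
    proof cases
      case 1
      then show ?thesis using S'(2)[of 0] by (simp add: input_regs_def)
    next
      case 2
      then have "r \<notin> range ?\<rho>" by auto
      then show ?thesis using S'(3) 2 by simp
    next
      case 3
      then show ?thesis using S'(2)[of "r - b"] assms(2,3) by (simp add: input_regs_def)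
    qed
  qed
  then have "S' = s(a := y)" by blast
  then show ?thesis using S'(1) n(1) unfolding runs_def by blast
qed


subsection \<open>Closure properties\<close>

lemma PT_E:
  assumes "PT f"
  obtains c p where "\<forall>t. runs c (input_regs (ser t)) (poly p (tsize t)) (input_regs (ser (f t)))"
proof -
  obtain c T where T: "polyb T" and
      c: "\<forall>t. runs c (input_regs (ser t)) (T (tsize t)) (input_regs (ser (f t)))"
    using assms[unfolded PT_def] by (elim exE conjE) (rule that)
  obtain p where p: "\<forall>n. T n \<le> poly p n" using T[unfolded polyb_def] by (elim exE) (rule that)
  have "\<forall>t. runs c (input_regs (ser t)) (poly p (tsize t)) (input_regs (ser (f t)))"
    using runs_weaken[OF c[rule_format] p[rule_format] refl] by (rule allI)
  then show ?thesis by (rule that)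
qed

lemma PT_on_reg_E:
  assumes "PT f"
  obtains c p where "\<forall>a b s t. s a = ser t \<longrightarrow> a \<le> b \<longrightarrow> (\<forall>r>b. s r = []) \<longrightarrow>
    runs (on_reg a b c) s (poly p (tsize t)) (s(a := ser (f t)))"
proof -
  obtain c p where c: "\<forall>t. runs c (input_regs (ser t)) (poly p (tsize t)) (input_regs (ser (f t)))"
    by (rule PT_E[OF assms])
  have "\<forall>a b s t. s a = ser t \<longrightarrow> a \<le> b \<longrightarrow> (\<forall>r>b. s r = []) \<longrightarrow>
    runs (on_reg a b c) s (poly p (tsize t)) (s(a := ser (f t)))"
    by (intro allI impI runs_on_reg) (simp_all add: c)
  then show ?thesis by (rule that)
qed

lemma PT_I:
  assumes "\<And>t. runs c (input_regs (ser t)) (T (tsize t)) (input_regs (ser (f t)))" "polyb T"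
  shows "PT f"
  using assms unfolding PT_def by blast

lemma PT_size:
  assumes "PT f"
  obtains p :: "nat poly" where "\<And>t. tsize (f t) \<le> poly p (tsize t)"
proof -
  obtain c p where *: "\<And>t. runs c (input_regs (ser t)) (poly p (tsize t)) (input_regs (ser (f t)))"
    by (rule PT_E[OF assms]) blast
  have "tsize (f t) \<le> poly ([:0, 1:] + p) (tsize t)" for t
    using runs_length[OF *[of t], of 0] by (simp add: input_regs_def)
  then show ?thesis using that by blast
qed

lemma input_regs_simps [simp]:
  "input_regs x 0 = x" "r \<noteq> 0 \<Longrightarrow> input_regs x r = []" "(input_regs x)(0 := y) = input_regs y"
  by (auto simp: input_regs_def)

lemma PT_id: "PT (\<lambda>t. t)"
  by (rule PT_I[OF runs_Skip]) (rule polyb_intros)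

lemma PT_comp:
  assumes "PT f" "PT g"
  shows "PT (\<lambda>t. f (g t))"
proof -
  obtain c p where c: "\<forall>t. runs c (input_regs (ser t)) (poly p (tsize t)) (input_regs (ser (f t)))"
    by (rule PT_E[OF assms(1)])
  note c = c[rule_format]
  obtain d q where d: "\<forall>t. runs d (input_regs (ser t)) (poly q (tsize t)) (input_regs (ser (g t)))"
    by (rule PT_E[OF assms(2)])
  note d = d[rule_format]
  obtain r where r: "\<And>t. tsize (g t) \<le> poly r (tsize t)" by (rule PT_size[OF assms(2)]) blast
  show ?thesis
  proof (rule PT_I)
    show "runs (d ;; c) (input_regs (ser t)) (poly q (tsize t) + poly p (poly r (tsize t)))
        (input_regs (ser (f (g t))))" for t
      by (rule runs_weaken[OF runs_Seq[OF d c]]) (auto intro: poly_nat_mono r)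
  qed (intro polyb_intros)
qed

lemma PT_const: "PT (\<lambda>_. u)"
proof (rule PT_I)
  show "runs (clr 0 ;; pushes 0 (rev (ser u))) (input_regs (ser t))
      (2 * tsize t + 1 + (2 * tsize u + 1)) (input_regs (ser u))" for t
    by (rule runs_weaken[OF runs_Seq[OF runs_clr runs_pushes]]) auto
qed (intro polyb_intros)

text \<open>The right subtree is computed in place in register 0. The left one is computed from a
  copy in register 1 and put in front by two moves whose reversals cancel.\<close>

lemma PT_Node:
  assumes "PT f" "PT g"
  shows "PT (\<lambda>t. Node (f t) (g t))"
proof -
  obtain c p where c: "\<forall>a b s t. s a = ser t \<longrightarrow> a \<le> b \<longrightarrow> (\<forall>r>b. s r = []) \<longrightarrow>
    runs (on_reg a b c) s (poly p (tsize t)) (s(a := ser (f t)))"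
    by (rule PT_on_reg_E[OF assms(1)])
  note c = c[rule_format]
  obtain d q where d: "\<forall>a b s t. s a = ser t \<longrightarrow> a \<le> b \<longrightarrow> (\<forall>r>b. s r = []) \<longrightarrow>
    runs (on_reg a b d) s (poly q (tsize t)) (s(a := ser (g t)))"
    by (rule PT_on_reg_E[OF assms(2)])
  note d = d[rule_format]
  obtain r where r: "\<And>t. tsize (f t) \<le> poly r (tsize t)" by (rule PT_size[OF assms(1)]) blast
  show ?thesis
  proof (rule PT_I)
    fix t
    let ?i = "input_regs (ser t)" and ?j = "input_regs (ser (g t))"
    let ?f = "ser (f t)"
    have 1: "runs (copy 0 1 2) ?i (12 * tsize t + 2) (?i(1 := ser t))"
      using runs_copy[of 0 1 2 ?i] by simp
    have 2: "runs (on_reg 0 1 d) (?i(1 := ser t)) (poly q (tsize t)) (?j(1 := ser t))"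
      by (rule runs_weaken[OF d]) (auto simp: fun_eq_iff input_regs_def)
    have 3: "runs (on_reg 1 1 c) (?j(1 := ser t)) (poly p (tsize t)) (?j(1 := ?f))"
      by (rule runs_weaken[OF c]) auto
    have 4: "runs (mv 1 2) (?j(1 := ?f)) (5 * tsize (f t) + 1) (?j(2 := rev ?f))"
      by (rule runs_weaken[OF runs_mv]) (auto simp: fun_eq_iff)
    have 5: "runs (mv 2 0) (?j(2 := rev ?f)) (5 * tsize (f t) + 1) (input_regs (?f @ ser (g t)))"
      by (rule runs_weaken[OF runs_mv]) (auto simp: fun_eq_iff input_regs_def)
    have 6: "runs (Push 0 True) (input_regs (?f @ ser (g t))) 2 (input_regs (ser (Node (f t) (g t))))"
      by (rule runs_weaken[OF runs_Push]) (auto simp: input_regs_def)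
    show "runs (copy 0 1 2 ;; on_reg 0 1 d ;; on_reg 1 1 c ;; mv 1 2 ;; mv 2 0 ;; Push 0 True) ?i
        (12 * tsize t + 2 + (poly q (tsize t) + (poly p (tsize t) + (5 * poly r (tsize t) + 1 +
          (5 * poly r (tsize t) + 1 + 2))))) (input_regs (ser (Node (f t) (g t))))"
      by (rule runs_weaken[OF runs_Seq[OF 1 runs_Seq[OF 2 runs_Seq[OF 3 runs_Seq[OF 4 runs_Seq[OF 5 6]]]]]])
        (use r[of t] in auto)
  qed (intro polyb_intros)
qed

text \<open>Register 2 counts, in unary, the subtrees that are still to be read.\<close>

definition read_body :: com where
  "read_body = Case 0 Skip (Pop 0 ;; Push 1 False ;; Pop 2) (Pop 0 ;; Push 1 True ;; Push 2 True)"

definition read_tree :: com where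
  "read_tree = Push 2 True ;; While 2 read_body"

text \<open>The induction needs a whole forest of pending trees: a leaf bit removes its first tree,
  a node bit replaces it by two subtrees, and the remaining code shrinks by one bit either
  way.\<close>

lemma runs_read_loop:
  assumes "s 0 = concat (map ser ts) @ u" "s 2 = replicate (length ts) True"
  shows "runs (While 2 read_body) s (7 * length (concat (map ser ts)) + 1)
    (s(0 := u, 1 := rev (concat (map ser ts)) @ s 1, 2 := []))"
  using assms
proof (induction "length (concat (map ser ts))" arbitrary: ts s rule: less_induct)
  case less
  show ?case
  proof (cases ts)
    case Nil
    then have "s(0 := u, 1 := rev (concat (map ser ts)) @ s 1, 2 := []) = s"
      using less.prems by (auto simp: fun_eq_iff)
    then show ?thesis using Nil less.prems runs_While_empty[of s 2] by simp
  next
    case (Cons t ts')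
    show ?thesis
    proof (cases t)
      case Leaf
      let ?v = "concat (map ser ts')"
      define s' where "s' = s(0 := ?v @ u, 1 := False # s 1, 2 := replicate (length ts') True)"
      have "runs (Pop 0 ;; Push 1 False ;; Pop 2) s (1 + (2 + 1)) s'"
        by (rule runs_weaken[OF runs_Seq[OF runs_Pop runs_Seq[OF runs_Push runs_Pop]]])
          (use less.prems Cons Leaf in \<open>auto simp: s'_def fun_eq_iff\<close>)
      then have 1: "runs read_body s 5 s'"
        unfolding read_body_def using less.prems Cons Leaf by (intro runs_weaken[OF runs_Case_False]) auto
      have 2: "runs (While 2 read_body) s' (7 * length ?v + 1) (s'(0 := u, 1 := rev ?v @ s' 1, 2 := []))"
        by (rule less.hyps) (use Cons Leaf in \<open>auto simp: s'_def\<close>)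
      show ?thesis
        by (rule runs_weaken[OF runs_While[OF _ 1 2]]) (use less.prems Cons Leaf in \<open>auto simp: s'_def fun_eq_iff\<close>)
    next
      case (Node a b)
      let ?v = "concat (map ser (a # b # ts'))"
      define s' where "s' = s(0 := ?v @ u, 1 := True # s 1, 2 := replicate (Suc (Suc (length ts'))) True)"
      have "runs (Pop 0 ;; Push 1 True ;; Push 2 True) s (1 + (2 + 2)) s'"
        by (rule runs_weaken[OF runs_Seq[OF runs_Pop runs_Seq[OF runs_Push runs_Push]]])
          (use less.prems Cons Node in \<open>auto simp: s'_def fun_eq_iff\<close>)
      then have 1: "runs read_body s 6 s'"
        unfolding read_body_def using less.prems Cons Node by (intro runs_weaken[OF runs_Case_True]) auto
      have 2: "runs (While 2 read_body) s' (7 * length ?v + 1) (s'(0 := u, 1 := rev ?v @ s' 1, 2 := []))"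
        by (rule less.hyps) (use Cons Node in \<open>auto simp: s'_def\<close>)
      show ?thesis
        by (rule runs_weaken[OF runs_While[OF _ 1 2]]) (use less.prems Cons Node in \<open>auto simp: s'_def fun_eq_iff\<close>)
    qed
  qed
qed

lemma runs_read_tree:
  assumes "s 0 = ser t @ u" "s 2 = []"
  shows "runs read_tree s (7 * tsize t + 3) (s(0 := u, 1 := rev (ser t) @ s 1))"
  unfolding read_tree_def
  by (rule runs_weaken[OF runs_Seq[OF runs_Push runs_read_loop[of _ "[t]" u]]])
    (use assms in \<open>auto simp: fun_eq_iff\<close>)

lemma PT_left: "PT left"
proof (rule PT_I)
  fix t
  let ?c = "Pop 0 ;; read_tree ;; clr 0 ;; mv 1 0"
  let ?i = "input_regs (ser t)"
  have "runs (Case 0 Skip Skip ?c) ?i (14 * tsize t + 20) (input_regs (ser (left t)))"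
  proof (cases t)
    case Leaf
    then show ?thesis by (intro runs_weaken[OF runs_Case_False[OF _ runs_Skip]]) auto
  next
    case (Node a b)
    have 1: "runs (Pop 0) ?i 1 (input_regs (ser a @ ser b))"
      by (rule runs_weaken[OF runs_Pop]) (auto simp: Node)
    have 2: "runs read_tree (input_regs (ser a @ ser b)) (7 * tsize a + 3) ((input_regs (ser b))(1 := rev (ser a)))"
      by (rule runs_weaken[OF runs_read_tree]) (auto simp: fun_eq_iff input_regs_def)
    have 3: "runs (clr 0) ((input_regs (ser b))(1 := rev (ser a))) (2 * tsize b + 1) ((\<lambda>_. [])(1 := rev (ser a)))"
      by (rule runs_weaken[OF runs_clr]) (auto simp: fun_eq_iff input_regs_def)
    have 4: "runs (mv 1 0) ((\<lambda>_. [])(1 := rev (ser a))) (5 * tsize a + 1) (input_regs (ser a))"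
      by (rule runs_weaken[OF runs_mv]) (auto simp: fun_eq_iff input_regs_def)
    show ?thesis
      by (rule runs_weaken[OF runs_Case_True[OF _ runs_Seq[OF 1 runs_Seq[OF 2 runs_Seq[OF 3 4]]]]])
        (auto simp: Node)
  qed
  then show "runs (Case 0 Skip Skip ?c) ?i (14 * tsize t + 20) (input_regs (ser (left t)))" .
qed (intro polyb_intros)

lemma PT_right: "PT right"
proof (rule PT_I)
  fix t
  let ?c = "Pop 0 ;; read_tree ;; clr 1"
  let ?i = "input_regs (ser t)"
  show "runs (Case 0 Skip Skip ?c) ?i (14 * tsize t + 20) (input_regs (ser (right t)))"
  proof (cases t)
    case Leaf
    then show ?thesis by (intro runs_weaken[OF runs_Case_False[OF _ runs_Skip]]) auto
  next
    case (Node a b)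
    have 1: "runs (Pop 0) ?i 1 (input_regs (ser a @ ser b))"
      by (rule runs_weaken[OF runs_Pop]) (auto simp: Node)
    have 2: "runs read_tree (input_regs (ser a @ ser b)) (7 * tsize a + 3) ((input_regs (ser b))(1 := rev (ser a)))"
      by (rule runs_weaken[OF runs_read_tree]) (auto simp: fun_eq_iff input_regs_def)
    have 3: "runs (clr 1) ((input_regs (ser b))(1 := rev (ser a))) (2 * tsize a + 1) (input_regs (ser b))"
      by (rule runs_weaken[OF runs_clr]) (auto simp: fun_eq_iff input_regs_def)
    show ?thesis
      by (rule runs_weaken[OF runs_Case_True[OF _ runs_Seq[OF 1 runs_Seq[OF 2 3]]]])
        (auto simp: Node)
  qed
qed (intro polyb_intros)

lemma PT_cond:
  assumes "PT f" "PT g" "PT h"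
  shows "PT (\<lambda>t. if f t = Leaf then g t else h t)"
proof -
  obtain c p where c: "\<forall>a b s t. s a = ser t \<longrightarrow> a \<le> b \<longrightarrow> (\<forall>r>b. s r = []) \<longrightarrow>
    runs (on_reg a b c) s (poly p (tsize t)) (s(a := ser (f t)))"
    by (rule PT_on_reg_E[OF assms(1)])
  note c = c[rule_format]
  obtain d q where d: "\<forall>t. runs d (input_regs (ser t)) (poly q (tsize t)) (input_regs (ser (g t)))"
    by (rule PT_E[OF assms(2)])
  note d = d[rule_format]
  obtain e q' where e: "\<forall>t. runs e (input_regs (ser t)) (poly q' (tsize t)) (input_regs (ser (h t)))"
    by (rule PT_E[OF assms(3)])
  note e = e[rule_format]
  obtain r where r: "\<And>t. tsize (f t) \<le> poly r (tsize t)" by (rule PT_size[OF assms(1)]) blast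
  show ?thesis
  proof (rule PT_I)
    fix t
    let ?i = "input_regs (ser t)"
    let ?f = "ser (f t)" and ?y = "if f t = Leaf then g t else h t"
    have 1: "runs (copy 0 1 2) ?i (12 * tsize t + 2) (?i(1 := ser t))"
      using runs_copy[of 0 1 2 ?i] by simp
    have 2: "runs (on_reg 1 1 c) (?i(1 := ser t)) (poly p (tsize t)) (?i(1 := ?f))"
      by (rule runs_weaken[OF c]) auto
    have 3: "runs (clr 1) (?i(1 := ?f)) (2 * tsize (f t) + 1) ?i"
      by (rule runs_weaken[OF runs_clr]) (auto simp: fun_eq_iff)
    have 4: "runs (Case 1 Skip (clr 1 ;; d) (clr 1 ;; e)) (?i(1 := ?f))
        (Suc (2 * tsize (f t) + 1 + (poly q (tsize t) + poly q' (tsize t)))) (input_regs (ser ?y))"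
    proof (cases "f t")
      case Leaf
      then show ?thesis by (intro runs_weaken[OF runs_Case_False[OF _ runs_Seq[OF 3 d]]]) auto
    next
      case (Node a b)
      then show ?thesis by (intro runs_weaken[OF runs_Case_True[OF _ runs_Seq[OF 3 e]]]) auto
    qed
    show "runs (copy 0 1 2 ;; on_reg 1 1 c ;; Case 1 Skip (clr 1 ;; d) (clr 1 ;; e)) ?i
      (12 * tsize t + 2 + (poly p (tsize t) + Suc (2 * poly r (tsize t) + 1 +
        (poly q (tsize t) + poly q' (tsize t))))) (input_regs (ser ?y))"
      by (rule runs_weaken[OF runs_Seq[OF 1 runs_Seq[OF 2 4]]]) (use r[of t] in auto)
  qed (intro polyb_intros)
qed

text \<open>The code of \<open>g t\<close> itself is the counter: a copy of it is popped once per
  round. A bound on all iterates is required, since iterating a polynomial-time function can make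
  sizes grow exponentially.\<close>

lemma PT_iter:
  assumes "PT f" "PT g" "polyb B" "\<And>t i. i \<le> tsize (g t) \<Longrightarrow> tsize ((f ^^ i) (g t)) \<le> B (tsize t)"
  shows "PT (\<lambda>t. (f ^^ tsize (g t)) (g t))"
proof -
  obtain c p where c: "\<forall>a b s t. s a = ser t \<longrightarrow> a \<le> b \<longrightarrow> (\<forall>r>b. s r = []) \<longrightarrow>
    runs (on_reg a b c) s (poly p (tsize t)) (s(a := ser (f t)))"
    by (rule PT_on_reg_E[OF assms(1)])
  note c = c[rule_format]
  obtain d q where d: "\<forall>t. runs d (input_regs (ser t)) (poly q (tsize t)) (input_regs (ser (g t)))"
    by (rule PT_E[OF assms(2)])
  note d = d[rule_format]
  obtain b where b: "\<And>n. B n \<le> poly b n" using assms(3) unfolding polyb_def by blast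
  let ?body = "Pop 1 ;; on_reg 0 1 c"
  have loop: "runs (While 1 ?body) ((input_regs (ser u))(1 := x)) (length x * (poly p N + 2) + 1)
      (input_regs (ser ((f ^^ length x) u)))"
    if "\<And>i. i \<le> length x \<Longrightarrow> tsize ((f ^^ i) u) \<le> N" for u x N
    using that
  proof (induction x arbitrary: u)
    case Nil
    have "(input_regs (ser u))(1 := []) = input_regs (ser u)" by (auto simp: fun_eq_iff)
    then show ?case using runs_While_empty[of "input_regs (ser u)" 1] by simp
  next
    case (Cons y x)
    let ?s = "(input_regs (ser u))(1 := x)"
    have 1: "runs (Pop 1) ((input_regs (ser u))(1 := y # x)) 1 ?s"
      by (rule runs_weaken[OF runs_Pop]) auto
    have 2: "runs (on_reg 0 1 c) ?s (poly p N) ((input_regs (ser (f u)))(1 := x))"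
      by (rule runs_weaken[OF c])
        (use Cons.prems[of 0] in \<open>auto simp: fun_eq_iff input_regs_def intro: poly_nat_mono\<close>)
    have 3: "runs (While 1 ?body) ((input_regs (ser (f u)))(1 := x)) (length x * (poly p N + 2) + 1)
      (input_regs (ser ((f ^^ length x) (f u))))"
      by (rule Cons.IH) (use Cons.prems[of "Suc _"] in \<open>simp add: funpow_swap1\<close>)
    show ?case
      by (rule runs_weaken[OF runs_While[OF _ runs_Seq[OF 1 2] 3]])
        (auto simp: funpow_swap1)
  qed
  show ?thesis
  proof (rule PT_I)
    fix t
    let ?j = "input_regs (ser (g t))" and ?N = "poly b (tsize t)"
    have B: "tsize ((f ^^ i) (g t)) \<le> ?N" if "i \<le> tsize (g t)" for i
      using assms(4)[OF that] b le_trans by blast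
    have 2: "runs (copy 0 1 2) ?j (12 * tsize (g t) + 2) (?j(1 := ser (g t)))"
      using runs_copy[of 0 1 2 ?j] by simp
    have "tsize (g t) \<le> ?N" using B[of 0] by simp
    then have "tsize (g t) * (poly p ?N + 2) \<le> ?N * (poly p ?N + 2)" by (rule mult_le_mono1)
    then show "runs (d ;; copy 0 1 2 ;; While 1 ?body) (input_regs (ser t))
        (poly q (tsize t) + (12 * ?N + 2 + (?N * (poly p ?N + 2) + 1)))
        (input_regs (ser ((f ^^ tsize (g t)) (g t))))"
      by (intro runs_weaken[OF runs_Seq[OF d runs_Seq[OF 2 loop[OF B]]]])
        (use \<open>tsize (g t) \<le> ?N\<close> in \<open>auto intro!: add_mono\<close>)
  qed (intro polyb_intros)
qed

section \<open>Equality of trees\<close>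

definition true_tree :: tree where
  "true_tree = Node Leaf Leaf"

text \<open>Register 3 becomes nonempty when a mismatch is found.\<close>

definition cmp_body :: com where
  "cmp_body = Case 1 Skip (Case 2 (Push 3 True) Skip (Push 3 True)) (Case 2 (Push 3 True) (Push 3 True) Skip) ;;
     Pop 1 ;; Pop 2"

text \<open>The loop is controlled by the first list alone, hence it recognises prefixes. Equality
  takes a further test of register 2 for a remainder, left to the caller.\<close>

lemma runs_cmp_loop:
  assumes "s 1 = xs" "s 2 = ys"
  shows "\<exists>zs. runs (While 1 cmp_body) s (7 * length xs + 1) (s(1 := [], 2 := drop (length xs) ys, 3 := zs @ s 3)) \<and>
    (zs = [] \<longleftrightarrow> (\<exists>us. ys = xs @ us)) \<and> length zs \<le> length xs \<and> set zs \<subseteq> {True}"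
  using assms
proof (induction xs arbitrary: s ys)
  case Nil
  then have "runs (While 1 cmp_body) s 1 (s(1 := [], 2 := drop (length []) ys, 3 := [] @ s 3))"
    by (intro runs_weaken[OF runs_While_empty]) (auto simp: fun_eq_iff)
  then show ?case by (intro exI[of _ "[]"]) (simp add: fun_upd_def)
next
  case (Cons x xs)
  define w where "w = (if ys = [] \<or> hd ys \<noteq> x then [True] else [])"
  define s' where "s' = s(1 := xs, 2 := tl ys, 3 := w @ s 3)"
  have "runs (Case 1 Skip (Case 2 (Push 3 True) Skip (Push 3 True)) (Case 2 (Push 3 True) (Push 3 True) Skip))
     s 4 (s(3 := w @ s 3))"
  proof (cases x)
    case True
    have "runs (Case 2 (Push 3 True) (Push 3 True) Skip) s 3 (s(3 := w @ s 3))"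
    proof (cases ys)
      case Nil
      then show ?thesis using Cons.prems
        by (intro runs_weaken[OF runs_Case_empty[OF _ runs_Push]]) (auto simp: w_def)
    next
      case (Cons y ys')
      then show ?thesis using \<open>s 2 = ys\<close> True
        by (cases y) (auto simp: w_def intro: runs_weaken[OF runs_Case_True[OF _ runs_Skip]]
          runs_weaken[OF runs_Case_False[OF _ runs_Push]])
    qed
    from runs_Case_True[OF _ this] show ?thesis using Cons.prems True by simp
  next
    case False
    have "runs (Case 2 (Push 3 True) Skip (Push 3 True)) s 3 (s(3 := w @ s 3))"
    proof (cases ys)
      case Nil
      then show ?thesis using Cons.prems
        by (intro runs_weaken[OF runs_Case_empty[OF _ runs_Push]]) (auto simp: w_def)
    next
      case (Cons y ys')
      then show ?thesis using \<open>s 2 = ys\<close> False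
        by (cases y) (auto simp: w_def intro: runs_weaken[OF runs_Case_False[OF _ runs_Skip]]
          runs_weaken[OF runs_Case_True[OF _ runs_Push]])
    qed
    from runs_Case_False[OF _ this] show ?thesis using Cons.prems False by simp
  qed
  then have 1: "runs cmp_body s (4 + (1 + 1)) s'"
    unfolding cmp_body_def
    by (intro runs_weaken[OF runs_Seq[OF _ runs_Seq[OF runs_Pop runs_Pop]]])
      (use Cons.prems in \<open>auto simp: s'_def fun_eq_iff\<close>)
  have s': "s' 1 = xs" "s' 2 = tl ys" by (simp_all add: s'_def)
  obtain zs where zs: "runs (While 1 cmp_body) s' (7 * length xs + 1)
       (s'(1 := [], 2 := drop (length xs) (tl ys), 3 := zs @ s' 3))"
      "zs = [] \<longleftrightarrow> (\<exists>us. tl ys = xs @ us)" "length zs \<le> length xs"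
      "set zs \<subseteq> {True}"
    using Cons.IH[OF s'] by blast
  have "runs (While 1 cmp_body) s (7 * length (x # xs) + 1)
      (s(1 := [], 2 := drop (length (x # xs)) ys, 3 := (zs @ w) @ s 3))"
    by (rule runs_weaken[OF runs_While[OF _ 1 zs(1)]])
      (use Cons.prems in \<open>auto simp: s'_def fun_eq_iff drop_Suc\<close>)
  moreover have "zs @ w = [] \<longleftrightarrow> (\<exists>us. ys = (x # xs) @ us)"
    using zs(2) by (cases ys) (auto simp: w_def)
  moreover have "length (zs @ w) \<le> length (x # xs)" "set (zs @ w) \<subseteq> {True}"
    using zs(3,4) by (auto simp: w_def)
  ultimately show ?case by blast
qed

lemma PT_eq_subtrees: "PT (\<lambda>t. if left t = right t then true_tree else Leaf)"
proof (rule PT_I)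
  fix t
  let ?i = "input_regs (ser t)"
  let ?y = "if left t = right t then true_tree else Leaf"
  let ?m = "Case 2 Skip (Push 3 True) (Push 3 True)"
  let ?o = "Case 3 (pushes 0 (rev (ser true_tree))) Skip (clr 3 ;; Push 0 False)"
  let ?d = "Case 0 Skip (Pop 0 ;; pushes 0 (rev (ser true_tree)))
    (Pop 0 ;; read_tree ;; mv 0 2 ;; While 1 cmp_body ;; ?m ;; clr 2 ;; ?o)"
  show "runs ?d ?i (100 * tsize t + 100) (input_regs (ser ?y))"
  proof (cases t)
    case Leaf
    \<comment> \<open>Both projections of \<open>Leaf\<close> are \<open>Leaf\<close>, so the answer
      here is \<open>true_tree\<close>.\<close>
    have "runs (Pop 0 ;; pushes 0 (rev (ser true_tree))) ?i (1 + (2 * 3 + 1)) (input_regs (ser true_tree))"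
      by (rule runs_weaken[OF runs_Seq[OF runs_Pop runs_pushes]]) (auto simp: Leaf true_tree_def)
    then show ?thesis using Leaf by (intro runs_weaken[OF runs_Case_False]) auto
  next
    case (Node a b)
    let ?e = "\<lambda>_ :: nat. [] :: bool list"
    let ?s = "?e(1 := rev (ser a), 2 := rev (ser b))"
    have 1: "runs (Pop 0) ?i 1 (input_regs (ser a @ ser b))"
      by (rule runs_weaken[OF runs_Pop]) (auto simp: Node)
    have 2: "runs read_tree (input_regs (ser a @ ser b)) (7 * tsize a + 3) (?e(0 := ser b, 1 := rev (ser a)))"
      by (rule runs_weaken[OF runs_read_tree]) (auto simp: fun_eq_iff input_regs_def)
    have 3: "runs (mv 0 2) (?e(0 := ser b, 1 := rev (ser a))) (5 * tsize b + 1) ?s"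
      by (rule runs_weaken[OF runs_mv]) (auto simp: fun_eq_iff)
    obtain zs where zs: "runs (While 1 cmp_body) ?s (7 * tsize a + 1)
         (?s(1 := [], 2 := drop (tsize a) (rev (ser b)), 3 := zs @ ?s 3))"
        "zs = [] \<longleftrightarrow> (\<exists>us. rev (ser b) = rev (ser a) @ us)" "length zs \<le> tsize a"
        "set zs \<subseteq> {True}"
      using runs_cmp_loop[of ?s "rev (ser a)" "rev (ser b)"] by auto
    let ?u = "drop (tsize a) (rev (ser b))"
    have 4: "runs (While 1 cmp_body) ?s (7 * tsize a + 1) (?e(2 := ?u, 3 := zs))"
      by (rule runs_weaken[OF zs(1)]) (auto simp: fun_eq_iff)
    define ws where "ws = (if ?u = [] then [] else [True]) @ zs"
    have 5: "runs ?m (?e(2 := ?u, 3 := zs)) 3 (?e(2 := ?u, 3 := ws))"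
    proof (cases ?u)
      case Nil
      then show ?thesis by (intro runs_weaken[OF runs_Case_empty[OF _ runs_Skip]]) (auto simp: ws_def)
    next
      case (Cons y ys)
      then show ?thesis
        by (cases y) (auto simp: ws_def intro: runs_weaken[OF runs_Case_True[OF _ runs_Push]]
          runs_weaken[OF runs_Case_False[OF _ runs_Push]])
    qed
    have 6: "runs (clr 2) (?e(2 := ?u, 3 := ws)) (2 * tsize b + 1) (?e(3 := ws))"
      by (rule runs_weaken[OF runs_clr]) (auto simp: fun_eq_iff)
    have ws: "ws = [] \<longleftrightarrow> a = b"
    proof
      assume ws0: "ws = []"
      then obtain us where us: "rev (ser b) = rev (ser a) @ us" using zs(2) by (auto simp: ws_def)
      then have "us = []" using ws0 by (auto simp: ws_def split: if_splits)
      then have "rev (ser b) = rev (ser a)" using us by simp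
      then show "a = b" using ser_inject[of a "[]" b "[]"] by simp
    qed (use zs(2) in \<open>auto simp: ws_def\<close>)
    have len: "length ws \<le> tsize a + 1" using zs(3) by (auto simp: ws_def)
    have tr: "ws = True # tl ws" if "ws \<noteq> []"
      using that zs(4) by (cases ws) (auto simp: ws_def split: if_splits)
    have 7: "runs ?o (?e(3 := ws)) (2 * tsize a + 20) (input_regs (ser ?y))"
    proof (cases "ws = []")
      case True
      then show ?thesis using ws
        by (intro runs_weaken[OF runs_Case_empty[OF _ runs_pushes]]) (auto simp: Node true_tree_def input_regs_def fun_eq_iff)
    next
      case False
      then show ?thesis using ws tr[OF False] len
        by (intro runs_weaken[OF runs_Case_True[of _ _ "tl ws", OF _ runs_Seq[OF runs_clr runs_Push]]]) (auto simp: Node input_regs_def fun_eq_iff)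
    qed
    show ?thesis
      by (rule runs_weaken[OF runs_Case_True[OF _ runs_Seq[OF 1 runs_Seq[OF 2 runs_Seq[OF 3
          runs_Seq[OF 4 runs_Seq[OF 5 runs_Seq[OF 6 7]]]]]]]]) (auto simp: Node)
  qed
qed (intro polyb_intros)


section \<open>Trees as lists: folds along the right spine\<close>

primrec spine :: "tree \<Rightarrow> tree list" where
  "spine Leaf = []"
| "spine (Node a b) = a # spine b"

primrec unspine :: "tree list \<Rightarrow> tree" where
  "unspine [] = Leaf"
| "unspine (t # ts) = Node t (unspine ts)"

lemma spine_unspine [simp]: "spine (unspine ts) = ts"
  by (induction ts) auto

lemma unspine_spine [simp]: "unspine (spine t) = t"
  by (induction t) auto

lemma tsize_unspine: "tsize (unspine ts) = Suc (sum_list (map (\<lambda>t. Suc (tsize t)) ts))"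
  by (induction ts) auto

lemma length_spine_less: "length (spine t) < tsize t"
  by (induction t) auto

lemma tsize_drop_spine: "tsize (unspine (drop i (spine t))) \<le> tsize t"
proof -
  have "tsize t = tsize (unspine (take i (spine t) @ drop i (spine t)))" by simp
  then show ?thesis by (simp only: tsize_unspine map_append sum_list_append)
qed

text \<open>The iterated state holds the elements still to come, the parameter \<open>t\<close>,
  which \<open>F\<close> may use, and the accumulator. \<open>PT_iter\<close> makes more rounds than
  there are elements; \<open>st\<close> is idle once they are used up.\<close>

lemma PT_foldl:
  assumes F: "PT F" and X: "PT X" and A: "PT A" and B: "polyb B"
    and bound: "\<And>t i. tsize (foldl (\<lambda>acc e. F (Node t (Node acc e))) (A t) (take i (spine (X t)))) \<le> B (tsize t)"
  shows "PT (\<lambda>t. foldl (\<lambda>acc e. F (Node t (Node acc e))) (A t) (spine (X t)))"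
proof -
  define st where "st u = (if left u = Leaf then u else Node (right (left u))
    (Node (left (right u)) (F (Node (left (right u)) (Node (right (right u)) (left (left u)))))))" for u
  define g where "g t = Node (X t) (Node t (A t))" for t
  have PT_st: "PT st"
    unfolding st_def by (intro PT_cond PT_Node PT_comp[OF F] PT_comp[OF PT_left] PT_comp[OF PT_right] PT_id)
  have PT_g: "PT g"
    unfolding g_def by (intro PT_Node X A PT_id)
  have st_pow: "(st ^^ i) (Node x (Node t a)) = Node (unspine (drop i (spine x)))
      (Node t (foldl (\<lambda>acc e. F (Node t (Node acc e))) a (take i (spine x))))" for i x t a
  proof (induction i arbitrary: x a)
    case (Suc i)
    show ?case
    proof (cases x)
      case Leaf
      then have "st (Node x (Node t a)) = Node x (Node t a)" by (simp add: st_def)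
      then show ?thesis using Suc.IH[of x a] Leaf by (simp only: funpow_Suc_app) simp
    next
      case (Node e r)
      then have "st (Node x (Node t a)) = Node r (Node t (F (Node t (Node a e))))" 
        by (simp add: st_def)
      then show ?thesis using Suc.IH[of r] Node by (simp only: funpow_Suc_app) simp
    qed
  qed simp
  obtain p where p: "\<And>t. tsize (X t) \<le> poly p (tsize t)" by (rule PT_size[OF X]) blast
  have "PT (\<lambda>t. (st ^^ tsize (g t)) (g t))"
  proof (rule PT_iter[OF PT_st PT_g])
    show "polyb (\<lambda>n. Suc (poly p n + Suc (n + B n)))" by (intro polyb_intros B)
    show "tsize ((st ^^ i) (g t)) \<le> Suc (poly p (tsize t) + Suc (tsize t + B (tsize t)))" for t i
      unfolding g_def st_pow using tsize_drop_spine[of i "X t"] p[of t] bound[of t i] by simp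
  qed
  then have "PT (\<lambda>t. right (right ((st ^^ tsize (g t)) (g t))))"
    by (intro PT_comp[OF PT_right])
  moreover have "right (right ((st ^^ tsize (g t)) (g t))) =
      foldl (\<lambda>acc e. F (Node t (Node acc e))) (A t) (spine (X t))" for t
  proof -
    have "length (spine (X t)) \<le> tsize (g t)" using length_spine_less[of "X t"] by (simp add: g_def)
    then show ?thesis unfolding g_def st_pow by simp
  qed
  ultimately show ?thesis by simp
qed

lemma PT_rev: "PT (\<lambda>t. unspine (rev (spine t)))"
proof -
  have eq: "foldl (\<lambda>acc e. Node e acc) (unspine ys) xs = unspine (rev xs @ ys)" for xs ys
    by (induction xs arbitrary: ys) (auto simp flip: unspine.simps(2))
  note eq = eq[of "[]", simplified]
  define F where "F u = Node (right (right u)) (left (right u))" for u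
  have "PT (\<lambda>t. foldl (\<lambda>acc e. F (Node t (Node acc e))) Leaf (spine t))"
  proof (rule PT_foldl)
    show "PT F" unfolding F_def by (intro PT_Node PT_comp[OF PT_left] PT_comp[OF PT_right] PT_id)
    show "tsize (foldl (\<lambda>acc e. F (Node t (Node acc e))) Leaf (take i (spine t))) \<le> tsize t" for t i
    proof -
      have "tsize t = tsize (unspine (take i (spine t) @ drop i (spine t)))" by simp
      then show ?thesis
        unfolding F_def by (simp only: left.simps right.simps eq tsize_unspine map_append sum_list_append)
          (simp flip: rev_map)
    qed
  qed (intro PT_id PT_const polyb_intros)+
  then show ?thesis by (simp add: F_def eq)
qed

lemma PT_map:
  assumes "PT f"
  shows "PT (\<lambda>t. unspine (map f (spine t)))"
proof -
  have eq: "foldl (\<lambda>acc e. Node (f e) acc) (unspine ys) xs = unspine (rev (map f xs) @ ys)" for xs ys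
    by (induction xs arbitrary: ys) (auto simp flip: unspine.simps(2))
  note eq = eq[of "[]", simplified]
  define F where "F u = Node (f (right (right u))) (left (right u))" for u
  obtain p where p: "\<And>t. tsize (f t) \<le> poly p (tsize t)" by (rule PT_size[OF assms]) blast
  have "PT (\<lambda>t. foldl (\<lambda>acc e. F (Node t (Node acc e))) Leaf (spine t))"
  proof (rule PT_foldl)
    show "PT F"
      unfolding F_def by (intro PT_Node PT_comp[OF assms] PT_comp[OF PT_left] PT_comp[OF PT_right] PT_id)
    show "tsize (foldl (\<lambda>acc e. F (Node t (Node acc e))) Leaf (take i (spine t)))
        \<le> Suc (tsize t * Suc (poly p (tsize t)))" for t i
    proof -
      have le: "tsize e \<le> tsize t" if "e \<in> set (spine t)" for e
        using that by (induction t) auto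
      have "sum_list (map (\<lambda>e. Suc (tsize (f e))) (take i (spine t)))
          \<le> sum_list (map (\<lambda>e. Suc (poly p (tsize t))) (take i (spine t)))"
        by (intro sum_list_mono Suc_le_mono[THEN iffD2] order_trans[OF p] poly_nat_mono le)
          (auto dest: in_set_takeD)
      also have "\<dots> \<le> tsize t * Suc (poly p (tsize t))"
        using length_spine_less[of t]
        by (simp only: sum_list_triv of_nat_id) (intro mult_le_mono1, simp)
      finally show ?thesis
        unfolding F_def by (simp add: eq tsize_unspine rev_map[symmetric] o_def)
    qed
  qed (intro PT_const polyb_intros PT_id)+
  from PT_comp[OF PT_rev this] show ?thesis by (simp add: F_def eq)
qed


section \<open>Polynomial-time functions on data types\<close>

text \<open>
  Every tree represents an element of the type, via \<open>decode\<close>; this makes computations on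
  arbitrary, possibly malformed, certificates well behaved.
\<close>

class data =
  fixes code :: "'a \<Rightarrow> tree" and decode :: "tree \<Rightarrow> 'a"
  assumes decode_code [simp]: "decode (code x) = x"
    and PT_normal: "PT (\<lambda>t. code (decode t))"

definition pt :: "('a :: data \<Rightarrow> 'b :: data) \<Rightarrow> bool" where
  "pt f \<longleftrightarrow> PT (\<lambda>t. code (f (decode t)))"

abbreviation dsize :: "'a :: data \<Rightarrow> nat" where
  "dsize x \<equiv> tsize (code x)"

lemma code_eq_iff [simp]: "code x = code y \<longleftrightarrow> x = y"
  by (metis decode_code)

instantiation tree :: data
begin
definition code_tree :: "tree \<Rightarrow> tree" where "code_tree t = t"
definition decode_tree :: "tree \<Rightarrow> tree" where "decode_tree t = t"
instance by standard (simp_all add: code_tree_def decode_tree_def PT_id)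
end

instantiation unit :: data
begin
definition code_unit :: "unit \<Rightarrow> tree" where "code_unit u = Leaf"
definition decode_unit :: "tree \<Rightarrow> unit" where "decode_unit t = ()"
instance by standard (simp_all add: code_unit_def decode_unit_def PT_const)
end

instantiation bool :: data
begin
definition code_bool :: "bool \<Rightarrow> tree" where "code_bool b = (if b then true_tree else Leaf)"
definition decode_bool :: "tree \<Rightarrow> bool" where "decode_bool t \<longleftrightarrow> t \<noteq> Leaf"
instance
proof
  have "PT (\<lambda>t. if t = Leaf then Leaf else true_tree)" by (intro PT_cond PT_id PT_const)
  then show "PT (\<lambda>t. code (decode t :: bool))"
    by (rule back_subst[of PT]) (auto simp: code_bool_def decode_bool_def)
qed (simp add: code_bool_def decode_bool_def true_tree_def)
end

instantiation nat :: data
begin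
definition code_nat :: "nat \<Rightarrow> tree" where "code_nat n = unspine (replicate n Leaf)"
definition decode_nat :: "tree \<Rightarrow> nat" where "decode_nat t = length (spine t)"
instance
proof
  have "PT (\<lambda>t. unspine (map (\<lambda>_. Leaf) (spine t)))" by (intro PT_map PT_const)
  then show "PT (\<lambda>t. code (decode t :: nat))"
    by (simp add: code_nat_def decode_nat_def map_replicate_const)
qed (simp add: code_nat_def decode_nat_def)
end

instantiation prod :: (data, data) data
begin
definition code_prod :: "'a \<times> 'b \<Rightarrow> tree" where "code_prod p = Node (code (fst p)) (code (snd p))"
definition decode_prod :: "tree \<Rightarrow> 'a \<times> 'b" where "decode_prod t = (decode (left t), decode (right t))"
instance
proof
  show "PT (\<lambda>t. code (decode t :: 'a \<times> 'b))"
    unfolding code_prod_def decode_prod_def fst_conv snd_conv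
    by (intro PT_Node PT_comp[OF PT_normal] PT_left PT_right)
qed (simp add: code_prod_def decode_prod_def)
end

instantiation list :: (data) data
begin
definition code_list :: "'a list \<Rightarrow> tree" where "code_list xs = unspine (map code xs)"
definition decode_list :: "tree \<Rightarrow> 'a list" where "decode_list t = map decode (spine t)"
instance
proof
  have "PT (\<lambda>t. unspine (map (\<lambda>t. code (decode t :: 'a)) (spine t)))" by (intro PT_map PT_normal)
  then show "PT (\<lambda>t. code (decode t :: 'a list))"
    by (simp add: code_list_def decode_list_def o_def)
qed (simp add: code_list_def decode_list_def o_def)
end

named_theorems pt_intros

lemma pt_id [pt_intros]: "pt (\<lambda>x. x)"
  unfolding pt_def by (rule PT_normal)

lemma pt_const [pt_intros]: "pt (\<lambda>x. c)"
  unfolding pt_def by (rule PT_const)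

lemma pt_comp: "pt f \<Longrightarrow> pt g \<Longrightarrow> pt (\<lambda>x. f (g x))"
  unfolding pt_def by (drule (1) PT_comp) simp

lemma pt_size:
  assumes "pt f"
  obtains p :: "nat poly" where "\<And>x. dsize (f x) \<le> poly p (dsize x)"
proof -
  obtain p where p: "\<And>t. tsize (code (f (decode t))) \<le> poly p (tsize t)"
    by (rule PT_size[OF assms[unfolded pt_def]]) blast
  have "dsize (f x) \<le> poly p (dsize x)" for x using p[of "code x"] by simp
  then show ?thesis by (rule that)
qed

lemma pt_Pair [pt_intros]: "pt f \<Longrightarrow> pt g \<Longrightarrow> pt (\<lambda>x. (f x, g x))"
  unfolding pt_def code_prod_def by (simp add: PT_Node)

lemma pt_fst [pt_intros]: "pt f \<Longrightarrow> pt (\<lambda>x. fst (f x))"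
  unfolding pt_def code_prod_def by (drule PT_comp[OF PT_left]) simp

lemma pt_snd [pt_intros]: "pt f \<Longrightarrow> pt (\<lambda>x. snd (f x))"
  unfolding pt_def code_prod_def by (drule PT_comp[OF PT_right]) simp

lemma pt_case_prod [pt_intros]:
  "pt (\<lambda>x. f x (fst (p x)) (snd (p x))) \<Longrightarrow> pt (\<lambda>x. case p x of (a, b) \<Rightarrow> f x a b)"
  by (simp add: case_prod_beta)

lemma pt_if [pt_intros]:
  assumes "pt b" "pt f" "pt g"
  shows "pt (\<lambda>x. if b x then f x else g x)"
proof -
  have "PT (\<lambda>t. if code (b (decode t)) = Leaf then code (g (decode t)) else code (f (decode t)))"
    using assms unfolding pt_def by (intro PT_cond)
  moreover have "(if code (b x) = Leaf then code (g x) else code (f x)) = code (if b x then f x else g x)" for x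
    by (simp add: code_bool_def true_tree_def)
  ultimately show ?thesis unfolding pt_def by simp
qed

lemma pt_eq [pt_intros]:
  fixes f :: "'a :: data \<Rightarrow> 'b :: data"
  assumes "pt f" "pt g"
  shows "pt (\<lambda>x. f x = g x)"
proof -
  have "PT (\<lambda>t. Node (code (f (decode t))) (code (g (decode t))))"
    using assms unfolding pt_def by (intro PT_Node)
  from PT_comp[OF PT_eq_subtrees this] show ?thesis unfolding pt_def code_bool_def by simp
qed

lemma pt_not [pt_intros]:
  assumes "pt f"
  shows "pt (\<lambda>x. \<not> f x)"
proof -
  have "pt (\<lambda>x. if f x then False else True)" by (intro pt_if assms pt_const)
  moreover have "(\<lambda>x. if f x then False else True) = (\<lambda>x. \<not> f x)" by auto
  ultimately show ?thesis by simp
qed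

lemma pt_conj [pt_intros]:
  assumes "pt f" "pt g"
  shows "pt (\<lambda>x. f x \<and> g x)"
proof -
  have "pt (\<lambda>x. if f x then g x else False)" by (intro pt_if assms pt_const)
  moreover have "(\<lambda>x. if f x then g x else False) = (\<lambda>x. f x \<and> g x)" by auto
  ultimately show ?thesis by simp
qed

lemma pt_disj [pt_intros]:
  assumes "pt f" "pt g"
  shows "pt (\<lambda>x. f x \<or> g x)"
proof -
  have "pt (\<lambda>x. if f x then True else g x)" by (intro pt_if assms pt_const)
  moreover have "(\<lambda>x. if f x then True else g x) = (\<lambda>x. f x \<or> g x)" by auto
  ultimately show ?thesis by simp
qed

lemma pt_imp [pt_intros]:
  assumes "pt f" "pt g"
  shows "pt (\<lambda>x. f x \<longrightarrow> g x)"
proof -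
  have "pt (\<lambda>x. if f x then g x else True)" by (intro pt_if assms pt_const)
  moreover have "(\<lambda>x. if f x then g x else True) = (\<lambda>x. f x \<longrightarrow> g x)" by auto
  ultimately show ?thesis by simp
qed

lemma pt_Node [pt_intros]:
  assumes "pt f" "pt g"
  shows "pt (\<lambda>x. Node (f x) (g x))"
  using assms unfolding pt_def code_tree_def by (rule PT_Node)


subsection \<open>Lists\<close>

lemma dsize_Nil [simp]: "dsize ([] :: 'a :: data list) = 1"
  by (simp add: code_list_def)

lemma dsize_Cons [simp]: "dsize (x # xs) = Suc (dsize x + dsize xs)"
  by (simp add: code_list_def)

lemma dsize_append: "Suc (dsize (xs @ ys)) = dsize xs + dsize ys"
  by (induction xs) auto

lemma dsize_rev [simp]: "dsize (rev xs) = dsize xs"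
proof (induction xs)
  case (Cons x xs)
  then show ?case using dsize_append[of "rev xs" "[x]"] by simp
qed simp

lemma dsize_take: "dsize (take i xs) \<le> dsize xs"
  using dsize_append[of "take i xs" "drop i xs"] tsize_pos[of "code (drop i xs)"]
  by (simp del: length_greater_0_conv)

lemma dsize_elem: "x \<in> set xs \<Longrightarrow> dsize x < dsize xs"
  by (induction xs) auto

lemma length_less_dsize: "length xs < dsize xs"
  by (induction xs) auto

lemma dsize_Pair [simp]: "dsize (x, y) = Suc (dsize x + dsize y)"
  by (simp add: code_prod_def)

lemma dsize_bool: "dsize (b :: bool) \<le> 3"
  by (simp add: code_bool_def true_tree_def)

lemma dsize_nat: "dsize (n :: nat) = Suc (2 * n)"
  by (induction n) (auto simp: code_nat_def)

lemma dsize_le_if_bounded: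
  "(\<And>x. x \<in> set xs \<Longrightarrow> dsize x \<le> N) \<Longrightarrow> dsize xs \<le> Suc (length xs * Suc N)"
proof (induction xs)
  case (Cons x xs)
  then have "dsize x \<le> N" "dsize xs \<le> Suc (length xs * Suc N)" by auto
  then show ?case by simp
qed simp

lemma pt_Cons [pt_intros]:
  assumes "pt f" "pt g"
  shows "pt (\<lambda>x. f x # g x)"
  using PT_Node[OF assms[unfolded pt_def]] by (simp add: pt_def code_list_def)

text \<open>The bound ranges over all prefixes of the list because every intermediate accumulator
  has to stay polynomial, not only the final one.\<close>

lemma pt_foldl:
  fixes f :: "'a :: data \<Rightarrow> 'b :: data \<Rightarrow> 'c :: data \<Rightarrow> 'b"
  assumes f: "pt (\<lambda>z. f (fst z) (fst (snd z)) (snd (snd z)))" and xs: "pt xs" and a: "pt a"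
    and B: "polyb B" and bound: "\<And>x i. dsize (foldl (f x) (a x) (take i (xs x))) \<le> B (dsize x)"
  shows "pt (\<lambda>x. foldl (f x) (a x) (xs x))"
proof -
  define F where "F u = code ((\<lambda>z. f (fst z) (fst (snd z)) (snd (snd z))) (decode u))" for u
  have F: "PT F" using f unfolding pt_def F_def .
  have F_eq: "F (Node t (Node (code acc) (code e))) = code (f (decode t) acc e)" for t acc e
    by (simp add: F_def decode_prod_def)
  have fold: "foldl (\<lambda>acc e. F (Node t (Node acc e))) (code b) (map code ys) =
      code (foldl (f (decode t)) b ys)" for t b ys
    by (induction ys arbitrary: b) (simp_all add: F_eq)
  have spine: "spine (code ys) = map code ys" for ys :: "'c list"
    by (simp add: code_list_def)
  \<comment> \<open>\<open>bound\<close> is measured in the size of \<open>code (decode t)\<close>,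
    which can exceed that of a malformed \<open>t\<close>.\<close>
  obtain p where p: "\<And>t. tsize (code (decode t :: 'a)) \<le> poly p (tsize t)"
    by (rule PT_size[OF PT_normal]) blast
  obtain b where b: "\<And>n. B n \<le> poly b n" using B[unfolded polyb_def] by blast
  have "PT (\<lambda>t. foldl (\<lambda>acc e. F (Node t (Node acc e))) (code (a (decode t)))
      (spine (code (xs (decode t)))))"
  proof (rule PT_foldl[OF F])
    show "polyb (\<lambda>n. poly b (poly p n))" by (intro polyb_intros)
    show "tsize (foldl (\<lambda>acc e. F (Node t (Node acc e))) (code (a (decode t)))
        (take i (spine (code (xs (decode t)))))) \<le> poly b (poly p (tsize t))" for t i
    proof -
      have "dsize (foldl (f (decode t)) (a (decode t)) (take i (xs (decode t)))) \<le> B (dsize (decode t :: 'a))"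
        by (rule bound)
      also have "\<dots> \<le> poly b (poly p (tsize t))" by (rule order_trans[OF b poly_nat_mono[OF p]])
      finally show ?thesis by (simp add: spine take_map fold)
    qed
  qed (use xs a in \<open>simp_all add: pt_def\<close>)
  then show ?thesis unfolding pt_def by (simp add: spine fold)
qed

lemma pt_rev [pt_intros]:
  assumes "pt xs"
  shows "pt (\<lambda>x. rev (xs x))"
proof -
  have eq: "foldl (\<lambda>acc e. e # acc) ys zs = rev zs @ ys" for zs ys :: "'b list"
    by (induction zs arbitrary: ys) auto
  obtain p where p: "\<And>x. dsize (xs x) \<le> poly p (dsize x)" by (rule pt_size[OF assms]) blast
  have "pt (\<lambda>x. foldl (\<lambda>acc e. e # acc) [] (xs x))"
    by (rule pt_foldl[where B = "poly p"], intro pt_intros, rule assms, intro pt_intros, intro polyb_intros)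
      (simp add: eq order_trans[OF dsize_take p])
  then show ?thesis by (simp add: eq)
qed

text \<open>The mapped function may depend on the surrounding argument \<open>x\<close>, so its
  premise concerns the pair of \<open>x\<close> and the element. Premises about \<open>x\<close>
  alone are carried under such a binder by \<open>pt_comp\<close>.\<close>

lemma pt_map [pt_intros]:
  assumes xs: "pt xs" and f: "pt (\<lambda>z. f (fst z) (snd z))"
  shows "pt (\<lambda>x. map (f x) (xs x))"
proof -
  have eq: "foldl (\<lambda>acc e. g e # acc) ys zs = rev (map g zs) @ ys" for g :: "'b \<Rightarrow> 'c" and zs ys
    by (induction zs arbitrary: ys) auto
  obtain p where p: "\<And>x. dsize (xs x) \<le> poly p (dsize x)" by (rule pt_size[OF xs]) blast
  obtain q where q: "\<And>z. dsize (f (fst z) (snd z)) \<le> poly q (dsize z)" by (rule pt_size[OF f]) blast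
  let ?B = "\<lambda>n. Suc (poly p n * Suc (poly q (Suc (n + poly p n))))"
  have "pt (\<lambda>x. foldl (\<lambda>acc e. f x e # acc) [] (xs x))"
  proof (rule pt_foldl[where B = ?B])
    show "pt (\<lambda>z. f (fst z) (snd (snd z)) # fst (snd z))"
      using pt_comp[OF f, of "\<lambda>z. (fst z, snd (snd z))"] by (intro pt_intros) (simp_all add: pt_intros)
    show "dsize (foldl (\<lambda>acc e. f x e # acc) [] (take i (xs x))) \<le> ?B (dsize x)" for x i
    proof -
      have "dsize (map (f x) (take i (xs x)))
          \<le> Suc (length (map (f x) (take i (xs x))) * Suc (poly q (Suc (dsize x + poly p (dsize x)))))"
      proof (rule dsize_le_if_bounded)
        fix y assume "y \<in> set (map (f x) (take i (xs x)))"
        then obtain e where e: "e \<in> set (xs x)" "y = f x e" by (auto dest: in_set_takeD)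
        have "dsize y \<le> poly q (dsize (x, e))" using q[of "(x, e)"] e by simp
        also have "\<dots> \<le> poly q (Suc (dsize x + poly p (dsize x)))"
          using dsize_elem[OF e(1)] p[of x] by (intro poly_nat_mono) simp
        finally show "dsize y \<le> poly q (Suc (dsize x + poly p (dsize x)))" .
      qed
      also have "\<dots> \<le> ?B (dsize x)"
        using length_less_dsize[of "xs x"] p[of x] by (intro Suc_le_mono[THEN iffD2] mult_le_mono1) simp
      finally show ?thesis by (simp add: eq)
    qed
  qed (intro xs pt_intros polyb_intros)+
  from pt_rev[OF this] show ?thesis by (simp add: eq)
qed

lemma pt_append [pt_intros]:
  assumes xs: "pt xs" and ys: "pt ys"
  shows "pt (\<lambda>x. xs x @ ys x)"
proof -
  have eq: "foldl (\<lambda>acc e. e # acc) ys zs = rev zs @ ys" for zs ys :: "'b list"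
    by (induction zs arbitrary: ys) auto
  obtain p where p: "\<And>x. dsize (xs x) \<le> poly p (dsize x)" by (rule pt_size[OF xs]) blast
  obtain q where q: "\<And>x. dsize (ys x) \<le> poly q (dsize x)" by (rule pt_size[OF ys]) blast
  have "pt (\<lambda>x. foldl (\<lambda>acc e. e # acc) (ys x) (rev (xs x)))"
  proof (rule pt_foldl[where B = "\<lambda>n. poly p n + poly q n"])
    show "dsize (foldl (\<lambda>acc e. e # acc) (ys x) (take i (rev (xs x)))) \<le> poly p (dsize x) + poly q (dsize x)" for x i
      using dsize_append[of "rev (take i (rev (xs x)))" "ys x"] dsize_take[of i "rev (xs x)"] p[of x] q[of x]
      by (simp add: eq)
  qed (intro xs ys pt_intros polyb_intros)+
  then show ?thesis by (simp add: eq)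
qed

lemma pt_concat [pt_intros]:
  assumes xs: "pt xs"
  shows "pt (\<lambda>x. concat (xs x))"
proof -
  have eq: "foldl (@) ys zs = ys @ concat zs" for zs and ys :: "'b list"
    by (induction zs arbitrary: ys) auto
  have size: "dsize (concat zs) \<le> dsize zs" for zs :: "'b list list"
  proof (induction zs)
    case (Cons z zs)
    then show ?case using dsize_append[of z "concat zs"] by simp
  qed simp
  obtain p where p: "\<And>x. dsize (xs x) \<le> poly p (dsize x)" by (rule pt_size[OF xs]) blast
  have "pt (\<lambda>x. foldl (@) [] (xs x))"
  proof (rule pt_foldl[where B = "poly p"])
    show "dsize (foldl (@) [] (take i (xs x))) \<le> poly p (dsize x)" for x i
      using order_trans[OF size order_trans[OF dsize_take p]] by (simp add: eq)
  qed (intro xs pt_intros polyb_intros)+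
  then show ?thesis by (simp add: eq)
qed

lemma pt_filter [pt_intros]:
  assumes "pt xs" "pt (\<lambda>z. P (fst z) (snd z))"
  shows "pt (\<lambda>x. filter (P x) (xs x))"
proof -
  have "pt (\<lambda>x. concat (map (\<lambda>e. if P x e then [e] else []) (xs x)))"
    by (intro pt_intros assms)
  moreover have "concat (map (\<lambda>e. if Q e then [e] else []) ys) = filter Q ys" for Q and ys :: "'b list"
    by (induction ys) auto
  ultimately show ?thesis by simp
qed

lemma pt_Ball [pt_intros]:
  assumes xs: "pt xs" and P: "pt (\<lambda>z. P (fst z) (snd z))"
  shows "pt (\<lambda>x. \<forall>e\<in>set (xs x). P x e)"
proof -
  have "pt (\<lambda>x. filter (\<lambda>e. \<not> P x e) (xs x) = [])" by (intro pt_intros xs P)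
  then show ?thesis by (simp add: filter_empty_conv)
qed

lemma pt_Bex [pt_intros]:
  assumes xs: "pt xs" and P: "pt (\<lambda>z. P (fst z) (snd z))"
  shows "pt (\<lambda>x. \<exists>e\<in>set (xs x). P x e)"
proof -
  have "pt (\<lambda>x. \<not> (\<forall>e\<in>set (xs x). \<not> P x e))" by (intro pt_intros xs P)
  then show ?thesis by simp
qed


subsection \<open>Natural numbers in unary\<close>

lemma pt_Suc [pt_intros]:
  assumes "pt f"
  shows "pt (\<lambda>x. Suc (f x))"
  using PT_Node[OF PT_const assms[unfolded pt_def], of Leaf] by (simp add: pt_def code_nat_def)

lemma pt_pred:
  assumes "pt f"
  shows "pt (\<lambda>x. f x - (1 :: nat))"
proof -
  have "right (unspine (replicate n Leaf)) = unspine (replicate (n - 1) Leaf)" for n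
    by (cases n) auto
  then show ?thesis using PT_comp[OF PT_right assms[unfolded pt_def]] by (simp add: pt_def code_nat_def)
qed

lemma pt_replicate_unit:
  assumes "pt n"
  shows "pt (\<lambda>x. replicate (n x) ())"
  using assms by (simp add: pt_def code_nat_def code_list_def code_unit_def)

lemma pt_length [pt_intros]:
  assumes "pt xs"
  shows "pt (\<lambda>x. length (xs x))"
proof -
  have "pt (\<lambda>x. map (\<lambda>_. ()) (xs x))" by (intro pt_intros assms)
  then show ?thesis by (simp add: pt_def code_nat_def code_list_def code_unit_def map_replicate_const o_def)
qed

lemma pt_replicate [pt_intros]:
  assumes "pt n" "pt a"
  shows "pt (\<lambda>x. replicate (n x) (a x))"
proof -
  have "pt (\<lambda>x. map (\<lambda>_. a x) (replicate (n x) ()))"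
    by (intro pt_intros pt_replicate_unit assms pt_comp[OF assms(2)])
  then show ?thesis by simp
qed

lemma pt_upt [pt_intros]:
  assumes n: "pt n"
  shows "pt (\<lambda>x. [0..<n x])"
proof -
  have eq: "foldl (\<lambda>acc _. acc @ [length acc]) [] us = [0..<length us]" for us :: "unit list"
    by (induction us rule: rev_induct) auto
  obtain p where p: "\<And>x. dsize (n x) \<le> poly p (dsize x)" by (rule pt_size[OF n]) blast
  let ?B = "\<lambda>n. Suc (poly p n * Suc (poly p n))"
  have "pt (\<lambda>x. foldl (\<lambda>acc _. acc @ [length acc]) [] (replicate (n x) ()))"
  proof (rule pt_foldl[where B = ?B])
    show "dsize (foldl (\<lambda>acc _. acc @ [length acc]) [] (take i (replicate (n x) ()))) \<le> ?B (dsize x)" for x i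
    proof -
      have "dsize [0..<min i (n x)] \<le> Suc (length [0..<min i (n x)] * Suc (poly p (dsize x)))"
        by (rule dsize_le_if_bounded) (use p[of x] in \<open>auto simp: dsize_nat\<close>)
      also have "\<dots> \<le> ?B (dsize x)"
        using p[of x] by (intro Suc_le_mono[THEN iffD2] mult_le_mono1) (simp add: dsize_nat)
      finally show ?thesis by (simp add: eq take_replicate)
    qed
  qed (intro n pt_intros polyb_intros)+
  then show ?thesis by (simp add: eq)
qed

lemma pt_add [pt_intros]:
  assumes "pt m" "pt n"
  shows "pt (\<lambda>x. m x + n x :: nat)"
proof -
  have "pt (\<lambda>x. length (replicate (m x) () @ replicate (n x) ()))" by (intro pt_intros assms)
  then show ?thesis by simp
qed

lemma pt_mult [pt_intros]:
  assumes "pt m" "pt n"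
  shows "pt (\<lambda>x. m x * n x :: nat)"
proof -
  have "pt (\<lambda>x. length (concat (map (\<lambda>_. replicate (n x) ()) (replicate (m x) ()))))"
    by (intro pt_intros assms pt_comp[OF assms(2)])
  then show ?thesis by (simp add: length_concat sum_list_replicate)
qed

lemma pt_diff [pt_intros]:
  assumes m: "pt m" and n: "pt n"
  shows "pt (\<lambda>x. m x - n x :: nat)"
proof -
  have eq: "foldl (\<lambda>acc _. acc - Suc 0) a us = a - length us" for us :: "unit list" and a
    by (induction us arbitrary: a) auto
  obtain p where p: "\<And>x. dsize (m x) \<le> poly p (dsize x)" by (rule pt_size[OF m]) blast
  have "pt (\<lambda>x. foldl (\<lambda>acc _. acc - 1) (m x) (replicate (n x) ()))"
  proof (rule pt_foldl[where B = "poly p"])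
    show "dsize (foldl (\<lambda>acc _. acc - 1) (m x) (take i (replicate (n x) ()))) \<le> poly p (dsize x)" for x i
      using p[of x] by (simp add: eq dsize_nat)
  qed (intro m n pt_intros pt_pred polyb_intros)+
  then show ?thesis by (simp add: eq)
qed

lemma pt_le [pt_intros]:
  assumes "pt m" "pt n"
  shows "pt (\<lambda>x. m x \<le> (n x :: nat))"
proof -
  have "pt (\<lambda>x. m x - n x = 0)" by (intro pt_intros assms)
  then show ?thesis by simp
qed

lemma pt_less [pt_intros]:
  assumes "pt m" "pt n"
  shows "pt (\<lambda>x. m x < (n x :: nat))"
proof -
  have "pt (\<lambda>x. Suc (m x) \<le> n x)" by (intro pt_intros assms)
  then show ?thesis by (simp add: Suc_le_eq)
qed

lemma pt_sum_list [pt_intros]: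
  assumes "pt xs"
  shows "pt (\<lambda>x. sum_list (xs x) :: nat)"
proof -
  have "pt (\<lambda>x. length (concat (map (\<lambda>n. replicate n ()) (xs x))))" by (intro pt_intros assms)
  then show ?thesis by (simp add: length_concat o_def)
qed

lemma pt_poly [pt_intros]:
  assumes "pt n"
  shows "pt (\<lambda>x. poly p (n x) :: nat)"
proof (induction p)
  case (pCons a p)
  have "pt (\<lambda>x. a + n x * poly p (n x))" by (intro pt_intros assms pCons)
  then show ?case by simp
qed (simp add: pt_intros)

lemma pt_enumerate [pt_intros]:
  fixes xs :: "'a :: data \<Rightarrow> 'b :: data list"
  assumes xs: "pt xs"
  shows "pt (\<lambda>x. List.enumerate 0 (xs x))"
proof -
  have eq: "foldl (\<lambda>acc e. acc @ [(length acc, e)]) [] ys = List.enumerate 0 ys" for ys :: "'b list"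
    by (induction ys rule: rev_induct) (auto simp: enumerate_append_eq)
  obtain p where p: "\<And>x. dsize (xs x) \<le> poly p (dsize x)" by (rule pt_size[OF xs]) blast
  let ?B = "\<lambda>n. Suc (poly p n * Suc (Suc (Suc (2 * poly p n) + poly p n)))"
  have "pt (\<lambda>x. foldl (\<lambda>acc e. acc @ [(length acc, e)]) [] (xs x))"
  proof (rule pt_foldl[where B = ?B])
    show "dsize (foldl (\<lambda>acc e. acc @ [(length acc, e)]) [] (take i (xs x))) \<le> ?B (dsize x)" for x i
    proof -
      let ?e = "List.enumerate 0 (take i (xs x))"
      have "dsize ?e \<le> Suc (length ?e * Suc (Suc (Suc (2 * poly p (dsize x)) + poly p (dsize x))))"
      proof (rule dsize_le_if_bounded)
        fix z assume "z \<in> set ?e"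
        then have "fst z < length (xs x)" "snd z \<in> set (xs x)"
          by (auto simp: in_set_enumerate_eq dest: nth_mem)
        then show "dsize z \<le> Suc (Suc (2 * poly p (dsize x)) + poly p (dsize x))"
          using length_less_dsize[of "xs x"] dsize_elem[of "snd z" "xs x"] p[of x]
          by (cases z) (auto simp: dsize_nat)
      qed
      also have "\<dots> \<le> ?B (dsize x)"
        using p[of x] length_less_dsize[of "xs x"] by (intro Suc_le_mono[THEN iffD2] mult_le_mono1) simp
      finally show ?thesis by (simp add: eq)
    qed
  qed (intro xs pt_intros polyb_intros)+
  then show ?thesis by (simp add: eq)
qed

lemma pt_take [pt_intros]:
  assumes "pt n" "pt xs"
  shows "pt (\<lambda>x. take (n x) (xs x))"
proof -
  have "pt (\<lambda>x. map snd (filter (\<lambda>z. fst z < n x) (List.enumerate 0 (xs x))))"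
    by (intro pt_intros assms pt_comp[OF assms(1)])
  moreover have "map snd (filter (\<lambda>z. fst z < n) (List.enumerate k ys)) = take (n - k) ys" for n k and ys :: "'b list"
  proof (induction ys arbitrary: k)
    case (Cons y ys)
    then show ?case by (cases "n - k") (auto simp: Suc_diff_Suc diff_Suc split: nat.splits)
  qed simp
  ultimately show ?thesis by simp
qed

definition first :: "'a \<Rightarrow> 'a list \<Rightarrow> 'a" where
  "first a xs = (case xs of [] \<Rightarrow> a | x # _ \<Rightarrow> x)"

lemma first_simps [simp]: "first a [] = a" "first a (x # xs) = x"
  by (simp_all add: first_def)

lemma pt_first [pt_intros]:
  fixes xs :: "'a :: data \<Rightarrow> 'b :: data list"
  assumes xs: "pt xs" and a: "pt a"
  shows "pt (\<lambda>x. first (a x) (xs x))"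
proof -
  have "PT (\<lambda>t. if code (xs (decode t)) = Leaf then code (a (decode t)) else left (code (xs (decode t))))"
    using assms unfolding pt_def by (intro PT_cond PT_comp[OF PT_left])
  moreover have "(if code ys = Leaf then code b else left (code ys)) = code (first b ys)" for b and ys :: "'b list"
    by (cases ys) (auto simp: code_list_def)
  ultimately show ?thesis unfolding pt_def by simp
qed

lemma pt_tl [pt_intros]:
  fixes xs :: "'a :: data \<Rightarrow> 'b :: data list"
  assumes "pt xs"
  shows "pt (\<lambda>x. tl (xs x))"
proof -
  have "right (code ys) = code (tl ys)" for ys :: "'b list"
    by (cases ys) (auto simp: code_list_def)
  then show ?thesis using PT_comp[OF PT_right assms[unfolded pt_def]] by (simp add: pt_def)
qed

lemma pt_enc_list [pt_intros]:
  assumes "pt xs" "pt (\<lambda>z. e (fst z) (snd z))"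
  shows "pt (\<lambda>x. enc_list (e x) (xs x))"
  unfolding enc_list_def by (intro pt_intros assms)


subsection \<open>Input and output\<close>

text \<open>A raw bit becomes a list cell, pushed back to front: two bits for a cell with
  \<open>Leaf\<close>, four for a cell with \<open>true_tree\<close>. Prepending cells reverses the
  list, hence the reversal of the input beforehand.\<close>

definition input_body :: com where
  "input_body = Case 1 Skip (Pop 1 ;; Push 0 False ;; Push 0 True)
     (Pop 1 ;; Push 0 False ;; Push 0 False ;; Push 0 True ;; Push 0 True)"

lemma runs_input_loop:
  "runs (While 1 input_body) ((\<lambda>_. [])(0 := ser (code ys), 1 := xs)) (12 * length xs + 1)
    (input_regs (ser (code (rev xs @ ys))))"
proof (induction xs arbitrary: ys)
  case Nil
  show ?case by (rule runs_weaken[OF runs_While_empty]) (auto simp: input_regs_def)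
next
  case (Cons x xs)
  let ?e = "\<lambda>_ :: nat. [] :: bool list"
  have 1: "runs input_body (?e(0 := ser (code ys), 1 := x # xs)) 11 (?e(0 := ser (code (x # ys)), 1 := xs))"
  proof (cases x)
    case True
    show ?thesis
      unfolding input_body_def
      by (rule runs_weaken[OF runs_Case_True[OF _ runs_Seq[OF runs_Pop runs_Seq[OF runs_Push
          runs_Seq[OF runs_Push runs_Seq[OF runs_Push runs_Push]]]]]])
        (auto simp: True code_list_def code_bool_def true_tree_def fun_eq_iff)
  next
    case False
    show ?thesis
      unfolding input_body_def
      by (rule runs_weaken[OF runs_Case_False[OF _ runs_Seq[OF runs_Pop runs_Seq[OF runs_Push runs_Push]]]])
        (auto simp: False code_list_def code_bool_def fun_eq_iff)
  qed
  show ?case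
    by (rule runs_weaken[OF runs_While[OF _ 1 Cons.IH]]) auto
qed

definition output_body :: com where
  "output_body = Case 0 Skip (Pop 0) (Pop 0 ;; Case 0 Skip (Pop 0 ;; Push 1 False)
     (Pop 0 ;; Pop 0 ;; Pop 0 ;; Push 1 True))"

lemma runs_output_loop:
  "runs (While 0 output_body) ((\<lambda>_. [])(0 := ser (code xs), 1 := ys)) (12 * length xs + 4)
    ((\<lambda>_. [])(1 := rev xs @ ys))"
proof (induction xs arbitrary: ys)
  case Nil
  have 1: "runs output_body ((\<lambda>_. [])(0 := ser (code ([] :: bool list)), 1 := ys)) (Suc 1) ((\<lambda>_. [])(1 := ys))"
    unfolding output_body_def
    by (rule runs_weaken[OF runs_Case_False[OF _ runs_Pop]]) (auto simp: code_list_def fun_eq_iff)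
  show ?case
    by (rule runs_weaken[OF runs_While[OF _ 1 runs_While_empty]]) (auto simp: code_list_def)
next
  case (Cons x xs)
  let ?e = "\<lambda>_ :: nat. [] :: bool list"
  have 1: "runs output_body (?e(0 := ser (code (x # xs)), 1 := ys)) 10 (?e(0 := ser (code xs), 1 := x # ys))"
  proof (cases x)
    case True
    show ?thesis
      unfolding output_body_def
      by (rule runs_weaken[OF runs_Case_True[OF _ runs_Seq[OF runs_Pop runs_Case_True[OF _
          runs_Seq[OF runs_Pop runs_Seq[OF runs_Pop runs_Seq[OF runs_Pop runs_Push]]]]]]])
        (auto simp: True code_list_def code_bool_def true_tree_def fun_eq_iff)
  next
    case False
    show ?thesis
      unfolding output_body_def
      by (rule runs_weaken[OF runs_Case_True[OF _ runs_Seq[OF runs_Pop runs_Case_False[OF _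
          runs_Seq[OF runs_Pop runs_Push]]]]])
        (auto simp: False code_list_def code_bool_def fun_eq_iff)
  qed
  show ?case
    by (rule runs_weaken[OF runs_While[OF _ 1 Cons.IH]]) (auto simp: code_list_def)
qed

lemma dsize_bits: "dsize (xs :: bool list) \<le> Suc (4 * length xs)"
proof (induction xs)
  case (Cons x xs)
  then show ?case using dsize_bool[of x] by simp
qed simp

lemma polytime_computable_if_pt:
  fixes f :: "bool list \<Rightarrow> bool list"
  assumes "pt f"
  shows "polytime_computable f"
proof -
  obtain c p where c: "\<forall>t. runs c (input_regs (ser t)) (poly p (tsize t)) (input_regs (ser (code (f (decode t)))))"
    by (rule PT_E[OF assms[unfolded pt_def]])
  obtain q where q: "\<And>x. dsize (f x) \<le> poly q (dsize x)" by (rule pt_size[OF assms]) blast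
  let ?c = "mv 0 1 ;; Push 0 False ;; While 1 input_body ;; c ;; While 0 output_body ;; mv 1 0"
  let ?T = "\<lambda>n. (5 * n + 1) + (2 + ((12 * n + 1) + (poly p (Suc (4 * n)) +
    (12 * poly q (Suc (4 * n)) + 4 + (5 * poly q (Suc (4 * n)) + 1)))))"
  show ?thesis
  proof (rule polytime_computable_if_runs)
    show "polyb ?T" by (intro polyb_intros)
    show "\<exists>s. runs ?c (input_regs x) (?T (length x)) s \<and> s 0 = f x" for x
    proof (intro exI conjI)
      let ?e = "\<lambda>_ :: nat. [] :: bool list"
      have 1: "runs (mv 0 1) (input_regs x) (5 * length x + 1) (?e(1 := rev x))"
        by (rule runs_weaken[OF runs_mv]) (auto simp: fun_eq_iff input_regs_def)
      have 2: "runs (Push 0 False) (?e(1 := rev x)) 2 (?e(0 := ser (code ([] :: bool list)), 1 := rev x))"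
        by (rule runs_weaken[OF runs_Push]) (auto simp: fun_eq_iff code_list_def)
      have 3: "runs (While 1 input_body) (?e(0 := ser (code ([] :: bool list)), 1 := rev x)) (12 * length x + 1)
          (input_regs (ser (code x)))"
        by (rule runs_weaken[OF runs_input_loop]) auto
      have 4: "runs c (input_regs (ser (code x))) (poly p (Suc (4 * length x))) (?e(0 := ser (code (f x)), 1 := []))"
        by (rule runs_weaken[OF c[rule_format]]) (auto intro: poly_nat_mono dsize_bits simp: fun_eq_iff input_regs_def)
      have 5: "runs (While 0 output_body) (?e(0 := ser (code (f x)), 1 := [])) (12 * length (f x) + 4) (?e(1 := rev (f x)))"
        by (rule runs_weaken[OF runs_output_loop]) auto
      have 6: "runs (mv 1 0) (?e(1 := rev (f x))) (5 * length (f x) + 1) (input_regs (f x))"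
        by (rule runs_weaken[OF runs_mv]) (auto simp: fun_eq_iff input_regs_def)
      have "length (f x) \<le> poly q (Suc (4 * length x))"
        using length_less_dsize[of "f x"] q[of x] poly_nat_mono[OF dsize_bits[of x], of q] by linarith
      then show "runs ?c (input_regs x) (?T (length x)) (input_regs (f x))"
        by (intro runs_weaken[OF runs_Seq[OF 1 runs_Seq[OF 2 runs_Seq[OF 3 runs_Seq[OF 4 runs_Seq[OF 5 6]]]]]]) auto
    qed simp
  qed
qed


section \<open>Membership in NP\<close>

text \<open>Prefix notation evaluated from right to left with a stack of finished trees. The default
  \<open>Leaf\<close> gives every bit string a value, so no certificate is ill-formed.\<close>

fun deser_step :: "bool \<Rightarrow> tree list \<Rightarrow> tree list" where
  "deser_step b ts = (if b then Node (first Leaf ts) (first Leaf (tl ts)) # tl (tl ts) else Leaf # ts)"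

declare deser_step.simps [simp del]

definition deser :: "bool list \<Rightarrow> tree" where
  "deser bs = first Leaf (foldr deser_step bs [])"

lemma foldr_deser_step: "foldr deser_step (ser t) ts = t # ts"
  by (induction t arbitrary: ts) (simp_all add: deser_step.simps)

lemma deser_ser: "deser (ser t) = t"
  by (simp add: deser_def foldr_deser_step)

lemma dsize_deser_step: "dsize (deser_step b ts) \<le> dsize ts + 4"
proof (cases ts)
  case (Cons t us)
  then show ?thesis by (cases us) (auto simp: deser_step.simps code_tree_def)
qed (auto simp: deser_step.simps code_tree_def)

lemma pt_deser: "pt deser"
proof -
  have step: "pt (\<lambda>z :: bool list \<times> tree list \<times> bool. deser_step (snd (snd z)) (fst (snd z)))"
    unfolding deser_step.simps by (intro pt_intros)
  have size: "dsize (foldl (\<lambda>ts b. deser_step b ts) ts bs) \<le> dsize ts + 4 * length bs" for ts bs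
  proof (induction bs arbitrary: ts)
    case (Cons b bs)
    show ?case using Cons[of "deser_step b ts"] dsize_deser_step[of b ts] by simp
  qed simp
  have "pt (\<lambda>bs. foldl (\<lambda>ts b. deser_step b ts) [] (rev bs))"
  proof (rule pt_foldl[where B = "\<lambda>n. 1 + 4 * n"])
    show "dsize (foldl (\<lambda>ts b. deser_step b ts) [] (take i (rev bs))) \<le> 1 + 4 * dsize bs" for bs i
      using size[of "[]" "take i (rev bs)"] length_less_dsize[of bs] by simp
  qed (intro step pt_intros polyb_intros)+
  then have "pt (\<lambda>bs. first Leaf (foldl (\<lambda>ts b. deser_step b ts) [] (rev bs)))"
    by (intro pt_intros)
  then show ?thesis by (simp add: deser_def[abs_def] foldr_conv_foldl)
qed

text \<open>The mode of the parser tells whether it expects a list tag, a list element, or the rest.\<close>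

definition unpair_step :: "nat \<times> bool list \<times> bool list \<Rightarrow> bool \<Rightarrow> nat \<times> bool list \<times> bool list" where
  "unpair_step s b = (if fst s = 0 then (if b then 1 else 2, fst (snd s), snd (snd s))
     else if fst s = 1 then (0, b # fst (snd s), snd (snd s))
     else (2, fst (snd s), b # snd (snd s)))"

definition unpair :: "bool list \<Rightarrow> bool list \<times> bool list" where
  "unpair bs = (let s = foldl unpair_step (0, [], []) bs in (rev (fst (snd s)), rev (snd (snd s))))"

lemma unpair_enc_pair: "unpair (enc_pair x w) = (x, w)"
proof -
  have 1: "foldl unpair_step (2, xs, ws) w = (2, xs, rev w @ ws)" for xs ws w
    by (induction w arbitrary: ws) (auto simp: unpair_step_def)
  have "foldl unpair_step (0, xs, ws) (enc_list (\<lambda>b. [b]) x) = (2, rev x @ xs, ws)" for xs ws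
    by (induction x arbitrary: xs) (auto simp: unpair_step_def enc_list_def)
  then show ?thesis by (simp add: unpair_def enc_pair_def 1)
qed

lemma pt_unpair: "pt unpair"
proof -
  have step: "dsize (snd (unpair_step s b)) \<le> dsize (snd s) + 4" "fst (unpair_step s b) \<le> 2" for s b
    using dsize_bool[of b] by (cases s, auto simp: unpair_step_def)+
  have size: "dsize (snd (foldl unpair_step s bs)) \<le> dsize (snd s) + 4 * length bs \<and>
      fst (foldl unpair_step s bs) \<le> 2" if "fst s \<le> 2" for s bs
    using that
  proof (induction bs arbitrary: s)
    case (Cons b bs)
    from Cons.IH[OF step(2)[of s b]] step(1)[of s b] show ?case by simp
  qed simp
  have "pt (foldl unpair_step (0, [], []))"
  proof (rule pt_foldl[where B = "\<lambda>n. 10 + 4 * n" and xs = "\<lambda>bs. bs" and f = "\<lambda>_. unpair_step" and a = "\<lambda>_. (0, [], [])"])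
    show "pt (\<lambda>z. unpair_step (fst (snd z)) (snd (snd z)))" unfolding unpair_step_def by (intro pt_intros)
    show "dsize (foldl unpair_step (0, [], []) (take i bs)) \<le> 10 + 4 * dsize bs" for bs i
      using size[of "(0, [], [])" "take i bs"] length_less_dsize[of bs]
      by (cases "foldl unpair_step (0, [], []) (take i bs)") (auto simp: dsize_nat)
  qed (intro pt_intros polyb_intros)+
  then have "pt (\<lambda>bs. (rev (fst (snd (foldl unpair_step (0, [], []) bs))),
      rev (snd (snd (foldl unpair_step (0, [], []) bs)))))"
    by (intro pt_intros)
  then show ?thesis by (simp add: unpair_def[abs_def] Let_def)
qed

text \<open>Certificates may be taken from any data type: a bit string is read as a tree and the
  tree is decoded. Soundness is asked of every \<open>w\<close>, hence also of the values of
  malformed strings.\<close>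

lemma in_NP_if_pt:
  fixes R :: "bool list \<Rightarrow> 'w :: data \<Rightarrow> bool" and p :: "nat poly"
  assumes R: "pt (\<lambda>z. R (fst z) (snd z))"
    and sound: "\<And>x w. R x w \<Longrightarrow> x \<in> L"
    and complete: "\<And>x. x \<in> L \<Longrightarrow> \<exists>w. dsize w \<le> poly p (length x) \<and> R x w"
  shows "in_NP L"
proof -
  define V where "V = {z. R (fst (unpair z)) (decode (deser (snd (unpair z))))}"
  have decode: "pt (decode :: tree \<Rightarrow> 'w)"
    unfolding pt_def decode_tree_def by (rule PT_normal)
  have "pt (\<lambda>z. R (fst (unpair z)) (decode (deser (snd (unpair z)))))"
    using pt_comp[OF R, of "\<lambda>z. (fst (unpair z), decode (deser (snd (unpair z))))"]
    by (simp add: pt_intros pt_unpair pt_comp[OF decode] pt_comp[OF pt_deser])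
  then have "pt (\<lambda>z. [R (fst (unpair z)) (decode (deser (snd (unpair z))))])"
    by (intro pt_intros)
  then have "polytime_decidable V"
    unfolding polytime_decidable_def V_def by (intro polytime_computable_if_pt) simp
  moreover have "x \<in> L \<longleftrightarrow> (\<exists>w. length w \<le> poly p (length x) \<and> enc_pair x w \<in> V)" for x
  proof
    assume "x \<in> L"
    then obtain w where "dsize w \<le> poly p (length x)" "R x w" using complete by blast
    then show "\<exists>w. length w \<le> poly p (length x) \<and> enc_pair x w \<in> V"
      by (intro exI[of _ "ser (code w)"]) (simp add: V_def unpair_enc_pair deser_ser)
  next
    assume "\<exists>w. length w \<le> poly p (length x) \<and> enc_pair x w \<in> V"
    then show "x \<in> L" using sound by (auto simp: V_def unpair_enc_pair)
  qed
  ultimately show ?thesis unfolding in_NP_def by blast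
qed


subsection \<open>Binary arithmetic\<close>

text \<open>Makes bounded minimisation available to \<open>pt\<close>, with \<open>m\<close> as the
  sign of failure; halving and \<open>slot\<close> are defined by it.\<close>

lemma first_filter_upt:
  "first m (filter P [0..<m]) = (if \<exists>k<m. P k then (LEAST k. k < m \<and> P k) else m)"
proof (cases "\<exists>k<m. P k")
  case True
  then obtain k xs where ks: "filter P [0..<m] = k # xs" by (cases "filter P [0..<m]") (auto simp: filter_empty_conv)
  have k: "k < m" "P k"
    using ks filter_set[of P "[0..<m]"] by (auto simp: filter_eq_Cons_iff) (metis atLeastLessThan_iff in_set_conv_decomp set_upt)
  have "k \<le> l" if "l < m" "P l" for l
  proof -
    have "l \<in> set (k # xs)" using that ks[symmetric] by simp
    moreover have "sorted (k # xs)" using ks[symmetric] by (simp only: sorted_wrt_filter sorted_upt)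
    ultimately show ?thesis by auto
  qed
  then have "(LEAST k. k < m \<and> P k) = k" using k by (intro Least_equality) auto
  then show ?thesis using ks True by simp
next
  case False
  then have "filter P [0..<m] = []" by (auto simp: filter_empty_conv)
  then show ?thesis using False by auto
qed

lemma pt_half [pt_intros]:
  assumes "pt n"
  shows "pt (\<lambda>x. n x div (2 :: nat))"
proof -
  have "pt (\<lambda>x. first (Suc (n x)) (filter (\<lambda>k. n x \<le> 2 * k + 1) [0..<Suc (n x)]))"
    by (intro pt_intros assms pt_comp[OF assms])
  moreover have "first (Suc n) (filter (\<lambda>k. n \<le> 2 * k + 1) [0..<Suc n]) = n div 2" for n
  proof -
    have "(LEAST k. k < Suc n \<and> n \<le> 2 * k + 1) = n div 2" by (rule Least_equality) auto
    moreover have "\<exists>k<Suc n. n \<le> 2 * k + 1" by (intro exI[of _ n]) auto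
    ultimately show ?thesis unfolding first_filter_upt by simp
  qed
  ultimately show ?thesis by simp
qed

definition digit_step :: "nat \<times> bool list \<Rightarrow> nat \<times> bool list" where
  "digit_step s = (if fst s = 0 then s else (fst s div 2, (fst s \<noteq> 2 * (fst s div 2)) # snd s))"

text \<open>As many rounds as the value of \<open>n\<close> are more than enough; a round that finds
  0 changes nothing.\<close>

lemma foldl_digit_step:
  "n \<le> length us \<Longrightarrow> foldl (\<lambda>s u. digit_step s) (n, out) us = (0, rev (binary_digits n) @ out)"
proof (induction us arbitrary: n out)
  case Nil
  then show ?case by (simp add: binary_digits.simps)
next
  case (Cons u us)
  show ?case
  proof (cases "n = 0")
    case True
    then show ?thesis using Cons.IH[of 0 out] by (simp add: digit_step_def)
  next
    case False
    have "(n \<noteq> 2 * (n div 2)) = odd n" by presburger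
    then have st: "digit_step (n, out) = (n div 2, odd n # out)"
      using False unfolding digit_step_def fst_conv snd_conv by (simp only: if_False)
    have "n div 2 \<le> length us" using Cons.prems by auto
    from Cons.IH[OF this] show ?thesis
      using False by (simp add: st binary_digits.simps[of n])
  qed
qed

lemma pt_binary_digits [pt_intros]:
  assumes n: "pt n"
  shows "pt (\<lambda>x. binary_digits (n x))"
proof -
  obtain p where p: "\<And>x. dsize (n x) \<le> poly p (dsize x)" by (rule pt_size[OF n]) blast
  have size: "dsize (foldl (\<lambda>s u. digit_step s) s us) \<le> dsize s + 4 * length us" for s and us :: "unit list"
  proof (induction us arbitrary: s)
    case (Cons u us)
    have "dsize (digit_step s) \<le> dsize s + 4"
      using dsize_bool[of "fst s \<noteq> 2 * (fst s div 2)"] by (cases s) (auto simp: digit_step_def dsize_nat)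
    then show ?case using Cons[of "digit_step s"] by simp
  qed simp
  have "pt (\<lambda>x. foldl (\<lambda>s u. digit_step s) (n x, []) (replicate (n x) ()))"
  proof (rule pt_foldl[where B = "\<lambda>n. Suc (Suc (poly p n)) + 4 * poly p n"])
    show "pt (\<lambda>z :: 'a \<times> (nat \<times> bool list) \<times> unit. digit_step (fst (snd z)))"
      unfolding digit_step_def by (intro pt_intros)
    show "dsize (foldl (\<lambda>s u. digit_step s) (n x, []) (take i (replicate (n x) ())))
        \<le> Suc (Suc (poly p (dsize x))) + 4 * poly p (dsize x)" for x i
      using size[of "(n x, [])" "take i (replicate (n x) ())"] p[of x] by (simp add: dsize_nat)
  qed (intro pt_intros n polyb_intros)+
  then have "pt (\<lambda>x. rev (snd (foldl (\<lambda>s u. digit_step s) (n x, []) (replicate (n x) ()))))"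
    by (intro pt_intros)
  then show ?thesis by (simp add: foldl_digit_step)
qed

primrec val :: "bool list \<Rightarrow> nat" where
  "val [] = 0"
| "val (b # bs) = of_bool b + 2 * val bs"

lemma val_binary_digits [simp]: "val (binary_digits n) = n"
proof (induction n rule: binary_digits.induct)
  case (1 n)
  show ?case
  proof (cases "n = 0")
    case False
    then have "val (binary_digits n) = of_bool (odd n) + 2 * (n div 2)"
      using 1 by (simp add: binary_digits.simps[of n])
    then show ?thesis by (simp add: odd_two_times_div_two_succ)
  qed (simp add: binary_digits.simps)
qed

text \<open>The most significant digit is the last one and must not be 0. The default
  \<open>True\<close> admits the empty list, the code of 0. These lists are exactly the values of
  \<open>binary_digits\<close>.\<close>

definition canonical :: "bool list \<Rightarrow> bool" where
  "canonical bs \<longleftrightarrow> first True (rev bs)"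

lemma canonical_Cons: "canonical (b # bs) \<longleftrightarrow> (if bs = [] then b else canonical bs)"
  unfolding canonical_def by (cases "rev bs") auto

lemma canonical_binary_digits: "canonical (binary_digits n)"
proof (induction n rule: binary_digits.induct)
  case (1 n)
  show ?case
  proof (cases "n = 0")
    case False
    moreover have "odd n" if "binary_digits (n div 2) = []"
    proof -
      have "n div 2 = 0" using that by (simp add: binary_digits.simps[of "n div 2"] split: if_splits)
      then show ?thesis using False by presburger
    qed
    ultimately show ?thesis using 1 by (auto simp: binary_digits.simps[of n] canonical_Cons)
  qed (simp add: binary_digits.simps canonical_def)
qed

lemma binary_digits_val: "canonical bs \<Longrightarrow> binary_digits (val bs) = bs"
proof (induction bs)
  case (Cons b bs)
  have c: "canonical bs"
  proof (cases "bs = []")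
    case True
    then show ?thesis by (simp add: canonical_def)
  next
    case False
    then show ?thesis using Cons.prems by (simp add: canonical_Cons)
  qed
  have "val (b # bs) \<noteq> 0"
  proof
    assume "val (b # bs) = 0"
    then have v: "val bs = 0" "\<not> b" by auto
    then have "bs = []" using Cons.IH[OF c] by (simp add: binary_digits.simps)
    then show False using Cons.prems v by (simp add: canonical_Cons)
  qed
  then have "binary_digits (val (b # bs)) = odd (val (b # bs)) # binary_digits (val (b # bs) div 2)"
    by (subst binary_digits.simps) (simp only: if_False)
  moreover have "odd (val (b # bs)) = b" "val (b # bs) div 2 = val bs" by auto
  ultimately show ?case using Cons.IH[OF c] by (simp only:)
qed (simp add: binary_digits.simps)

text \<open>The only arithmetic of the verifier; with \<open>[]\<close> as second argument it is a
  plain comparison.\<close>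

definition leq_sum :: "bool list \<Rightarrow> bool list \<Rightarrow> bool list \<Rightarrow> bool" where
  "leq_sum x y z \<longleftrightarrow> val x + val y \<le> val z"

text \<open>
  The state consists of the remaining digits of the three numbers, the carry of the addition, and
  the result of the comparison of the digits seen so far, least significant digits first.
\<close>

definition cmp_step ::
    "bool list \<times> bool list \<times> bool list \<times> bool \<times> bool \<Rightarrow> bool list \<times> bool list \<times> bool list \<times> bool \<times> bool" where
  "cmp_step = (\<lambda>(x, y, z, c, r).
     let a = first False x; b = first False y; d = first False z
     in (tl x, tl y, tl z, (if a then b \<or> c else b \<and> c),
         if ((a = b) = c) = d then r else d))"

lemma val_first_tl: "val x = of_bool (first False x) + 2 * val (tl x)"
  by (cases x) auto

text \<open>The strict length bound leaves a round in which all digits are spent and the last carry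
  is absorbed. The second disjunct is the state after that round. A more significant digit that
  differs overrides the verdict of the lower ones.\<close>

lemma foldl_cmp_step:
  assumes "(length x < length us \<and> length y < length us \<and> length z < length us) \<or>
    (us = [] \<and> x = [] \<and> y = [] \<and> z = [] \<and> \<not> c)"
  shows "snd (snd (snd (snd (foldl (\<lambda>s u. cmp_step s) (x, y, z, c, r) us)))) =
    (if val x + val y + of_bool c = val z then r else val x + val y + of_bool c < val z)"
  using assms
proof (induction us arbitrary: x y z c r)
  case (Cons u us)
  define a b d where "a = first False x" and "b = first False y" and "d = first False z"
  define c' r' where "c' = (if a then b \<or> c else b \<and> c)" and "r' = (if ((a = b) = c) = d then r else d)"
  have step: "cmp_step (x, y, z, c, r) = (tl x, tl y, tl z, c', r')"
    by (simp add: cmp_step_def a_def b_def d_def c'_def r'_def)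
  have v: "val x = of_bool a + 2 * val (tl x)" "val y = of_bool b + 2 * val (tl y)"
      "val z = of_bool d + 2 * val (tl z)"
    unfolding a_def b_def d_def by (rule val_first_tl)+
  have "(length (tl x) < length us \<and> length (tl y) < length us \<and> length (tl z) < length us) \<or>
    (us = [] \<and> tl x = [] \<and> tl y = [] \<and> tl z = [] \<and> \<not> c')"
  proof (cases "us = []")
    case True
    then have "x = []" "y = []" "z = []" using Cons.prems by auto
    then show ?thesis using True by (simp add: c'_def a_def b_def)
  next
    case False
    then have "length (tl v) < length us" if "length v < length (u # us)" for v :: "bool list"
      using that by (cases v) auto
    then show ?thesis using Cons.prems by blast
  qed
  note IH = Cons.IH[OF this, of r']
  have "(if X + Y + of_bool c' = Z then r' else X + Y + of_bool c' < Z) =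
    (if of_bool a + 2 * X + (of_bool b + 2 * Y) + of_bool c = of_bool d + 2 * Z then r
     else of_bool a + 2 * X + (of_bool b + 2 * Y) + of_bool c < of_bool d + 2 * Z)" for X Y Z :: nat
    unfolding c'_def r'_def by (cases a; cases b; cases c; cases d; simp; arith)
  then show ?case unfolding foldl.simps step IH v .
qed auto

lemma pt_leq_sum [pt_intros]:
  assumes "pt f" "pt g" "pt h"
  shows "pt (\<lambda>x. leq_sum (f x) (g x) (h x))"
proof -
  have size: "dsize (foldl (\<lambda>s u. cmp_step s) s us) \<le> dsize s + 6" for s and us :: "bool list"
  proof (cases "us = []")
    case False
    have tl: "dsize (tl xs) \<le> dsize xs" for xs :: "bool list" by (cases xs) auto
    obtain x y z c r where s: "s = (x, y, z, c, r)" by (cases s)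
    have "\<exists>c' r'. foldl (\<lambda>s u. cmp_step s) s us = (drop (length us) x, drop (length us) y, drop (length us) z, c', r')"
      unfolding s
    proof (induction us arbitrary: x y z c r)
      case (Cons u us)
      then show ?case by (auto simp: cmp_step_def Let_def drop_Suc)
    qed auto
    then obtain c' r' where
      *: "foldl (\<lambda>s u. cmp_step s) s us = (drop (length us) x, drop (length us) y, drop (length us) z, c', r')"
      by blast
    have drop: "dsize (drop i xs) \<le> dsize xs" for i and xs :: "bool list"
      using dsize_append[of "take i xs" "drop i xs"] tsize_pos[of "code (take i xs)"]
      by (simp del: length_greater_0_conv)
    show ?thesis
      unfolding * using drop[of "length us" x] drop[of "length us" y] drop[of "length us" z]
        dsize_bool[of c'] dsize_bool[of r'] by (simp add: s)
  qed simp
  obtain p where p: "\<And>x. dsize (f x, g x, h x, False, True) \<le> poly p (dsize x)"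
    by (rule pt_size[of "\<lambda>x. (f x, g x, h x, False, True)"]) (intro pt_intros assms, blast)
  \<comment> \<open>The folded list only counts rounds: one more than the three lengths together
    exceeds each of them strictly.\<close>
  have "pt (\<lambda>x. foldl (\<lambda>s u. cmp_step s) (f x, g x, h x, False, True) (True # f x @ g x @ h x))"
  proof (rule pt_foldl[where B = "\<lambda>n. poly p n + 6"])
    show "pt (\<lambda>z :: 'a \<times> (bool list \<times> bool list \<times> bool list \<times> bool \<times> bool) \<times> bool. cmp_step (fst (snd z)))"
      unfolding cmp_step_def Let_def by (intro pt_intros)
    show "dsize (foldl (\<lambda>s u. cmp_step s) (f x, g x, h x, False, True) (take i (True # f x @ g x @ h x)))
        \<le> poly p (dsize x) + 6" for x i
      by (rule order_trans[OF size]) (use p[of x] in simp)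
  qed (intro pt_intros assms polyb_intros)+
  then have "pt (\<lambda>x. snd (snd (snd (snd (foldl (\<lambda>s u. cmp_step s) (f x, g x, h x, False, True)
      (True # f x @ g x @ h x))))))"
    by (intro pt_intros)
  moreover have "snd (snd (snd (snd (foldl (\<lambda>s u. cmp_step s) (x, y, z, False, True) (True # x @ y @ z))))) =
      leq_sum x y z" for x y z
    by (subst foldl_cmp_step) (auto simp: leq_sum_def)
  ultimately show ?thesis by simp
qed


subsection \<open>Integer schedules\<close>

lemma exec_time_le_iff:
  assumes "k \<ge> 0"
  shows "exec_time bvs t \<le> k \<longleftrightarrow> (\<forall>(b, v)\<in>set bvs. real b \<le> t \<longrightarrow> int v \<le> k)"
  unfolding exec_time_def using assms
  by (subst Max_le_iff) (auto simp: finite_exec_time_values)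

lemma exec_time_floor: "exec_time bvs (of_int \<lfloor>t\<rfloor>) = exec_time bvs t"
proof -
  have "real b \<le> of_int \<lfloor>t\<rfloor> \<longleftrightarrow> real b \<le> t" for b
    using le_floor_iff[of "int b" t] by (metis of_int_le_iff of_int_of_nat_eq)
  then show ?thesis unfolding exec_time_def by simp
qed

text \<open>\<open>C j\<close> is any upper bound on the completion time rather than its value, so
  each breakpoint contributes one inequality between natural numbers and no maximum has to be
  computed.\<close>

definition integer_schedule :: "task_set \<Rightarrow> (nat \<Rightarrow> nat) \<Rightarrow> (nat \<Rightarrow> nat) \<Rightarrow> bool" where
  "integer_schedule I s C \<longleftrightarrow>
     (\<forall>j<length I. s j \<le> C j \<and> int (C j) \<le> fst (I ! j) \<and>
        (\<forall>(b, v)\<in>set (snd (I ! j)). b \<le> s j \<longrightarrow> s j + v \<le> C j)) \<and>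
     (\<forall>i<length I. \<forall>j<length I. i \<noteq> j \<longrightarrow> C i \<le> s i \<or> C j \<le> s j \<or> C i \<le> s j \<or> C j \<le> s i)"

lemma schedulable_iff_integer: "schedulable I \<longleftrightarrow> (\<exists>s C. integer_schedule I s C)"
proof
  let ?p = "\<lambda>j. exec_time (snd (I ! j))"
  assume "schedulable I"
  then obtain s0 where "feasible_schedule {..<length I} (\<lambda>j. fst (I ! j)) ?p s0"
    unfolding schedulable_def by blast
  then have "feasible_schedule {..<length I} (\<lambda>j. fst (I ! j)) (\<lambda>j t. ?p j (of_int \<lfloor>t\<rfloor>)) s0"
    by (simp add: exec_time_floor)
  then have f: "feasible_schedule {..<length I} (\<lambda>j. fst (I ! j)) ?p (\<lambda>j. of_int \<lfloor>s0 j\<rfloor>)"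
    by (rule feasible_schedule_floor)
  define s where "s j = nat \<lfloor>s0 j\<rfloor>" for j
  define C where "C j = s j + nat (?p j (real (s j)))" for j
  have s: "real_of_int \<lfloor>s0 j\<rfloor> = real (s j)" if "j < length I" for j
    using f that by (auto simp: feasible_schedule_def s_def)
  have ct: "completion_time (?p j) (real (s j)) = real (C j)" for j
    using exec_time_nonneg[of "snd (I ! j)" "real (s j)"] by (simp add: completion_time_def C_def)
  have 1: "int (C j) \<le> fst (I ! j)" if "j < length I" for j
  proof -
    have "completion_time (?p j) (real_of_int \<lfloor>s0 j\<rfloor>) \<le> real_of_int (fst (I ! j))"
      using f that unfolding feasible_schedule_def by blast
    then show ?thesis unfolding s[OF that] ct by linarith
  qed
  have 2: "s j + v \<le> C j" if "(b, v) \<in> set (snd (I ! j))" "b \<le> s j" for j b v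
  proof -
    have "int v \<le> ?p j (real (s j))"
      using exec_time_le_iff[OF exec_time_nonneg, of "snd (I ! j)" "real (s j)" "snd (I ! j)" "real (s j)"] that by auto
    then show ?thesis by (simp add: C_def)
  qed
  have 3: "C i \<le> s i \<or> C j \<le> s j \<or> C i \<le> s j \<or> C j \<le> s i" if "i < length I" "j < length I" "i \<noteq> j" for i j
  proof -
    have "{real_of_int \<lfloor>s0 i\<rfloor>..<completion_time (?p i) (real_of_int \<lfloor>s0 i\<rfloor>)} \<inter>
        {real_of_int \<lfloor>s0 j\<rfloor>..<completion_time (?p j) (real_of_int \<lfloor>s0 j\<rfloor>)} = {}"
      using f that unfolding feasible_schedule_def disjoint_family_on_def by blast
    then show ?thesis unfolding s[OF that(1)] s[OF that(2)] ct disjoint_intervals_iff by simp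
  qed
  have "integer_schedule I s C"
    unfolding integer_schedule_def using 1 2 3 by (auto simp: C_def)
  then show "\<exists>s C. integer_schedule I s C" by blast
next
  let ?p = "\<lambda>j. exec_time (snd (I ! j))"
  assume "\<exists>s C. integer_schedule I s C"
  then obtain s C where sC: "integer_schedule I s C" by blast
  have ct: "completion_time (?p j) (real (s j)) \<le> real (C j)" if "j < length I" for j
  proof -
    have *: "s j \<le> C j" "\<forall>(b, v)\<in>set (snd (I ! j)). b \<le> s j \<longrightarrow> s j + v \<le> C j"
      using sC that by (auto simp: integer_schedule_def)
    have "?p j (real (s j)) \<le> int (C j) - int (s j)"
      by (subst exec_time_le_iff) (use * in \<open>force+\<close>)
    then show ?thesis unfolding completion_time_def by linarith
  qed
  have "feasible_schedule {..<length I} (\<lambda>j. fst (I ! j)) ?p (\<lambda>j. real (s j))"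
    unfolding feasible_schedule_def disjoint_family_on_def
  proof (intro conjI ballI impI)
    show "completion_time (?p j) (real (s j)) \<le> real_of_int (fst (I ! j))" if "j \<in> {..<length I}" for j
    proof -
      have "int (C j) \<le> fst (I ! j)" using sC that by (simp add: integer_schedule_def)
      then show ?thesis using ct[of j] that by simp
    qed
    fix i j assume ij: "i \<in> {..<length I}" "j \<in> {..<length I}" "i \<noteq> j"
    then have "C i \<le> s i \<or> C j \<le> s j \<or> C i \<le> s j \<or> C j \<le> s i"
      using sC by (simp add: integer_schedule_def)
    then show "{real (s i)..<completion_time (?p i) (real (s i))} \<inter> {real (s j)..<completion_time (?p j) (real (s j))} = {}"
      unfolding disjoint_intervals_iff using ct[of i] ct[of j] ij by fastforce
  qed simp
  then show "schedulable I" unfolding schedulable_def by blast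
qed


subsection \<open>The verifier\<close>

text \<open>An entry of a certificate: deadline, breakpoints, starting time, completion time, in binary.\<close>

type_synonym entry = "bool list \<times> (bool list \<times> bool list) list \<times> bool list \<times> bool list"

definition enc_bits :: "bool list \<Rightarrow> bool list" where
  "enc_bits bs = enc_list (\<lambda>b. [b]) bs"

text \<open>The leading \<open>False\<close> is the sign bit of the deadline: completion times are
  never negative, so a schedulable instance has no negative deadline.\<close>

definition enc_entry :: "entry \<Rightarrow> bool list" where
  "enc_entry = (\<lambda>(d, bvs, s, C). False # enc_bits d @ enc_list (\<lambda>(b, v). enc_bits b @ enc_bits v) bvs)"

definition enc_entries :: "entry list \<Rightarrow> bool list" where
  "enc_entries w = enc_list enc_entry w"

definition valid_entry :: "entry \<Rightarrow> bool" where
  "valid_entry = (\<lambda>(d, bvs, s, C). canonical d \<and> leq_sum s [] C \<and> leq_sum C [] d \<and>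
     (\<forall>(b, v)\<in>set bvs. canonical b \<and> canonical v \<and> (leq_sum b [] s \<longrightarrow> leq_sum s v C)))"

definition disjoint_entries :: "entry \<Rightarrow> entry \<Rightarrow> bool" where
  "disjoint_entries e e' = (case snd (snd e) of (s, C) \<Rightarrow> case snd (snd e') of (s', C') \<Rightarrow>
     leq_sum C [] s \<or> leq_sum C' [] s' \<or> leq_sum C [] s' \<or> leq_sum C' [] s)"

definition bounded_entry :: "nat \<Rightarrow> entry \<Rightarrow> bool" where
  "bounded_entry n = (\<lambda>(d, bvs, s, C). leq_sum d [] (binary_digits n) \<and>
     (\<forall>(b, v)\<in>set bvs. leq_sum b [] (binary_digits n) \<and> leq_sum v [] (binary_digits n)))"

text \<open>The certificate repeats the instance next to the schedule, so the input is checked by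
  encoding the certificate again instead of parsing. The flag \<open>bounded\<close> selects one of
  the two languages.\<close>

definition verify :: "bool \<Rightarrow> bool list \<Rightarrow> entry list \<Rightarrow> bool" where
  "verify bounded x w \<longleftrightarrow> x = enc_entries w \<and> (\<forall>e\<in>set w. valid_entry e) \<and>
     (\<forall>a\<in>set (List.enumerate 0 w). \<forall>b\<in>set (List.enumerate 0 w).
        fst a \<noteq> fst b \<longrightarrow> disjoint_entries (snd a) (snd b)) \<and>
     (bounded \<longrightarrow> (\<forall>e\<in>set w. bounded_entry (length w) e))"

lemma pt_canonical [pt_intros]: "pt f \<Longrightarrow> pt (\<lambda>x. canonical (f x))"
  unfolding canonical_def by (intro pt_intros)

lemma pt_enc_bits [pt_intros]: "pt f \<Longrightarrow> pt (\<lambda>x. enc_bits (f x))"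
  unfolding enc_bits_def by (intro pt_intros)

lemma pt_enc_entries: "pt enc_entries"
  unfolding enc_entries_def[abs_def] enc_entry_def by (intro pt_intros)

lemma pt_valid_entry: "pt valid_entry"
  unfolding valid_entry_def by (intro pt_intros)

lemma pt_disjoint_entries: "pt (\<lambda>z. disjoint_entries (fst z) (snd z))"
  unfolding disjoint_entries_def by (intro pt_intros)

lemma pt_bounded_entry: "pt (\<lambda>z. bounded_entry (fst z) (snd z))"
  unfolding bounded_entry_def by (intro pt_intros)

lemma pt_verify: "pt (\<lambda>z. verify bounded (fst z) (snd z))"
  unfolding verify_def
  using pt_comp[OF pt_disjoint_entries, of "\<lambda>z. (snd (snd (fst z)), snd (snd z))"]
    pt_comp[OF pt_bounded_entry, of "\<lambda>z. (length (snd (fst z)), snd z)"]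
  by (intro pt_intros pt_comp[OF pt_enc_entries] pt_comp[OF pt_valid_entry]) (simp_all add: pt_intros)

definition task_of :: "entry \<Rightarrow> task" where
  "task_of = (\<lambda>(d, bvs, s, C). (int (val d), map (\<lambda>(b, v). (val b, val v)) bvs))"

lemma enc_nat_val: "canonical bs \<Longrightarrow> enc_nat (val bs) = enc_bits bs"
  by (simp add: enc_nat_def enc_bits_def binary_digits_val)

lemma enc_list_map: "enc_list e (map f xs) = enc_list (\<lambda>x. e (f x)) xs"
  by (simp add: enc_list_def o_def)

lemma enc_list_cong: "(\<And>x. x \<in> set xs \<Longrightarrow> e x = e' x) \<Longrightarrow> enc_list e xs = enc_list e' xs"
  by (simp add: enc_list_def cong: map_cong)

lemma enc_task_set_entries:
  assumes "\<And>e. e \<in> set w \<Longrightarrow> valid_entry e"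
  shows "enc_task_set (map task_of w) = enc_entries w"
  unfolding enc_task_set_def enc_entries_def enc_list_map
proof (rule enc_list_cong)
  fix e assume "e \<in> set w"
  then have e: "valid_entry e" by (rule assms)
  obtain d bvs s C where e': "e = (d, bvs, s, C)" by (cases e)
  have "enc_list (\<lambda>(b, v). enc_nat b @ enc_nat v) (map (\<lambda>(b, v). (val b, val v)) bvs) =
      enc_list (\<lambda>(b, v). enc_bits b @ enc_bits v) bvs"
    unfolding enc_list_map
    by (rule enc_list_cong) (use e in \<open>auto simp: e' valid_entry_def enc_nat_val\<close>)
  then show "enc_task (task_of e) = enc_entry e"
    using e by (simp add: e' enc_entry_def task_of_def enc_task_def enc_int_def valid_entry_def enc_nat_val)
qed

definition small_instance :: "task_set \<Rightarrow> bool" where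
  "small_instance I \<longleftrightarrow> (\<forall>a\<in>numbers I. a \<le> length I)"

lemma small_instance_entries:
  "small_instance (map task_of w) \<longleftrightarrow> (\<forall>e\<in>set w. bounded_entry (length w) e)"
proof -
  have "(\<forall>a\<in>numbers (map task_of w). a \<le> n) \<longleftrightarrow> (\<forall>e\<in>set w. bounded_entry n e)" for n
  proof (induction w)
    case (Cons e w)
    obtain d bvs s C where e: "e = (d, bvs, s, C)" by (cases e)
    have "numbers (map task_of (e # w)) = insert (val d) (\<Union>(b, v)\<in>set bvs. {val b, val v}) \<union> numbers (map task_of w)"
      by (simp add: numbers_def e task_of_def case_prod_beta)
    then show ?case using Cons by (auto simp: e bounded_entry_def leq_sum_def)
  qed (simp add: numbers_def)
  then show ?thesis by (simp add: small_instance_def)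
qed

lemma verify_sound:
  assumes "verify bounded x w"
  shows "x \<in> enc_task_set ` {I. schedulable I \<and> (bounded \<longrightarrow> small_instance I)}"
proof -
  let ?I = "map task_of w"
  have v: "\<And>e. e \<in> set w \<Longrightarrow> valid_entry e" using assms by (simp add: verify_def)
  have "x = enc_task_set ?I" using assms enc_task_set_entries[OF v] by (simp add: verify_def)
  moreover have "bounded \<longrightarrow> small_instance ?I" using assms by (simp add: verify_def small_instance_entries)
  moreover have "integer_schedule ?I (\<lambda>j. val (fst (snd (snd (w ! j))))) (\<lambda>j. val (snd (snd (snd (w ! j)))))"
    (is "integer_schedule _ ?s ?C")
    unfolding integer_schedule_def
  proof (intro conjI allI impI)
    fix j assume j: "j < length ?I"
    obtain d bvs s C where e: "w ! j = (d, bvs, s, C)" by (cases "w ! j")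
    have "valid_entry (d, bvs, s, C)" using v[OF nth_mem, of j] j e by simp
    then show "?s j \<le> ?C j" "int (?C j) \<le> fst (?I ! j)"
      "\<forall>(b, v)\<in>set (snd (?I ! j)). b \<le> ?s j \<longrightarrow> ?s j + v \<le> ?C j"
      using j e by (auto simp: valid_entry_def leq_sum_def task_of_def)
  next
    fix i j assume ij: "i < length ?I" "j < length ?I" "i \<noteq> j"
    have "(i, w ! i) \<in> set (List.enumerate 0 w)" "(j, w ! j) \<in> set (List.enumerate 0 w)"
      using ij by (auto simp: in_set_enumerate_eq)
    then have "disjoint_entries (w ! i) (w ! j)"
      using assms ij(3) unfolding verify_def by fastforce
    then show "?C i \<le> ?s i \<or> ?C j \<le> ?s j \<or> ?C i \<le> ?s j \<or> ?C j \<le> ?s i"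
      by (auto simp: disjoint_entries_def leq_sum_def case_prod_beta)
  qed
  ultimately show ?thesis using schedulable_iff_integer by blast
qed

lemma length_binary_digits_mono: "m \<le> n \<Longrightarrow> length (binary_digits m) \<le> length (binary_digits n)"
proof (induction m arbitrary: n rule: binary_digits.induct)
  case (1 m)
  show ?case
  proof (cases "m = 0")
    case False
    then have "length (binary_digits (m div 2)) \<le> length (binary_digits (n div 2))"
      using 1 by (intro "1.IH") (auto intro: div_le_mono)
    then show ?thesis using False 1 by (simp add: binary_digits.simps[of m] binary_digits.simps[of n])
  qed (simp add: binary_digits.simps)
qed

lemma length_enc_list: "length (enc_list e xs) = Suc (sum_list (map (\<lambda>x. Suc (length (e x))) xs))"
  by (simp add: enc_list_def length_concat o_def)

lemma length_enc_bits: "length (enc_bits bs) = Suc (2 * length bs)"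
  by (simp add: enc_bits_def length_enc_list sum_list_triv)

lemma dsize_list: "dsize xs = Suc (sum_list (map (\<lambda>x. Suc (dsize x)) xs))"
  by (induction xs) auto

text \<open>Times up to the deadline have no more digits than it, so a certificate is linear in the
  instance. The factor 6: a deadline and two times take up to four symbols per digit each, while the
  encoding spends two per digit of the deadline.\<close>

lemma dsize_entries:
  assumes "\<And>d bvs s C. (d, bvs, s, C) \<in> set w \<Longrightarrow> length s \<le> length d \<and> length C \<le> length d"
  shows "dsize w \<le> 6 * length (enc_entries w)"
proof -
  have "Suc (dsize e) \<le> 6 * Suc (length (enc_entry e))" if "e \<in> set w" for e
  proof -
    obtain d bvs s C where e: "e = (d, bvs, s, C)" by (cases e)
    have len: "length s \<le> length d" "length C \<le> length d" using assms that e by auto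
    have "sum_list (map (\<lambda>x. Suc (dsize x)) bvs)
        \<le> sum_list (map (\<lambda>x. 2 * Suc (length (case x of (b, v) \<Rightarrow> enc_bits b @ enc_bits v))) bvs)"
    proof (rule sum_list_mono)
      fix x assume "x \<in> set bvs"
      obtain b v where x: "x = (b, v)" by (cases x)
      show "Suc (dsize x) \<le> 2 * Suc (length (case x of (b, v) \<Rightarrow> enc_bits b @ enc_bits v))"
        using dsize_bits[of b] dsize_bits[of v] by (simp add: x length_enc_bits)
    qed
    also have "\<dots> = 2 * sum_list (map (\<lambda>x. Suc (length (case x of (b, v) \<Rightarrow> enc_bits b @ enc_bits v))) bvs)"
      by (rule sum_list_const_mult)
    finally have "dsize bvs \<le> 2 * length (enc_list (\<lambda>(b, v). enc_bits b @ enc_bits v) bvs)"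
      unfolding dsize_list length_enc_list by simp
    then show ?thesis
      using len dsize_bits[of d] dsize_bits[of s] dsize_bits[of C] by (simp add: e enc_entry_def length_enc_bits)
  qed
  then have "sum_list (map (\<lambda>e. Suc (dsize e)) w) \<le> sum_list (map (\<lambda>e. 6 * Suc (length (enc_entry e))) w)"
    by (intro sum_list_mono)
  also have "\<dots> = 6 * sum_list (map (\<lambda>e. Suc (length (enc_entry e))) w)"
    by (rule sum_list_const_mult)
  finally show ?thesis unfolding dsize_list enc_entries_def length_enc_list by simp
qed

lemma verify_complete:
  assumes "schedulable I" "bounded \<longrightarrow> small_instance I"
  shows "\<exists>w. dsize w \<le> 6 * length (enc_task_set I) \<and> verify bounded (enc_task_set I) w"
proof -
  obtain s C where sC: "integer_schedule I s C" using assms(1) schedulable_iff_integer by blast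
  define entry where "entry j = (binary_digits (nat (fst (I ! j))),
    map (\<lambda>(b, v). (binary_digits b, binary_digits v)) (snd (I ! j)), binary_digits (s j), binary_digits (C j))" for j
  define w where "w = map entry [0..<length I]"
  have j: "s j \<le> C j" "int (C j) \<le> fst (I ! j)" "\<forall>(b, v)\<in>set (snd (I ! j)). b \<le> s j \<longrightarrow> s j + v \<le> C j"
    if "j < length I" for j
    using sC that by (auto simp: integer_schedule_def)
  have task: "task_of (entry j) = I ! j" if "j < length I" for j
    using j[OF that] by (auto simp: task_of_def entry_def prod_eq_iff o_def case_prod_beta)
  have I: "map task_of w = I" by (rule nth_equalityI) (auto simp: w_def task)
  have valid: "valid_entry e" if e: "e \<in> set w" for e
  proof -
    obtain i where i: "i < length I" "e = entry i" using e by (auto simp: w_def)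
    show ?thesis using j[OF i(1)] unfolding i(2) entry_def valid_entry_def leq_sum_def
      by (auto simp: canonical_binary_digits)
  qed
  have x: "enc_task_set I = enc_entries w" using enc_task_set_entries[of w] valid I by simp
  have "disjoint_entries (snd a) (snd b)"
    if "a \<in> set (List.enumerate 0 w)" "b \<in> set (List.enumerate 0 w)" "fst a \<noteq> fst b" for a b
  proof -
    have nth: "fst c < length I \<and> snd c = entry (fst c)" if "c \<in> set (List.enumerate 0 w)" for c
      using that unfolding in_set_enumerate_eq w_def by auto
    have "C (fst a) \<le> s (fst a) \<or> C (fst b) \<le> s (fst b) \<or> C (fst a) \<le> s (fst b) \<or> C (fst b) \<le> s (fst a)"
      using sC that(3) nth[OF that(1)] nth[OF that(2)] unfolding integer_schedule_def by blast
    then show ?thesis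
      using nth[OF that(1)] nth[OF that(2)] by (simp add: disjoint_entries_def entry_def leq_sum_def)
  qed
  moreover have "bounded \<longrightarrow> (\<forall>e\<in>set w. bounded_entry (length w) e)"
    using assms(2) small_instance_entries[of w] I by simp
  ultimately have "verify bounded (enc_task_set I) w" unfolding verify_def using x valid by blast
  moreover have "dsize w \<le> 6 * length (enc_task_set I)"
    unfolding x
  proof (rule dsize_entries)
    fix d bvs s' C' assume "(d, bvs, s', C') \<in> set w"
    then obtain i where i: "i < length I" "(d, bvs, s', C') = entry i" by (auto simp: w_def)
    have "s i \<le> nat (fst (I ! i))" "C i \<le> nat (fst (I ! i))" using j[OF i(1)] by auto
    then show "length s' \<le> length d \<and> length C' \<le> length d"
      using i(2) length_binary_digits_mono by (simp add: entry_def)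
  qed
  ultimately show ?thesis by blast
qed

lemma in_NP_scheduling: "in_NP (enc_task_set ` {I. schedulable I \<and> (bounded \<longrightarrow> small_instance I)})"
proof (rule in_NP_if_pt[where R = "verify bounded" and p = "[:0, 6:]"])
  show "\<exists>w. dsize w \<le> poly [:0, 6:] (length x) \<and> verify bounded x w"
    if x: "x \<in> enc_task_set ` {I. schedulable I \<and> (bounded \<longrightarrow> small_instance I)}" for x
  proof -
    obtain I where I: "x = enc_task_set I" "schedulable I" "bounded \<longrightarrow> small_instance I"
      using x by auto
    from verify_complete[OF I(2,3)] show ?thesis unfolding I(1) by (simp add: mult.commute)
  qed
qed (rule pt_verify, rule verify_sound)


section \<open>From packing to scheduling\<close>

text \<open>Values of \<open>\<phi>\<close> from \<open>length B\<close> on stand for the garbage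
  bin, on which there is no condition.\<close>

definition packs :: "nat list \<Rightarrow> nat list \<Rightarrow> bool" where
  "packs A B \<longleftrightarrow> (\<exists>\<phi> :: nat \<Rightarrow> nat. \<forall>k<length B. (\<Sum>j | j < length A \<and> \<phi> j = k. A ! j) = B ! k)"

text \<open>Bin \<open>k\<close> is the stretch of work from \<open>cap B k\<close> to
  \<open>cap B (Suc k)\<close>.\<close>

definition cap :: "nat list \<Rightarrow> nat \<Rightarrow> nat" where
  "cap B k = sum_list (take k B)"

text \<open>
  Work done in the k-th bin (counted from 0) takes k + 1 units of time per unit of work; so
  \<open>clock B w\<close> is the time needed for an amount \<open>w\<close> of work done without interruption.
\<close>

definition clock :: "nat list \<Rightarrow> nat \<Rightarrow> nat" where
  "clock B w = w + sum_list (map (\<lambda>k. w - cap B (Suc k)) [0..<length B])"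

text \<open>The bin that a task started at \<open>t\<close> is charged for: the first one by whose
  end it can finish at that bin's own rate. The default \<open>length B\<close> is the garbage bin,
  which has no end.\<close>

definition slot :: "nat list \<Rightarrow> nat \<Rightarrow> nat \<Rightarrow> nat" where
  "slot B a t = first (length B) (filter (\<lambda>k. t + a * Suc k \<le> clock B (cap B (Suc k))) [0..<length B])"

definition duration :: "nat list \<Rightarrow> nat \<Rightarrow> nat \<Rightarrow> nat" where
  "duration B a t = a * Suc (slot B a t)"

section \<open>The clock as a convex function of the work\<close>

lemma clock_eq: "clock B w = w + (\<Sum>k<length B. w - cap B (Suc k))"
  by (simp add: clock_def interv_sum_list_conv_sum_set_nat atLeast0LessThan)

lemma cap_mono: "i \<le> k \<Longrightarrow> cap B i \<le> cap B k"
proof -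
  assume "i \<le> k"
  then have "take k B = take i B @ take (k - i) (drop i B)" by (metis le_add_diff_inverse take_add)
  then show ?thesis by (simp add: cap_def)
qed

lemma cap_0 [simp]: "cap B 0 = 0"
  by (simp add: cap_def)

lemma cap_Suc: "k < length B \<Longrightarrow> cap B (Suc k) = cap B k + B ! k"
  by (simp add: cap_def take_Suc_conv_app_nth)

lemma sum_if_less: "k \<le> m \<Longrightarrow> (\<Sum>i<m. if i < k then d else 0) = k * (d :: nat)"
proof -
  assume "k \<le> m"
  then have "{..<m} \<inter> {i. i < k} = {..<k}" by auto
  then show ?thesis by (simp add: sum.If_cases)
qed

text \<open>Each truncated difference in \<open>clock\<close> begins to grow where its bin ends and
  then raises the rate by 1. Beyond the beginning of bin \<open>k\<close> the first \<open>k\<close>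
  of them grow, so the slope is at least \<open>k + 1\<close>.\<close>

lemma clock_add_ge:
  assumes "k \<le> length B" "cap B k \<le> w"
  shows "clock B w + d * Suc k \<le> clock B (w + d)"
proof -
  have "(w - cap B (Suc i)) + (if i < k then d else 0) \<le> w + d - cap B (Suc i)" for i
    using assms(2) cap_mono[of "Suc i" k B] by auto
  then have "(\<Sum>i<length B. (w - cap B (Suc i)) + (if i < k then d else 0)) \<le> (\<Sum>i<length B. w + d - cap B (Suc i))"
    by (intro sum_mono)
  then show ?thesis
    unfolding clock_eq sum.distrib sum_if_less[OF assms(1)] by (simp add: mult.commute)
qed

text \<open>Up to the end of bin \<open>k\<close> at most the first \<open>k\<close> differences
  grow, so the slope is at most \<open>k + 1\<close>; it is smaller before bin \<open>k\<close>, so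
  equality places the whole stretch inside that bin.\<close>

lemma clock_add_le:
  assumes "k \<le> length B" "k < length B \<Longrightarrow> w + d \<le> cap B (Suc k)"
  shows "clock B (w + d) \<le> clock B w + d * Suc k"
    and "clock B (w + d) = clock B w + d * Suc k \<Longrightarrow> d > 0 \<Longrightarrow> cap B k \<le> w"
proof -
  let ?f = "\<lambda>i. w + d - cap B (Suc i)"
  let ?g = "\<lambda>i. (w - cap B (Suc i)) + (if i < k then d else 0)"
  have le: "?f i \<le> ?g i" if "i < length B" for i
    using assms(2) cap_mono[of "Suc k" "Suc i" B] that by (cases "i < k") auto
  have g: "sum ?g {..<length B} = (\<Sum>i<length B. w - cap B (Suc i)) + k * d"
    unfolding sum.distrib sum_if_less[OF assms(1)] ..
  have "sum ?f {..<length B} \<le> sum ?g {..<length B}"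
    using le by (intro sum_mono) auto
  then show "clock B (w + d) \<le> clock B w + d * Suc k"
    unfolding clock_eq g by (simp add: mult.commute)
  assume eq: "clock B (w + d) = clock B w + d * Suc k" and d: "d > 0"
  show "cap B k \<le> w"
  proof (rule ccontr)
    assume "\<not> cap B k \<le> w"
    \<comment> \<open>The difference belonging to the bin just before \<open>k\<close> is the strict
      one: it does not grow along the part of the stretch that lies before bin
      \<open>k\<close>.\<close>
    moreover from this obtain i where i: "k = Suc i" by (cases k) auto
    ultimately have "?f i < ?g i" using d by auto
    then have "sum ?f {..<length B} < sum ?g {..<length B}"
      using le assms(1) i by (intro sum_strict_mono_ex1) auto
    then show False using eq unfolding clock_eq g by (simp add: mult.commute)
  qed
qed

lemma clock_mono: "w \<le> w' \<Longrightarrow> clock B w \<le> clock B w'"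
  using clock_add_ge[of 0 B w "w' - w"] by simp

lemma slot_le: "slot B a t \<le> length B"
proof -
  have "first m (filter P [0..<m]) \<le> m" for m P
  proof (cases "filter P [0..<m]")
    case (Cons k ks)
    then have "k \<in> set (filter P [0..<m])" by simp
    then have "k < m" unfolding set_filter by simp
    then show ?thesis using Cons by simp
  qed simp
  then show ?thesis unfolding slot_def .
qed

lemma slot_fits:
  assumes "slot B a t < length B"
  shows "t + a * Suc (slot B a t) \<le> clock B (cap B (Suc (slot B a t)))"
proof -
  let ?P = "\<lambda>k. k < length B \<and> t + a * Suc k \<le> clock B (cap B (Suc k))"
  have ex: "\<exists>k. ?P k" using assms unfolding slot_def first_filter_upt by (auto split: if_splits)
  then have "slot B a t = (LEAST k. ?P k)" unfolding slot_def first_filter_upt by auto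
  then show ?thesis using LeastI_ex[OF ex] by simp
qed

lemma slot_least:
  assumes "k < length B" "t + a * Suc k \<le> clock B (cap B (Suc k))"
  shows "slot B a t \<le> k"
  using assms unfolding slot_def first_filter_upt by (auto intro: Least_le)

text \<open>A later start leaves less room in every bin, so the slot can only move on. For this
  reason the table of all values denotes \<open>duration\<close> itself and not a larger running
  maximum.\<close>

lemma duration_mono:
  assumes "t \<le> t'"
  shows "duration B a t \<le> duration B a t'"
proof -
  have "slot B a t \<le> slot B a t'"
  proof (cases "slot B a t' < length B")
    case True
    from slot_fits[OF True] assms show ?thesis by (intro slot_least True) simp
  next
    case False
    then show ?thesis using slot_le[of B a t] by simp
  qed
  then show ?thesis unfolding duration_def by (intro mult_le_mono2) simp
qed

text \<open>The clock needs at most \<open>k + 1\<close> per unit of work up to the end of bin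
  \<open>k\<close>, and \<open>t\<close> is not ahead of \<open>clock B w\<close>; so a task that
  fits by time at this rate also fits by work.\<close>

lemma work_before_slot_end:
  assumes "a > 0" "clock B w \<le> t" "slot B a t < length B"
  shows "w + a \<le> cap B (Suc (slot B a t))"
proof (rule ccontr)
  let ?k = "slot B a t"
  let ?V = "cap B (Suc ?k)"
  assume "\<not> w + a \<le> ?V"
  have fits: "t + a * Suc ?k \<le> clock B ?V" by (rule slot_fits[OF assms(3)])
  show False
  proof (cases "?V \<le> w")
    case True
    from clock_mono[OF this, of B] fits assms(1,2) show False by simp
  next
    case False
    define d where "d = ?V - w"
    have d: "d < a" "w + d = ?V" using False \<open>\<not> w + a \<le> ?V\<close> by (auto simp: d_def)
    have "clock B ?V \<le> clock B w + d * Suc ?k"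
      using clock_add_le(1)[of ?k B w d] assms(3) d by simp
    also have "\<dots> < t + a * Suc ?k" using assms(2) d(1) by (intro add_le_less_mono mult_less_mono1) auto
    finally show False using fits by simp
  qed
qed

text \<open>The work of the task ends within its slot, where the clock is no faster than the rate
  charged, so the slack cannot shrink. If it stays the same, the equality case of
  \<open>clock_add_le\<close> puts the work inside the slot's bin.\<close>

lemma clock_slack:
  assumes "a > 0" "clock B w \<le> t"
  shows "clock B (w + a) \<le> clock B w + duration B a t"
    and "clock B (w + a) = clock B w + duration B a t \<Longrightarrow> i \<le> length B \<Longrightarrow> cap B i \<le> w \<or> w + a \<le> cap B i"
proof -
  let ?k = "slot B a t"
  have fits: "?k < length B \<Longrightarrow> w + a \<le> cap B (Suc ?k)" by (rule work_before_slot_end[OF assms])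
  show "clock B (w + a) \<le> clock B w + duration B a t"
    unfolding duration_def by (rule clock_add_le(1)[OF slot_le fits])
  assume "clock B (w + a) = clock B w + duration B a t" "i \<le> length B"
  then have "cap B ?k \<le> w"
    using clock_add_le(2)[OF slot_le fits] assms(1) unfolding duration_def by blast
  then show "cap B i \<le> w \<or> w + a \<le> cap B i"
    using fits cap_mono[of i ?k B] cap_mono[of "Suc ?k" i B] \<open>i \<le> length B\<close> by (cases "i \<le> ?k") auto
qed

section \<open>From schedules to exact packings\<close>

primrec no_straddle :: "(nat \<Rightarrow> nat) \<Rightarrow> nat \<Rightarrow> nat \<Rightarrow> nat list \<Rightarrow> bool" where
  "no_straddle a V w [] \<longleftrightarrow> True"
| "no_straddle a V w (j # js) \<longleftrightarrow> (V \<le> w \<or> w + a j \<le> V) \<and> no_straddle a V (w + a j) js"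

text \<open>
  The slack, the time elapsed in excess of \<open>clock\<close> of the work done, never decreases; as it is 0 at
  the end it is always 0, which rules out a task that straddles the boundary between two bins.
\<close>

lemma schedule_no_straddle:
  assumes "sorted_wrt (\<lambda>i j. C i \<le> s j) js"
    and "\<forall>j\<in>set js. a j > 0 \<and> s j + duration B (a j) (s j) \<le> C j \<and> C j \<le> D \<and> t \<le> s j"
    and "t \<le> D" "clock B w \<le> t" "D \<le> clock B (w + sum_list (map a js))"
  shows "t = clock B w \<and> (\<forall>i\<le>length B. no_straddle a (cap B i) w js)"
  using assms
proof (induction js arbitrary: t w)
  case (Cons j js)
  have j: "a j > 0" "s j + duration B (a j) (s j) \<le> C j" "C j \<le> D" "t \<le> s j"
    using Cons.prems(2) by auto
  have sj: "clock B w \<le> s j" using Cons.prems(4) j(4) by simp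
  have le: "clock B (w + a j) \<le> clock B w + duration B (a j) (s j)"
    by (rule clock_slack(1)[OF j(1) sj])
  have IH: "C j = clock B (w + a j) \<and> (\<forall>i\<le>length B. no_straddle a (cap B i) (w + a j) js)"
  proof (rule Cons.IH)
    show "\<forall>i\<in>set js. a i > 0 \<and> s i + duration B (a i) (s i) \<le> C i \<and> C i \<le> D \<and> C j \<le> s i"
      using Cons.prems(1,2) by auto
    show "clock B (w + a j) \<le> C j" using le j(2) sj by simp
  qed (use Cons.prems j in \<open>auto simp: add.assoc\<close>)
  then have eq: "clock B (w + a j) = clock B w + duration B (a j) (s j)" "s j = clock B w"
    using le j(2) sj by auto
  have "cap B i \<le> w \<or> w + a j \<le> cap B i" if "i \<le> length B" for i
    by (rule clock_slack(2)[OF j(1) sj eq(1) that])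
  then show ?case using IH eq(2) j(4) Cons.prems(4) by auto
qed simp

primrec work_before :: "(nat \<Rightarrow> nat) \<Rightarrow> nat \<Rightarrow> nat list \<Rightarrow> nat \<Rightarrow> nat" where
  "work_before a w [] j = w"
| "work_before a w (i # is) j = (if i = j then w else work_before a (w + a i) is j)"

lemma work_before_ge: "w \<le> work_before a w js j"
proof (induction js arbitrary: w)
  case (Cons i js)
  show ?case using order_trans[OF _ Cons[of "w + a i"], of w] by simp
qed simp

text \<open>Tasks whose work begins below \<open>V\<close> form an initial segment of the list. None
  of them crosses \<open>V\<close> and the total work reaches \<open>V\<close>, so the segment ends
  exactly there.\<close>

lemma sum_no_straddle:
  assumes "no_straddle a V w js" "distinct js" "w \<le> V" "V \<le> w + sum_list (map a js)"
    "\<forall>j\<in>set js. a j > 0"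
  shows "w + (\<Sum>j | j \<in> set js \<and> work_before a w js j < V. a j) = V"
  using assms
proof (induction js arbitrary: w)
  case (Cons i js)
  have ni: "i \<notin> set js" and pos: "a i > 0" using Cons.prems by auto
  show ?case
  proof (cases "w = V")
    case True
    have "{j. j \<in> set (i # js) \<and> work_before a w (i # js) j < V} = {}"
    proof -
      have "V \<le> work_before a w (i # js) j" for j
        using work_before_ge[of w a "i # js" j] True by simp
      then show ?thesis by (simp add: not_less)
    qed
    then show ?thesis using True by (simp only: sum.empty)
  next
    case False
    then have le: "w < V" "w + a i \<le> V" using Cons.prems by auto
    let ?S = "{j. j \<in> set js \<and> work_before a (w + a i) js j < V}"
    have "{j. j \<in> set (i # js) \<and> work_before a w (i # js) j < V} = insert i ?S"
      using ni le by auto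
    moreover have "i \<notin> ?S" "finite ?S" using ni by auto
    moreover have "w + a i + (\<Sum>j\<in>?S. a j) = V"
      by (rule Cons.IH) (use Cons.prems le in \<open>auto simp: add.assoc\<close>)
    ultimately show ?thesis by (simp only: sum.insert) simp
  qed
qed simp

lemma packs_if_schedule:
  assumes pos: "\<And>j. j < length A \<Longrightarrow> A ! j > 0" and total: "sum_list B \<le> sum_list A"
    and item: "\<And>j. j < length A \<Longrightarrow> s j + duration B (A ! j) (s j) \<le> C j \<and> C j \<le> clock B (sum_list A)"
    and disj: "\<And>i j. i < length A \<Longrightarrow> j < length A \<Longrightarrow> i \<noteq> j \<Longrightarrow>
      C i \<le> s i \<or> C j \<le> s j \<or> C i \<le> s j \<or> C j \<le> s i"
  shows "packs A B"
proof -
  define a where "a j = A ! j" for j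
  define js where "js = sort_key s [0..<length A]"
  have set_js: "set js = {..<length A}" and dist: "distinct js" by (auto simp: js_def)
  have "sum_list (map a js) = sum a (set js)" by (rule sum_list_distinct_conv_sum_set[OF dist])
  also have "\<dots> = sum_list A" by (simp add: set_js sum_list_sum_nth a_def atLeast0LessThan)
  finally have sum_js: "sum_list (map a js) = sum_list A" .
  have nonempty: "s j < C j" if "j < length A" for j
    using item[OF that] pos[OF that] by (simp add: duration_def)
  have sorted: "sorted_wrt (\<lambda>i j. C i \<le> s j) js"
    unfolding sorted_wrt_iff_nth_less
  proof (intro allI impI)
    fix p q assume pq: "p < q" "q < length js"
    have ne: "js ! p \<noteq> js ! q" using dist pq nth_eq_iff_index_eq[of js p q] by auto
    have mem: "js ! p < length A" "js ! q < length A" using pq set_js nth_mem[of p js] nth_mem[of q js] by auto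
    have "sorted (map s js)" by (simp add: js_def)
    then have "s (js ! p) \<le> s (js ! q)" using pq sorted_nth_mono[of "map s js" p q] by simp
    then show "C (js ! p) \<le> s (js ! q)"
      using disj[OF mem ne] nonempty[OF mem(1)] nonempty[OF mem(2)] by linarith
  qed
  have "0 = clock B 0 \<and> (\<forall>i\<le>length B. no_straddle a (cap B i) 0 js)"
    by (rule schedule_no_straddle[OF sorted, where D = "clock B (sum_list A)"])
      (use item pos set_js sum_js in \<open>auto simp: a_def clock_def\<close>)
  then have ns: "no_straddle a (cap B i) 0 js" if "i \<le> length B" for i using that by blast
  define u where "u = work_before a 0 js"
  have below: "(\<Sum>j | j < length A \<and> u j < cap B i. a j) = cap B i" if "i \<le> length B" for i
  proof -
    have "cap B i \<le> sum_list A" using total cap_mono[OF that, of B] by (simp add: cap_def)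
    then show ?thesis
      using sum_no_straddle[OF ns[OF that] dist] sum_js pos set_js by (simp add: u_def a_def)
  qed
  \<comment> \<open>The bin in which the work of \<open>j\<close> begins. The disjunct
    \<open>k = length B\<close> guarantees a minimum and sends the remaining items to the garbage
    bin.\<close>
  define \<phi> where "\<phi> j = (LEAST k. k = length B \<or> u j < cap B (Suc k))" for j
  have phi: "\<phi> j = k \<longleftrightarrow> cap B k \<le> u j \<and> u j < cap B (Suc k)" if "k < length B" for j k
  proof
    assume k: "\<phi> j = k"
    have "\<phi> j = length B \<or> u j < cap B (Suc (\<phi> j))"
      unfolding \<phi>_def by (rule LeastI[of _ "length B"]) simp
    moreover have "cap B k \<le> u j"
    proof (cases k)
      case (Suc i)
      then have "\<not> (i = length B \<or> u j < cap B (Suc i))"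
        using k not_less_Least[of i "\<lambda>k. k = length B \<or> u j < cap B (Suc k)"] by (simp add: \<phi>_def)
      then show ?thesis using Suc by simp
    qed simp
    ultimately show "cap B k \<le> u j \<and> u j < cap B (Suc k)" using k that by simp
  next
    assume *: "cap B k \<le> u j \<and> u j < cap B (Suc k)"
    show "\<phi> j = k"
      unfolding \<phi>_def
    proof (rule Least_equality)
      fix y assume "y = length B \<or> u j < cap B (Suc y)"
      then show "k \<le> y" using * that cap_mono[of "Suc y" k B] by (cases "k \<le> y") auto
    qed (use * in simp)
  qed
  have "(\<Sum>j | j < length A \<and> \<phi> j = k. A ! j) = B ! k" if k: "k < length B" for k
  proof -
    let ?S = "\<lambda>i. {j. j < length A \<and> u j < cap B i}"
    have "{j. j < length A \<and> \<phi> j = k} = ?S (Suc k) - ?S k"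
      unfolding phi[OF k] using cap_mono[of k "Suc k" B] by (auto simp: not_less)
    moreover have "?S k \<subseteq> ?S (Suc k)" using cap_mono[of k "Suc k" B] by auto
    moreover have "finite (?S k)" by simp
    ultimately have "(\<Sum>j | j < length A \<and> \<phi> j = k. a j) = sum a (?S (Suc k)) - sum a (?S k)"
      by (simp only: sum_diff_nat)
    then show ?thesis using below[of k] below[of "Suc k"] k cap_Suc[OF k] by (simp add: a_def)
  qed
  then show ?thesis unfolding packs_def by blast
qed

section \<open>From exact packings to schedules\<close>

lemma schedule_if_packs:
  assumes "packs A B"
  shows "\<exists>s. (\<forall>j<length A. s j + duration B (A ! j) (s j) \<le> clock B (sum_list A)) \<and>
    (\<forall>i<length A. \<forall>j<length A. i \<noteq> j \<longrightarrow>
      s i + duration B (A ! i) (s i) \<le> s j \<or> s j + duration B (A ! j) (s j) \<le> s i)"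
proof -
  obtain \<phi>0 where \<phi>0: "\<And>k. k < length B \<Longrightarrow> (\<Sum>j | j < length A \<and> \<phi>0 j = k. A ! j) = B ! k"
    using assms unfolding packs_def by blast
  define m where "m = length B"
  \<comment> \<open>All garbage gets the one index \<open>m\<close>, so that it comes after every
    bin in the order below.\<close>
  define \<phi> where "\<phi> j = min m (\<phi>0 j)" for j :: nat
  define a where "a j = A ! j" for j
  have bin: "(\<Sum>j | j < length A \<and> \<phi> j = k. a j) = B ! k" if "k < m" for k
  proof -
    have "\<phi> j = k \<longleftrightarrow> \<phi>0 j = k" for j using that by (auto simp: \<phi>_def)
    then show ?thesis using \<phi>0[of k] that by (simp add: a_def m_def)
  qed
  have bins: "(\<Sum>j | j < length A \<and> \<phi> j < k. a j) = cap B k" if "k \<le> m" for k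
    using that
  proof (induction k)
    case (Suc k)
    have "{j. j < length A \<and> \<phi> j < Suc k} = {j. j < length A \<and> \<phi> j < k} \<union> {j. j < length A \<and> \<phi> j = k}"
      by auto
    then have "(\<Sum>j | j < length A \<and> \<phi> j < Suc k. a j) =
        (\<Sum>j | j < length A \<and> \<phi> j < k. a j) + (\<Sum>j | j < length A \<and> \<phi> j = k. a j)"
      by (simp only:) (rule sum.union_disjoint; auto)
    then show ?case using Suc bin[of k] cap_Suc[of k B] by (simp add: m_def)
  qed simp
  define before where "before i j \<longleftrightarrow> \<phi> i < \<phi> j \<or> \<phi> i = \<phi> j \<and> i < j" for i j
  define w where "w j = (\<Sum>i | i < length A \<and> before i j. a i)" for j
  have w_add: "w j + a j = (\<Sum>i\<in>insert j {i. i < length A \<and> before i j}. a i)" for j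
  proof -
    have "j \<notin> {i. i < length A \<and> before i j}" by (simp add: before_def)
    then show ?thesis by (simp add: w_def)
  qed
  have lower: "cap B (\<phi> j) \<le> w j" for j
    unfolding w_def using bins[of "\<phi> j", symmetric]
    by (simp add: \<phi>_def) (rule sum_mono2; auto simp: before_def \<phi>_def)
  have upper: "w j + a j \<le> cap B (Suc (\<phi> j))" if "j < length A" "\<phi> j < m" for j
    unfolding w_add using bins[of "Suc (\<phi> j)", symmetric] that
    by simp (rule sum_mono2; auto simp: before_def)
  have total: "w j + a j \<le> sum_list A" if "j < length A" for j
  proof -
    have "w j + a j \<le> sum a {..<length A}"
      unfolding w_add by (rule sum_mono2) (use that in auto)
    then show ?thesis by (simp add: sum_list_sum_nth a_def atLeast0LessThan)
  qed
  have trans: "w i + a i \<le> w j" if "before i j" "i < length A" for i j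
    unfolding w_add unfolding w_def by (rule sum_mono2) (use that in \<open>auto simp: before_def\<close>)
  \<comment> \<open>An item starts at the clock time of all the work ordered before it. It then
    suffices to bound its slot from above by its own bin.\<close>
  define s where "s j = clock B (w j)" for j
  have dur: "s j + duration B (a j) (s j) \<le> clock B (w j + a j)" if "j < length A" for j
  proof -
    have le: "\<phi> j \<le> length B" by (simp add: \<phi>_def m_def)
    have "slot B (a j) (s j) \<le> \<phi> j"
    proof (cases "\<phi> j < m")
      case True
      have "s j + a j * Suc (\<phi> j) \<le> clock B (w j + a j)"
        unfolding s_def by (rule clock_add_ge[OF le lower])
      also have "\<dots> \<le> clock B (cap B (Suc (\<phi> j)))" by (rule clock_mono[OF upper[OF that True]])
      finally show ?thesis using True by (intro slot_least) (auto simp: m_def)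
    next
      case False
      then show ?thesis using slot_le[of B "a j" "s j"] by (simp add: m_def)
    qed
    then have "duration B (a j) (s j) \<le> a j * Suc (\<phi> j)"
      unfolding duration_def by (intro mult_le_mono2) simp
    then show ?thesis using clock_add_ge[OF le lower, of "a j"] by (simp add: s_def)
  qed
  show ?thesis
  proof (intro exI[of _ s] conjI allI impI)
    show "s j + duration B (A ! j) (s j) \<le> clock B (sum_list A)" if "j < length A" for j
      using order_trans[OF dur[OF that] clock_mono[OF total[OF that]]] by (simp add: a_def)
    have *: "s i + duration B (A ! i) (s i) \<le> s j" if "before i j" "i < length A" for i j
      using order_trans[OF dur[OF that(2)] clock_mono[OF trans[OF that]]] by (simp add: a_def s_def)
    show "s i + duration B (A ! i) (s i) \<le> s j \<or> s j + duration B (A ! j) (s j) \<le> s i"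
      if "i < length A" "j < length A" "i \<noteq> j" for i j
    proof -
      have "before i j \<or> before j i" using that(3) by (auto simp: before_def)
      then show ?thesis using * that by blast
    qed
  qed
qed

section \<open>The task set of a packing problem\<close>

text \<open>The tasks (0, []) only serve to make the number of tasks exceed all numbers occurring.\<close>

definition packing_tasks :: "nat list \<Rightarrow> nat list \<Rightarrow> (nat \<times> (nat \<times> nat) list) list" where
  "packing_tasks A B =
     map (\<lambda>a. (clock B (sum_list A), map (\<lambda>t. (t, duration B a t)) [0..<Suc (clock B (sum_list A))])) A @
     replicate (clock B (sum_list A) + sum_list A * Suc (length B)) (0, [])"

definition task_set_of :: "(nat \<times> (nat \<times> nat) list) list \<Rightarrow> task_set" where
  "task_set_of = map (\<lambda>(d, bvs). (int d, bvs))"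

lemma small_packing_tasks: "small_instance (task_set_of (packing_tasks A B))"
proof -
  let ?D = "clock B (sum_list A)"
  have "x \<le> ?D + sum_list A * Suc (length B)" if x: "x \<in> numbers (task_set_of (packing_tasks A B))" for x
  proof -
    obtain d bvs where d: "(d, bvs) \<in> set (packing_tasks A B)"
        and x: "x = d \<or> (\<exists>(b, v)\<in>set bvs. x = b \<or> x = v)"
      using x unfolding numbers_def task_set_of_def by (auto simp: case_prod_beta) (metis fst_conv snd_conv)+
    show ?thesis
    proof (cases "bvs = []")
      case True
      then show ?thesis using d x by (auto simp: packing_tasks_def)
    next
      case False
      then obtain a where a: "a \<in> set A" "d = ?D" "bvs = map (\<lambda>t. (t, duration B a t)) [0..<Suc ?D]"
        using d by (auto simp: packing_tasks_def)
      have "duration B a t \<le> sum_list A * Suc (length B)" for t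
        unfolding duration_def using member_le_sum_list[OF a(1)] slot_le[of B a t]
        by (intro mult_le_mono) auto
      moreover have "x = ?D \<or> (\<exists>t<Suc ?D. x = t \<or> x = duration B a t)"
        using x unfolding a(2,3) by (auto simp del: upt_Suc)
      ultimately show ?thesis by (auto intro: trans_le_add1 trans_le_add2)
    qed
  qed
  then show ?thesis
    unfolding small_instance_def by (auto simp: task_set_of_def packing_tasks_def intro: trans_le_add2)
qed

lemma schedulable_packing_tasks:
  assumes pos: "\<And>j. j < length A \<Longrightarrow> A ! j > 0" and total: "sum_list B \<le> sum_list A"
  shows "schedulable (task_set_of (packing_tasks A B)) \<longleftrightarrow> packs A B"
proof -
  define D where "D = clock B (sum_list A)"
  define I where "I = task_set_of (packing_tasks A B)"
  have len: "length A \<le> length I" by (simp add: I_def task_set_of_def packing_tasks_def)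
  have item: "I ! j = (int D, map (\<lambda>t. (t, duration B (A ! j) t)) [0..<Suc D])" if "j < length A" for j
    using that by (simp add: I_def task_set_of_def packing_tasks_def D_def nth_append del: upt_Suc)
  have pad: "I ! j = (0, [])" if "j < length I" "\<not> j < length A" for j
    using that by (simp add: I_def task_set_of_def packing_tasks_def nth_append del: upt_Suc)
  have "packs A B" if I: "schedulable I"
  proof -
    obtain s C where sC: "integer_schedule I s C" using I schedulable_iff_integer by blast
    show ?thesis
    proof (rule packs_if_schedule[OF pos total, where s = s and C = C])
      fix j assume j: "j < length A"
      then have "s j \<le> C j \<and> int (C j) \<le> fst (I ! j) \<and>
          (\<forall>(b, v)\<in>set (snd (I ! j)). b \<le> s j \<longrightarrow> s j + v \<le> C j)"
        using sC len unfolding integer_schedule_def by simp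
      then have *: "s j \<le> C j" "int (C j) \<le> int D" "\<forall>t<Suc D. t \<le> s j \<longrightarrow> s j + duration B (A ! j) t \<le> C j"
        unfolding item[OF j] fst_conv snd_conv set_map by (auto simp del: upt_Suc)
      \<comment> \<open>The start is at most the deadline \<open>D\<close>, so the table has an
        entry for precisely this time.\<close>
      then show "s j + duration B (A ! j) (s j) \<le> C j \<and> C j \<le> clock B (sum_list A)"
        by (simp add: D_def)
    next
      fix i j assume "i < length A" "j < length A" "i \<noteq> j"
      then show "C i \<le> s i \<or> C j \<le> s j \<or> C i \<le> s j \<or> C j \<le> s i"
        using sC len unfolding integer_schedule_def by simp
    qed
  qed
  moreover have "schedulable I" if p: "packs A B"
  proof -
    obtain s where s: "\<forall>j<length A. s j + duration B (A ! j) (s j) \<le> clock B (sum_list A)"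
        "\<forall>i<length A. \<forall>j<length A. i \<noteq> j \<longrightarrow>
          s i + duration B (A ! i) (s i) \<le> s j \<or> s j + duration B (A ! j) (s j) \<le> s i"
      using schedule_if_packs[OF p] by blast
    note s = s[rule_format]
    \<comment> \<open>The padding tasks occupy the empty interval at time 0, which conflicts with
      nothing.\<close>
    define s' where "s' j = (if j < length A then s j else 0)" for j
    define C where "C j = (if j < length A then s j + duration B (A ! j) (s j) else 0)" for j
    have "integer_schedule I s' C"
      unfolding integer_schedule_def
    proof (intro conjI allI impI)
      fix j assume j: "j < length I"
      show "s' j \<le> C j" by (simp add: s'_def C_def)
      show "int (C j) \<le> fst (I ! j)"
        using s(1)[of j] item[of j] pad[OF j] by (cases "j < length A") (auto simp: C_def D_def)
      show "\<forall>(b, v)\<in>set (snd (I ! j)). b \<le> s' j \<longrightarrow> s' j + v \<le> C j"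
        using item[of j] pad[OF j] duration_mono[of _ "s j" B "A ! j"]
        by (cases "j < length A") (auto simp: C_def s'_def simp del: upt_Suc)
    next
      fix i j assume "i < length I" "j < length I" "i \<noteq> j"
      then show "C i \<le> s' i \<or> C j \<le> s' j \<or> C i \<le> s' j \<or> C j \<le> s' i"
        using s(2)[of i j] by (cases "i < length A"; cases "j < length A") (auto simp: C_def s'_def)
    qed
    then show ?thesis using schedulable_iff_integer by blast
  qed
  ultimately show ?thesis unfolding I_def by blast
qed

text \<open>An additional item too large for any bin makes the items at least as large as the bins.\<close>

lemma packs_snoc_large: "packs (A @ [Suc (sum_list B)]) B \<longleftrightarrow> packs A B"
proof
  let ?A = "A @ [Suc (sum_list B)]"
  assume "packs ?A B"
  then obtain \<phi> where \<phi>: "\<And>k. k < length B \<Longrightarrow> (\<Sum>j | j < length ?A \<and> \<phi> j = k. ?A ! j) = B ! k"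
    unfolding packs_def by blast
  have "\<not> \<phi> (length A) < length B"
  proof
    assume k: "\<phi> (length A) < length B"
    let ?k = "\<phi> (length A)"
    have "?A ! length A \<le> (\<Sum>j | j < length ?A \<and> \<phi> j = ?k. ?A ! j)"
      by (rule member_le_sum) auto
    also have "\<dots> \<le> sum_list B" using \<phi>[OF k] elem_le_sum_list[OF k] by simp
    finally show False by simp
  qed
  have "(\<Sum>j | j < length A \<and> \<phi> j = k. A ! j) = B ! k" if k: "k < length B" for k
  proof -
    have "{j. j < length ?A \<and> \<phi> j = k} = {j. j < length A \<and> \<phi> j = k}"
      using k \<open>\<not> \<phi> (length A) < length B\<close> by (auto simp: less_Suc_eq)
    then have "(\<Sum>j | j < length ?A \<and> \<phi> j = k. ?A ! j) = (\<Sum>j | j < length A \<and> \<phi> j = k. A ! j)"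
      by (intro sum.cong) (auto simp: nth_append)
    then show ?thesis using \<phi>[OF k] by simp
  qed
  then show "packs A B" unfolding packs_def by blast
next
  let ?A = "A @ [Suc (sum_list B)]"
  assume "packs A B"
  then obtain \<phi> where \<phi>: "\<And>k. k < length B \<Longrightarrow> (\<Sum>j | j < length A \<and> \<phi> j = k. A ! j) = B ! k"
    unfolding packs_def by blast
  define \<psi> where "\<psi> = \<phi>(length A := length B)"
  have "(\<Sum>j | j < length ?A \<and> \<psi> j = k. ?A ! j) = B ! k" if k: "k < length B" for k
  proof -
    have "(\<Sum>j | j < length ?A \<and> \<psi> j = k. ?A ! j) = (\<Sum>j | j < length A \<and> \<phi> j = k. A ! j)"
      using k by (intro sum.cong) (auto simp: \<psi>_def less_Suc_eq nth_append)
    then show ?thesis using \<phi>[OF k] by simp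
  qed
  then show "packs ?A B" unfolding packs_def by blast
qed

definition packing_instance :: "nat list \<Rightarrow> nat list \<Rightarrow> (nat \<times> (nat \<times> nat) list) list" where
  "packing_instance A B = packing_tasks (A @ [Suc (sum_list B)]) B"

lemma schedulable_packing_instance:
  assumes "\<And>a. a \<in> set A \<Longrightarrow> a > 0"
  shows "schedulable (task_set_of (packing_instance A B)) \<longleftrightarrow> packs A B"
proof -
  have "schedulable (task_set_of (packing_instance A B)) \<longleftrightarrow> packs (A @ [Suc (sum_list B)]) B"
    unfolding packing_instance_def
    by (rule schedulable_packing_tasks) (use assms in \<open>auto simp: nth_append less_Suc_eq\<close>)
  then show ?thesis by (simp add: packs_snoc_large)
qed

lemma pt_cap [pt_intros]:
  assumes "pt B" "pt k"
  shows "pt (\<lambda>x. cap (B x) (k x))"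
  unfolding cap_def by (intro pt_intros assms)

lemma pt_clock [pt_intros]:
  assumes "pt B" "pt w"
  shows "pt (\<lambda>x. clock (B x) (w x))"
  unfolding clock_def by (intro pt_intros assms pt_comp[OF assms(1)] pt_comp[OF assms(2)])

lemma pt_duration [pt_intros]:
  assumes "pt B" "pt a" "pt t"
  shows "pt (\<lambda>x. duration (B x) (a x) (t x))"
  unfolding duration_def slot_def
  by (intro pt_intros assms pt_comp[OF assms(1)] pt_comp[OF assms(2)] pt_comp[OF assms(3)])

lemma pt_packing_tasks [pt_intros]:
  assumes "pt A" "pt B"
  shows "pt (\<lambda>x. packing_tasks (A x) (B x))"
  unfolding packing_tasks_def
  by (intro pt_intros assms pt_comp[OF assms(1)] pt_comp[OF assms(2)])

lemma pt_packing_instance [pt_intros]: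
  assumes "pt A" "pt B"
  shows "pt (\<lambda>x. packing_instance (A x) (B x))"
  unfolding packing_instance_def by (intro pt_intros assms)

lemma pt_enc_task_set_of [pt_intros]:
  assumes "pt I"
  shows "pt (\<lambda>x. enc_task_set (task_set_of (I x)))"
proof -
  have "enc_task_set (task_set_of J) = enc_list (\<lambda>(d, bvs). False # enc_bits (binary_digits d) @
      enc_list (\<lambda>(b, v). enc_bits (binary_digits b) @ enc_bits (binary_digits v)) bvs) J" for J
    unfolding enc_task_set_def task_set_of_def enc_list_map
    by (rule enc_list_cong) (auto simp: enc_task_def enc_int_def enc_nat_def enc_bits_def)
  then show ?thesis by (simp only:) (intro pt_intros assms)
qed


section \<open>From satisfiability to packing\<close>

type_synonym 'v cnf = "(bool \<times> 'v) list list"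

definition sat :: "'v cnf \<Rightarrow> bool" where
  "sat F \<longleftrightarrow> (\<exists>\<sigma>. \<forall>C\<in>set F. \<exists>(b, v)\<in>set C. \<sigma> v = b)"

text \<open>Written as a left fold, the form of recursion that \<open>pt_foldl\<close>
  handles.\<close>

definition nub :: "'a list \<Rightarrow> 'a list" where
  "nub xs = foldl (\<lambda>acc e. if \<exists>e'\<in>set acc. e' = e then acc else acc @ [e]) [] xs"

lemma nub_snoc: "nub (xs @ [x]) = (if x \<in> set (nub xs) then nub xs else nub xs @ [x])"
  by (simp add: nub_def)

lemma set_nub [simp]: "set (nub xs) = set xs"
  by (induction xs rule: rev_induct) (auto simp: nub_snoc, simp add: nub_def)

lemma distinct_nub: "distinct (nub xs)"
proof (induction xs rule: rev_induct)
  case (snoc x xs)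
  then show ?case by (auto simp: nub_snoc)
qed (simp add: nub_def)

lemma dsize_nub: "dsize (nub xs) \<le> dsize xs"
proof (induction xs rule: rev_induct)
  case (snoc x xs)
  then show ?case
    using dsize_append[of xs "[x]"] dsize_append[of "nub xs" "[x]"] by (auto simp: nub_snoc)
qed (simp add: nub_def)

lemma pt_nub [pt_intros]:
  assumes xs: "pt xs"
  shows "pt (\<lambda>x. nub (xs x))"
proof -
  obtain p where p: "\<And>x. dsize (xs x) \<le> poly p (dsize x)" by (rule pt_size[OF xs]) blast
  show ?thesis
    unfolding nub_def
  proof (rule pt_foldl[where B = "poly p"])
    show "dsize (foldl (\<lambda>acc e. if \<exists>e'\<in>set acc. e' = e then acc else acc @ [e]) [] (take i (xs x)))
        \<le> poly p (dsize x)" for x i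
      using order_trans[OF dsize_nub order_trans[OF dsize_take p]] unfolding nub_def .
  qed (intro pt_intros xs polyb_intros)+
qed


subsection \<open>Packing problems in which every bin holds two items\<close>

text \<open>Replaces positions in lists by labels; \<open>None\<close> is the garbage bin.
  Distinctness makes a label stand for a single position.\<close>

lemma packs_iff_assignment:
  fixes Is :: "'i list" and Bs :: "'b list"
  assumes "distinct Is" "distinct Bs"
  shows "packs (map sz Is) (map bs Bs) \<longleftrightarrow>
    (\<exists>\<psi>. \<forall>b\<in>set Bs. (\<Sum>x | x \<in> set Is \<and> \<psi> x = Some b. sz x) = bs b)"
proof -
  have bij: "bij_betw ((!) Is) {j. j < length Is \<and> P (Is ! j)} {x \<in> set Is. P x}" for P
    unfolding bij_betw_def
  proof
    show "inj_on ((!) Is) {j. j < length Is \<and> P (Is ! j)}"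
      using assms(1) by (auto simp: inj_on_def nth_eq_iff_index_eq)
    show "(!) Is ` {j. j < length Is \<and> P (Is ! j)} = {x \<in> set Is. P x}"
      by (auto simp: in_set_conv_nth)
  qed
  have sum: "(\<Sum>j | j < length Is \<and> P (Is ! j). map sz Is ! j) = (\<Sum>x | x \<in> set Is \<and> P x. sz x)" for P
  proof -
    have "(\<Sum>j | j < length Is \<and> P (Is ! j). map sz Is ! j) = (\<Sum>j | j < length Is \<and> P (Is ! j). sz (Is ! j))"
      by (rule sum.cong) auto
    also have "\<dots> = (\<Sum>x | x \<in> set Is \<and> P x. sz x)" by (rule sum.reindex_bij_betw[OF bij])
    finally show ?thesis .
  qed
  show ?thesis
  proof
    assume "packs (map sz Is) (map bs Bs)"
    then obtain \<phi> where \<phi>: "\<And>k. k < length Bs \<Longrightarrow> (\<Sum>j | j < length Is \<and> \<phi> j = k. map sz Is ! j) = bs (Bs ! k)"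
      unfolding packs_def by auto
    define ix where "ix x = (THE j. j < length Is \<and> Is ! j = x)" for x
    have ix: "ix (Is ! j) = j" if "j < length Is" for j
      unfolding ix_def using that assms(1) by (intro the_equality) (auto simp: nth_eq_iff_index_eq)
    define \<psi> where "\<psi> x = (if \<phi> (ix x) < length Bs then Some (Bs ! \<phi> (ix x)) else None)" for x
    have "(\<Sum>x | x \<in> set Is \<and> \<psi> x = Some b. sz x) = bs b" if b: "b \<in> set Bs" for b
    proof -
      obtain k where k: "k < length Bs" "b = Bs ! k" using b by (auto simp: in_set_conv_nth)
      have "\<psi> (Is ! j) = Some b \<longleftrightarrow> \<phi> j = k" if "j < length Is" for j
        using k ix[OF that] assms(2) by (auto simp: \<psi>_def nth_eq_iff_index_eq)
      then have "{j. j < length Is \<and> \<psi> (Is ! j) = Some b} = {j. j < length Is \<and> \<phi> j = k}" by auto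
      then show ?thesis using sum[of "\<lambda>x. \<psi> x = Some b"] \<phi>[OF k(1)] k(2) by simp
    qed
    then show "\<exists>\<psi>. \<forall>b\<in>set Bs. (\<Sum>x | x \<in> set Is \<and> \<psi> x = Some b. sz x) = bs b" by blast
  next
    assume "\<exists>\<psi>. \<forall>b\<in>set Bs. (\<Sum>x | x \<in> set Is \<and> \<psi> x = Some b. sz x) = bs b"
    then obtain \<psi> where \<psi>: "\<And>b. b \<in> set Bs \<Longrightarrow> (\<Sum>x | x \<in> set Is \<and> \<psi> x = Some b. sz x) = bs b"
      by blast
    define \<phi> where "\<phi> j = (if \<exists>k<length Bs. \<psi> (Is ! j) = Some (Bs ! k)
      then THE k. k < length Bs \<and> \<psi> (Is ! j) = Some (Bs ! k) else length Bs)" for j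
    have "\<phi> j = k \<longleftrightarrow> \<psi> (Is ! j) = Some (Bs ! k)" if k: "k < length Bs" for j k
    proof (cases "\<exists>k<length Bs. \<psi> (Is ! j) = Some (Bs ! k)")
      case True
      then obtain k' where k': "k' < length Bs" "\<psi> (Is ! j) = Some (Bs ! k')" by blast
      have "(THE k. k < length Bs \<and> \<psi> (Is ! j) = Some (Bs ! k)) = k'"
        using k' assms(2) by (intro the_equality) (auto simp: nth_eq_iff_index_eq)
      then have "\<phi> j = k'" using True by (simp add: \<phi>_def)
      then show ?thesis using k k' assms(2) by (auto simp: nth_eq_iff_index_eq)
    qed (use k in \<open>auto simp: \<phi>_def\<close>)
    then have "(\<Sum>j | j < length Is \<and> \<phi> j = k. map sz Is ! j) = bs (Bs ! k)" if "k < length Bs" for k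
      using sum[of "\<lambda>x. \<psi> x = Some (Bs ! k)"] \<psi>[of "Bs ! k"] that by simp
    then show "packs (map sz Is) (map bs Bs)" unfolding packs_def by auto
  qed
qed

text \<open>One element stays below \<open>3 * M\<close>, three would already reach
  \<open>6 * M\<close>.\<close>

lemma card_eq_2_if_sum:
  fixes f :: "'a \<Rightarrow> nat"
  assumes "finite S" "\<And>x. x \<in> S \<Longrightarrow> 2 * M \<le> f x \<and> f x < 3 * M" "4 * M \<le> sum f S" "sum f S < 6 * M"
  shows "card S = 2"
proof -
  have "card S * (2 * M) \<le> sum f S" using assms(2) sum_bounded_below[of S "2 * M" f] by simp
  then have "card S * (2 * M) < 3 * (2 * M)" using assms(4) by linarith
  then have "card S < 3" using mult_less_cancel2[of "card S" "2 * M" 3] by blast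
  moreover have "\<not> card S \<le> 1"
  proof
    assume "card S \<le> 1"
    then have "sum f S \<le> 3 * M"
    proof (cases "card S = 0")
      case False
      then have "card S = 1" using \<open>card S \<le> 1\<close> by simp
      then obtain x where x: "S = {x}" by (auto simp: card_1_singleton_iff)
      then show ?thesis using assms(2)[of x] by simp
    qed (use assms(1) in simp)
    moreover have "M > 0" using assms(3,4) by simp
    ultimately show False using assms(3) by simp
  qed
  ultimately show ?thesis by simp
qed

lemma mult_add_less_unique:
  assumes "(Z :: nat) * p + q = Z * p' + q'" "q < Z" "q' < Z"
  shows "p = p'" "q = q'"
proof -
  have "(Z * p + q) div Z = p" "(Z * p' + q') div Z = p'" "(Z * p + q) mod Z = q" "(Z * p' + q') mod Z = q'"
    using assms(2,3) by auto
  then show "p = p'" "q = q'" using assms(1) by auto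
qed


subsection \<open>The reduction\<close>

text \<open>
  For each variable \<open>i\<close> there is a wheel with positions \<open>c < m + 2\<close>, of which those with \<open>c < m\<close> belong
  to the clauses.  The items are triples \<open>(k, i, c)\<close>: hinges (\<open>k = 0\<close>), tokens for the literals
  \<open>i\<close> (\<open>k = 1\<close>) and not \<open>i\<close> (\<open>k = 2\<close>), and connectors (\<open>k = 3, 4\<close>) for the occurrences of these
  literals in clause \<open>c\<close>.  The bin \<open>(0, i, c)\<close> takes the token 1 at \<open>c\<close> and the hinge at \<open>c\<close>, or
  the token 2 at \<open>c\<close> and the hinge at the next position; so either all tokens 1 or all
  tokens 2 of a wheel are used up.  The bin \<open>(1, 0, c)\<close> takes a connector of clause \<open>c\<close>
  together with its token, which has to be left over by the wheel.
\<close>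

definition pos :: "nat \<Rightarrow> nat \<Rightarrow> nat \<Rightarrow> nat" where
  "pos m i c = i * (m + 2) + c"

text \<open>The two positions beyond the clauses give every wheel at least two places, so
  \<open>nxt m c\<close> always differs from \<open>c\<close>.\<close>

definition nxt :: "nat \<Rightarrow> nat \<Rightarrow> nat" where
  "nxt m c = (if Suc c = m + 2 then 0 else Suc c)"

definition wsize :: "nat \<Rightarrow> nat \<Rightarrow> nat" where
  "wsize n m = n * (m + 2)"

text \<open>Exceeds the sum of a position and the low digit of a token, each of which is at most
  \<open>wsize n m\<close>.\<close>

definition radix :: "nat \<Rightarrow> nat \<Rightarrow> nat" where
  "radix n m = 2 * wsize n m + 1"

text \<open>Exceeds every token, as \<open>token_less\<close> shows, so that a token can be the low
  digit of a clause number.\<close>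

definition radix2 :: "nat \<Rightarrow> nat \<Rightarrow> nat" where
  "radix2 n m = wsize n m * radix n m + 1"

text \<open>Exceeds the sum of two identities, each at most \<open>radix2 n m * (m + 1)\<close> by
  \<open>ident_le\<close>.\<close>

definition radix3 :: "nat \<Rightarrow> nat \<Rightarrow> nat" where
  "radix3 n m = 2 * (radix2 n m * (m + 1)) + 1"

text \<open>The high digit is the token's own position. The low digit is the complement, with
  respect to \<open>wsize n m\<close>, of the position of its hinge, so that exactly this hinge
  completes it.\<close>

definition token :: "nat \<Rightarrow> nat \<Rightarrow> nat \<Rightarrow> nat \<Rightarrow> nat \<Rightarrow> nat" where
  "token n m k i c = radix n m * pos m i c + (wsize n m - pos m i (if k = 1 then c else nxt m c))"

text \<open>A connector is the complement of its token with respect to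
  \<open>radix2 n m * Suc c\<close>, the number of its clause. The successor prevents truncation
  when \<open>c\<close> is 0.\<close>

definition ident :: "nat \<Rightarrow> nat \<Rightarrow> nat \<times> nat \<times> nat \<Rightarrow> nat" where
  "ident n m = (\<lambda>(k, i, c). if k = 0 then pos m i c else if k < 3 then token n m k i c
     else radix2 n m * Suc c - token n m (k - 2) i c)"

text \<open>Powers of 3, so that a sum of two determines the kinds: 4 arises only as 1 + 3, and 12
  only as 3 + 9.\<close>

definition kind :: "nat \<Rightarrow> nat" where
  "kind k = (if k = 0 then 1 else if k < 3 then 3 else 9)"

text \<open>The 20 fixes the number of items per bin: with \<open>M\<close> =
  \<open>10 * radix3 n m\<close>, every item is between \<open>2 * M\<close> and
  \<open>3 * M\<close> and every bin between \<open>4 * M\<close> and \<open>6 * M\<close>, as in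
  \<open>card_eq_2_if_sum\<close>.\<close>

definition item_size :: "nat \<Rightarrow> nat \<Rightarrow> nat \<times> nat \<times> nat \<Rightarrow> nat" where
  "item_size n m x = radix3 n m * (20 + kind (fst x)) + ident n m x"

definition bin_ident :: "nat \<Rightarrow> nat \<Rightarrow> nat \<times> nat \<times> nat \<Rightarrow> nat" where
  "bin_ident n m = (\<lambda>(k, i, c). if k = 0 then radix n m * pos m i c + wsize n m else radix2 n m * Suc c)"

definition bin_size :: "nat \<Rightarrow> nat \<Rightarrow> nat \<times> nat \<times> nat \<Rightarrow> nat" where
  "bin_size n m b = radix3 n m * (40 + (if fst b = 0 then 4 else 12)) + bin_ident n m b"

definition cnf_vars :: "'v cnf \<Rightarrow> 'v list" where
  "cnf_vars F = nub (map snd (concat F))"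

text \<open>Indexing is expressed by quantifiers over enumerated lists, for which
  \<open>pt_intros\<close> has rules; \<open>set_cnf_items\<close> restores the readable
  form.\<close>

definition cnf_items :: "'v cnf \<Rightarrow> (nat \<times> nat \<times> nat) list" where
  "cnf_items F = filter (\<lambda>x. fst x < 3 \<or>
      (\<exists>p\<in>set (List.enumerate 0 F). \<exists>q\<in>set (List.enumerate 0 (cnf_vars F)).
         fst p = snd (snd x) \<and> fst q = fst (snd x) \<and> (\<exists>l\<in>set (snd p). l = (fst x = 3, snd q))))
    (List.product [0..<5] (List.product [0..<length (cnf_vars F)] [0..<length F + 2]))"

definition cnf_bins :: "'v cnf \<Rightarrow> (nat \<times> nat \<times> nat) list" where
  "cnf_bins F = map (Pair 0) (List.product [0..<length (cnf_vars F)] [0..<length F + 2]) @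
     map (\<lambda>c. (1, 0, c)) [0..<length F]"

definition item_sizes :: "'v cnf \<Rightarrow> nat list" where
  "item_sizes F = map (item_size (length (cnf_vars F)) (length F)) (cnf_items F)"

definition bin_sizes :: "'v cnf \<Rightarrow> nat list" where
  "bin_sizes F = map (bin_size (length (cnf_vars F)) (length F)) (cnf_bins F)"

lemma distinct_cnf_items: "distinct (cnf_items F)"
  unfolding cnf_items_def by (intro distinct_filter distinct_product distinct_upt)

lemma distinct_cnf_bins: "distinct (cnf_bins F)"
  unfolding cnf_bins_def
  by (auto simp: distinct_map distinct_product inj_on_def)

lemma set_cnf_items:
  "set (cnf_items F) = {(k, i, c). k < 5 \<and> i < length (cnf_vars F) \<and> c < length F + 2 \<and>
     (k < 3 \<or> c < length F \<and> (k = 3, cnf_vars F ! i) \<in> set (F ! c))}"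
proof -
  have "(\<exists>p\<in>set (List.enumerate 0 F). \<exists>q\<in>set (List.enumerate 0 vs).
      fst p = c \<and> fst q = i \<and> (\<exists>l\<in>set (snd p). l = (b, snd q))) \<longleftrightarrow>
    c < length F \<and> i < length vs \<and> (b, vs ! i) \<in> set (F ! c)" (is "?L \<longleftrightarrow> ?R") for vs and c i b
  proof
    assume ?L
    then show ?R by (auto simp: in_set_enumerate_eq)
  next
    assume ?R
    then show ?L
      by (intro bexI[of _ "(c, F ! c)"] bexI[of _ "(i, vs ! i)"]) (auto simp: in_set_enumerate_eq)
  qed
  then show ?thesis unfolding cnf_items_def by auto
qed

lemma set_cnf_bins:
  "set (cnf_bins F) = {(k, i, c). k = 0 \<and> i < length (cnf_vars F) \<and> c < length F + 2 \<or>
     k = 1 \<and> i = 0 \<and> c < length F}"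
  unfolding cnf_bins_def by auto

section \<open>Reading the digits: which items can share a bin\<close>

context
  fixes n m :: nat
begin

lemma pos_less: "i < n \<Longrightarrow> c < m + 2 \<Longrightarrow> pos m i c < wsize n m"
proof -
  assume "i < n" "c < m + 2"
  then have "Suc i * (m + 2) \<le> n * (m + 2)" by (intro mult_le_mono1) simp
  then show ?thesis using \<open>c < m + 2\<close> unfolding pos_def wsize_def by simp
qed

lemma pos_inject: "pos m i c = pos m i' c' \<Longrightarrow> c < m + 2 \<Longrightarrow> c' < m + 2 \<Longrightarrow> i = i' \<and> c = c'"
  unfolding pos_def using mult_add_less_unique[of "m + 2" i c i' c'] by (simp add: mult.commute)

lemma nxt_less: "c < m + 2 \<Longrightarrow> nxt m c < m + 2"
  by (simp add: nxt_def)

lemma nxt_neq: "c < m + 2 \<Longrightarrow> nxt m c \<noteq> c"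
  by (auto simp: nxt_def)

lemma token_less:
  assumes "i < n" "c < m + 2"
  shows "token n m k i c < radix2 n m"
proof -
  have "radix n m * Suc (pos m i c) \<le> radix n m * wsize n m"
    using pos_less[OF assms] by (intro mult_le_mono2) simp
  moreover have "token n m k i c < radix n m * Suc (pos m i c)"
    unfolding token_def by (simp add: radix_def)
  ultimately show ?thesis unfolding radix2_def by (simp add: mult.commute)
qed

lemma token_inject:
  assumes "token n m k i c = token n m k' i' c'" "i < n" "c < m + 2" "i' < n" "c' < m + 2"
    "k \<in> {1, 2}" "k' \<in> {1, 2}"
  shows "i = i' \<and> c = c' \<and> k = k'"
proof -
  let ?c = "if k = 1 then c else nxt m c" and ?c' = "if k' = 1 then c' else nxt m c'"
  have l: "wsize n m - x < radix n m" for x by (simp add: radix_def)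
  note * = mult_add_less_unique[OF assms(1)[unfolded token_def] l l]
  have ic: "i = i'" "c = c'" using pos_inject[OF *(1)] assms by auto
  have lt: "?c < m + 2" "?c' < m + 2" using assms nxt_less by auto
  have "pos m i ?c = pos m i' ?c'"
    using *(2) pos_less[OF assms(2) lt(1)] pos_less[OF assms(4) lt(2)] by linarith
  then have "?c = ?c'" using pos_inject lt by blast
  then show ?thesis using ic nxt_neq[OF assms(3)] nxt_neq[OF assms(3)] assms(6,7) by (auto split: if_splits)
qed

lemma ident_le:
  assumes "i < n" "c < m + 2" "k < 5" "k < 3 \<or> c < m"
  shows "ident n m (k, i, c) \<le> radix2 n m * (m + 1)"
proof -
  have r: "x \<le> radix2 n m * (m + 1)" if "x \<le> radix2 n m" for x
    using that by (simp add: order_trans[OF that])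
  consider "k = 0" | "k = 1 \<or> k = 2" | "k \<ge> 3" by linarith
  then show ?thesis
  proof cases
    case 1
    have "pos m i c \<le> token n m 1 i c"
      unfolding token_def radix_def by simp
    then show ?thesis using 1 token_less[OF assms(1,2), of 1] by (intro r) (simp add: ident_def)
  next
    case 2
    then show ?thesis using token_less[OF assms(1,2), of k] by (intro r) (auto simp: ident_def)
  next
    case 3
    then have "ident n m (k, i, c) \<le> radix2 n m * Suc c" by (simp add: ident_def)
    also have "\<dots> \<le> radix2 n m * (m + 1)" using 3 assms(4) by (intro mult_le_mono2) simp
    finally show ?thesis .
  qed
qed

lemma two_items_in_bin:
  assumes x: "x = (k, i, c)" "i < n" "c < m + 2" "k < 5" "k < 3 \<or> c < m"
    and y: "y = (k', i', c')" "i' < n" "c' < m + 2" "k' < 5" "k' < 3 \<or> c' < m"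
    and b: "bin_ident n m b \<le> radix2 n m * (m + 1)"
    and eq: "item_size n m x + item_size n m y = bin_size n m b"
  shows "kind k + kind k' = (if fst b = 0 then 4 else 12)" "ident n m x + ident n m y = bin_ident n m b"
proof -
  have "radix3 n m * (40 + (kind k + kind k')) + (ident n m x + ident n m y) =
      radix3 n m * (40 + (if fst b = 0 then 4 else 12)) + bin_ident n m b"
    using eq unfolding item_size_def bin_size_def x(1) y(1) fst_conv by (simp add: algebra_simps)
  moreover have "ident n m x + ident n m y < radix3 n m"
    using ident_le[OF x(2-5)] ident_le[OF y(2-5)] unfolding x(1) y(1) radix3_def by simp
  moreover have "bin_ident n m b < radix3 n m" using b unfolding radix3_def by simp
  ultimately have "40 + (kind k + kind k') = 40 + (if fst b = 0 then 4 else 12)"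
      "ident n m x + ident n m y = bin_ident n m b"
    by (rule mult_add_less_unique)+
  then show "kind k + kind k' = (if fst b = 0 then 4 else 12)" "ident n m x + ident n m y = bin_ident n m b"
    by simp_all
qed

text \<open>Only the token contributes a high digit, which has to be that of the bin. The low digits
  must then add up to \<open>wsize n m\<close>, which identifies the hinge.\<close>

lemma wheel_bin_items:
  assumes "i < n" "c < m + 2" "i' < n" "c' < m + 2" "i0 < n" "c0 < m + 2" "k \<in> {1, 2}"
    and "pos m i c + token n m k i' c' = radix n m * pos m i0 c0 + wsize n m"
  shows "i' = i0 \<and> c' = c0 \<and> i = i0 \<and> c = (if k = 1 then c0 else nxt m c0)"
proof -
  let ?d = "if k = 1 then c' else nxt m c'"
  have d: "?d < m + 2" using assms nxt_less by auto
  have "radix n m * pos m i' c' + (pos m i c + (wsize n m - pos m i' ?d)) = radix n m * pos m i0 c0 + wsize n m"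
    using assms(8) by (simp add: token_def)
  moreover have "pos m i c + (wsize n m - pos m i' ?d) < radix n m"
    using pos_less[OF assms(1,2)] by (simp add: radix_def)
  moreover have "wsize n m < radix n m" by (simp add: radix_def)
  ultimately have *: "pos m i' c' = pos m i0 c0" "pos m i c + (wsize n m - pos m i' ?d) = wsize n m"
    by (rule mult_add_less_unique)+
  then have "pos m i c = pos m i' ?d" using pos_less[OF assms(3) d] by linarith
  then have "i = i' \<and> c = ?d" by (rule pos_inject[OF _ assms(2) d])
  moreover have "i' = i0 \<and> c' = c0" by (rule pos_inject[OF *(1) assms(4,6)])
  ultimately show ?thesis by simp
qed

text \<open>With the subtracted token moved across, both sides are numerals in
  \<open>radix2 n m\<close> whose low digits are tokens; they agree, so the token in the bin is the
  connector's own.\<close>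

lemma clause_bin_items:
  assumes "i < n" "c < m" "i' < n" "c' < m + 2" "k \<in> {1, 2}" "k' \<in> {1, 2}"
    and "radix2 n m * Suc c - token n m k i c + token n m k' i' c' = radix2 n m * Suc c0"
  shows "c = c0 \<and> i' = i \<and> c' = c0 \<and> k' = k"
proof -
  have t: "token n m k i c < radix2 n m" "token n m k' i' c' < radix2 n m"
    using assms by (auto intro: token_less)
  have "token n m k i c \<le> radix2 n m * Suc c" using t(1) by simp
  then have "radix2 n m * Suc c + token n m k' i' c' = radix2 n m * Suc c0 + token n m k i c"
    using assms(7) by linarith
  from mult_add_less_unique[OF this t(2,1)] have "c = c0" "token n m k' i' c' = token n m k i c" by auto
  then show ?thesis using token_inject[of k' i' c' k i c] assms by auto
qed

end

lemma item_size_bounds: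
  assumes "x \<in> set (cnf_items F)"
  defines "M \<equiv> 10 * radix3 (length (cnf_vars F)) (length F)"
  shows "2 * M \<le> item_size (length (cnf_vars F)) (length F) x"
    "item_size (length (cnf_vars F)) (length F) x < 3 * M"
proof -
  obtain k i c where x: "x = (k, i, c)" by (cases x)
  let ?n = "length (cnf_vars F)" and ?m = "length F"
  have "ident ?n ?m (k, i, c) < radix3 ?n ?m"
    using ident_le[of i ?n c ?m k] assms(1) unfolding set_cnf_items x radix3_def by auto
  moreover have "radix3 ?n ?m * kind k \<le> radix3 ?n ?m * 9" by (intro mult_le_mono2) (simp add: kind_def)
  ultimately show "2 * M \<le> item_size ?n ?m x" "item_size ?n ?m x < 3 * M"
    unfolding M_def item_size_def x fst_conv add_mult_distrib2 by linarith+
qed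

lemma bin_ident_le:
  assumes "b \<in> set (cnf_bins F)"
  shows "bin_ident (length (cnf_vars F)) (length F) b \<le> radix2 (length (cnf_vars F)) (length F) * (length F + 1)"
proof -
  obtain k i c where b: "b = (k, i, c)" by (cases b)
  let ?n = "length (cnf_vars F)" and ?m = "length F"
  show ?thesis
  proof (cases "k = 0")
    case True
    then have ic: "i < ?n" "c < ?m + 2" using assms by (auto simp: set_cnf_bins b)
    have "radix ?n ?m * Suc (pos ?m i c) \<le> radix ?n ?m * wsize ?n ?m"
      using pos_less[OF ic] by (intro mult_le_mono2) simp
    then have "bin_ident ?n ?m b \<le> radix2 ?n ?m" using True
      by (simp add: b bin_ident_def radix2_def radix_def algebra_simps)
    then show ?thesis by (rule order_trans) simp
  next
    case False
    then have "c < ?m" using assms by (auto simp: set_cnf_bins b)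
    then show ?thesis using False unfolding b bin_ident_def
      by (simp only: prod.case if_False) (intro mult_le_mono2, simp)
  qed
qed

definition fits :: "'v cnf \<Rightarrow> nat \<times> nat \<times> nat \<Rightarrow> nat \<times> nat \<times> nat \<Rightarrow> nat \<times> nat \<times> nat \<Rightarrow> bool" where
  "fits F b x y \<longleftrightarrow>
     (\<exists>i c. b = (0, i, c) \<and> (x = (0, i, c) \<and> y = (1, i, c) \<or> x = (0, i, nxt (length F) c) \<and> y = (2, i, c))) \<or>
     (\<exists>i c. b = (1, 0, c) \<and> (x = (3, i, c) \<and> y = (1, i, c) \<or> x = (4, i, c) \<and> y = (2, i, c)))"

lemma size_of_fitting:
  assumes "fits F b x y" "x \<in> set (cnf_items F)" "y \<in> set (cnf_items F)"
  shows "item_size (length (cnf_vars F)) (length F) x + item_size (length (cnf_vars F)) (length F) y =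
    bin_size (length (cnf_vars F)) (length F) b"
proof -
  let ?n = "length (cnf_vars F)" and ?m = "length F"
  have le: "pos ?m i c \<le> wsize ?n ?m" if "i < ?n" "c < ?m + 2" for i c
    using pos_less[OF that] by simp
  have tok: "token ?n ?m k i c \<le> radix2 ?n ?m * Suc c" if "i < ?n" "c < ?m + 2" for k i c
    using token_less[OF that, of k] by simp
  consider i c where "b = (0, i, c)" "x = (0, i, c)" "y = (1, i, c)"
    | i c where "b = (0, i, c)" "x = (0, i, nxt ?m c)" "y = (2, i, c)"
    | i c where "b = (1, 0, c)" "x = (3, i, c)" "y = (1, i, c)"
    | i c where "b = (1, 0, c)" "x = (4, i, c)" "y = (2, i, c)"
    using assms(1) unfolding fits_def by blast
  then show ?thesis
  proof cases
    case (1 i c)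
    then show ?thesis using assms(2,3) le[of i c]
      by (simp add: set_cnf_items item_size_def bin_size_def ident_def bin_ident_def kind_def token_def algebra_simps)
  next
    case (2 i c)
    then show ?thesis using assms(2,3) le[of i "nxt ?m c"]
      by (simp add: set_cnf_items item_size_def bin_size_def ident_def bin_ident_def kind_def token_def algebra_simps)
  next
    case (3 i c)
    then show ?thesis using assms(2,3) tok[of i c 1]
      by (simp add: set_cnf_items item_size_def bin_size_def ident_def bin_ident_def kind_def algebra_simps)
  next
    case (4 i c)
    then show ?thesis using assms(2,3) tok[of i c 2]
      by (simp add: set_cnf_items item_size_def bin_size_def ident_def bin_ident_def kind_def algebra_simps)
  qed
qed

lemma fitting_if_size:
  assumes x: "x \<in> set (cnf_items F)" and y: "y \<in> set (cnf_items F)" and b: "b \<in> set (cnf_bins F)"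
    and eq: "item_size (length (cnf_vars F)) (length F) x + item_size (length (cnf_vars F)) (length F) y =
      bin_size (length (cnf_vars F)) (length F) b"
  shows "fits F b x y \<or> fits F b y x"
proof -
  let ?n = "length (cnf_vars F)" and ?m = "length F"
  have main: "fits F b x y" if x: "x \<in> set (cnf_items F)" and y: "y \<in> set (cnf_items F)"
    and sum: "ident ?n ?m x + ident ?n ?m y = bin_ident ?n ?m b"
    and kinds: "fst b = 0 \<and> fst x = 0 \<and> fst y \<in> {1, 2} \<or> fst b \<noteq> 0 \<and> fst x \<in> {3, 4} \<and> fst y \<in> {1, 2}" for x y
  proof -
    obtain k i c where x': "x = (k, i, c)" by (cases x)
    obtain k' i' c' where y': "y = (k', i', c')" by (cases y)
    obtain kb ib cb where b': "b = (kb, ib, cb)" by (cases b)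
    have xb: "i < ?n" "c < ?m + 2" "k < 3 \<or> c < ?m" using x by (auto simp: set_cnf_items x')
    have yb: "i' < ?n" "c' < ?m + 2" using y by (auto simp: set_cnf_items y')
    show ?thesis
    proof (cases "kb = 0")
      case True
      then have bb: "ib < ?n" "cb < ?m + 2" using b by (auto simp: set_cnf_bins b')
      have k: "k = 0" "k' \<in> {1, 2}" using kinds True by (auto simp: x' y' b')
      have "pos ?m i c + token ?n ?m k' i' c' = radix ?n ?m * pos ?m ib cb + wsize ?n ?m"
        using sum k True by (auto simp: x' y' b' ident_def bin_ident_def)
      from wheel_bin_items[OF xb(1,2) yb bb k(2) this] show ?thesis
        using k True by (auto simp: fits_def x' y' b')
    next
      case False
      then have bb: "kb = 1" "ib = 0" using b by (auto simp: set_cnf_bins b')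
      have k: "k \<in> {3, 4}" "k' \<in> {1, 2}" using kinds False by (auto simp: x' y' b')
      have k2: "k - 2 \<in> {1, 2}" using k by auto
      have "radix2 ?n ?m * Suc c - token ?n ?m (k - 2) i c + token ?n ?m k' i' c' = radix2 ?n ?m * Suc cb"
        using sum k False by (auto simp: x' y' b' ident_def bin_ident_def)
      moreover have "c < ?m" using xb(3) k by auto
      ultimately have "c = cb \<and> i' = i \<and> c' = cb \<and> k' = k - 2"
        using clause_bin_items[OF xb(1) _ yb k2 k(2)] by blast
      then show ?thesis using k bb by (auto simp: fits_def x' y' b')
    qed
  qed
  obtain k i c where x': "x = (k, i, c)" by (cases x)
  obtain k' i' c' where y': "y = (k', i', c')" by (cases y)
  have xb: "i < ?n" "c < ?m + 2" "k < 5" "k < 3 \<or> c < ?m" using x by (auto simp: set_cnf_items x')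
  have yb: "i' < ?n" "c' < ?m + 2" "k' < 5" "k' < 3 \<or> c' < ?m" using y by (auto simp: set_cnf_items y')
  note * = two_items_in_bin[OF x' xb y' yb bin_ident_le[OF b] eq]
  have k: "k \<in> {0, 1, 2, 3, 4}" "k' \<in> {0, 1, 2, 3, 4}" using xb yb by auto
  then have "(fst b = 0 \<and> k = 0 \<and> k' \<in> {1, 2} \<or> fst b \<noteq> 0 \<and> k \<in> {3, 4} \<and> k' \<in> {1, 2}) \<or>
      (fst b = 0 \<and> k' = 0 \<and> k \<in> {1, 2} \<or> fst b \<noteq> 0 \<and> k' \<in> {3, 4} \<and> k \<in> {1, 2})"
    using *(1) unfolding kind_def by (cases "fst b = 0") auto
  then show ?thesis using main[OF x y *(2)] main[OF y x] *(2) by (auto simp: x' y' add.commute)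
qed

text \<open>Arithmetic ends here: what remains is a matching problem on labels.\<close>

lemma packs_iff_fitting:
  "packs (item_sizes F) (bin_sizes F) \<longleftrightarrow>
    (\<exists>\<psi>. \<forall>b\<in>set (cnf_bins F). \<exists>x y. fits F b x y \<and> {z \<in> set (cnf_items F). \<psi> z = Some b} = {x, y})"
proof -
  let ?n = "length (cnf_vars F)" and ?m = "length F"
  let ?sz = "item_size ?n ?m" and ?bs = "bin_size ?n ?m"
  have "(\<Sum>z | z \<in> set (cnf_items F) \<and> \<psi> z = Some b. ?sz z) = ?bs b \<longleftrightarrow>
      (\<exists>x y. fits F b x y \<and> {z \<in> set (cnf_items F). \<psi> z = Some b} = {x, y})"
    if b: "b \<in> set (cnf_bins F)" for \<psi> b
  proof
    let ?S = "{z \<in> set (cnf_items F). \<psi> z = Some b}"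
    assume sum: "(\<Sum>z | z \<in> set (cnf_items F) \<and> \<psi> z = Some b. ?sz z) = ?bs b"
    let ?M = "10 * radix3 ?n ?m"
    have bb: "bin_ident ?n ?m b < radix3 ?n ?m"
      using bin_ident_le[OF b] unfolding radix3_def by simp
    have "card ?S = 2"
    proof (rule card_eq_2_if_sum[where M = ?M and f = ?sz])
      show "4 * ?M \<le> sum ?sz ?S" "sum ?sz ?S < 6 * ?M"
        unfolding sum using bb by (simp_all add: bin_size_def algebra_simps)
    qed (use item_size_bounds in auto)
    then obtain x y where xy: "?S = {x, y}" "x \<noteq> y" by (auto simp: card_2_iff)
    then have mem: "x \<in> set (cnf_items F)" "y \<in> set (cnf_items F)" by auto
    have "?sz x + ?sz y = ?bs b" using sum unfolding xy(1) using xy(2) by simp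
    from fitting_if_size[OF mem b this] show "\<exists>x y. fits F b x y \<and> ?S = {x, y}"
      using xy(1) by (metis insert_commute)
  next
    assume "\<exists>x y. fits F b x y \<and> {z \<in> set (cnf_items F). \<psi> z = Some b} = {x, y}"
    then obtain x y where xy: "fits F b x y" "{z \<in> set (cnf_items F). \<psi> z = Some b} = {x, y}" by blast
    then have mem: "x \<in> set (cnf_items F)" "y \<in> set (cnf_items F)" by auto
    have "x \<noteq> y" using xy(1) by (auto simp: fits_def)
    then show "(\<Sum>z | z \<in> set (cnf_items F) \<and> \<psi> z = Some b. ?sz z) = ?bs b"
      unfolding xy(2) using size_of_fitting[OF xy(1) mem] by simp
  qed
  then show ?thesis
    unfolding item_sizes_def bin_sizes_def packs_iff_assignment[OF distinct_cnf_items distinct_cnf_bins]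
    by (intro iff_exI ball_cong refl)
qed

section \<open>Packings and satisfying assignments\<close>

lemma sat_if_packs:
  assumes "packs (item_sizes F) (bin_sizes F)"
  shows "sat F"
proof -
  let ?n = "length (cnf_vars F)" and ?m = "length F"
  obtain \<psi> where \<psi>: "\<And>b. b \<in> set (cnf_bins F) \<Longrightarrow>
      \<exists>x y. fits F b x y \<and> {z \<in> set (cnf_items F). \<psi> z = Some b} = {x, y}"
    using assms unfolding packs_iff_fitting by blast
  have wheel: "\<psi> (0, i, c) = Some (0, i, c) \<and> \<psi> (1, i, c) = Some (0, i, c) \<or>
      \<psi> (0, i, nxt ?m c) = Some (0, i, c) \<and> \<psi> (2, i, c) = Some (0, i, c)" if "i < ?n" "c < ?m + 2" for i c
  proof -
    have "(0, i, c) \<in> set (cnf_bins F)" using that by (simp add: set_cnf_bins)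
    from \<psi>[OF this] obtain x y where xy: "fits F (0, i, c) x y"
        "{z \<in> set (cnf_items F). \<psi> z = Some (0, i, c)} = {x, y}" by blast
    then have "\<psi> x = Some (0, i, c)" "\<psi> y = Some (0, i, c)" by auto
    then show ?thesis using xy(1) by (auto simp: fits_def)
  qed
  \<comment> \<open>The wheel spends its tokens for the negated literal and leaves those for the
    positive one, so the variable is going to be true.\<close>
  define neg where "neg i c \<longleftrightarrow> \<psi> (0, i, nxt ?m c) = Some (0, i, c) \<and> \<psi> (2, i, c) = Some (0, i, c)" for i c
  \<comment> \<open>Bin \<open>c\<close> holds the hinge at \<open>nxt m c\<close>; the bin at that
    position therefore lacks its own hinge and has to take the following one.\<close>
  have step: "neg i (nxt ?m c)" if "neg i c" "i < ?n" "c < ?m + 2" for i c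
    using that wheel[OF that(2) nxt_less[OF that(3)]] nxt_neq[OF that(3)] by (auto simp: neg_def)
  have up: "neg i d" if "neg i c" "i < ?n" "c \<le> d" "d < ?m + 2" for i c d
    using that(3,4)
  proof (induction rule: dec_induct)
    case (step d)
    then have "neg i d" by simp
    from \<open>\<And>c i. neg i c \<Longrightarrow> i < ?n \<Longrightarrow> c < ?m + 2 \<Longrightarrow> neg i (nxt ?m c)\<close>[OF this that(2)] step
    show ?case by (simp add: nxt_def split: if_splits)
  qed (rule that(1))
  \<comment> \<open>Once round the wheel: up to the last position, across to 0, and up
    again.\<close>
  have all: "neg i d" if "neg i c" "i < ?n" "c < ?m + 2" "d < ?m + 2" for i c d
  proof -
    have "neg i (?m + 1)" using up[OF that(1,2), of "?m + 1"] that by simp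
    from step[OF this that(2)] have "neg i 0" by (simp add: nxt_def)
    then show ?thesis using up that by blast
  qed
  have dist: "distinct (cnf_vars F)" unfolding cnf_vars_def by (rule distinct_nub)
  define \<sigma> where "\<sigma> v \<longleftrightarrow> (\<exists>i<?n. cnf_vars F ! i = v \<and> neg i 0)" for v
  have \<sigma>: "\<sigma> (cnf_vars F ! i) \<longleftrightarrow> neg i 0" if "i < ?n" for i
    using that dist by (auto simp: \<sigma>_def nth_eq_iff_index_eq)
  have "\<exists>(b, v)\<in>set (F ! c). \<sigma> v = b" if c: "c < ?m" for c
  proof -
    have "(1, 0, c) \<in> set (cnf_bins F)" using c by (simp add: set_cnf_bins)
    from \<psi>[OF this] obtain x y where xy: "fits F (1, 0, c) x y"
        "{z \<in> set (cnf_items F). \<psi> z = Some (1, 0, c)} = {x, y}" by blast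
    then have ps: "\<psi> x = Some (1, 0, c)" "\<psi> y = Some (1, 0, c)" and x: "x \<in> set (cnf_items F)" by auto
    from xy(1) obtain i where "x = (3, i, c) \<and> y = (1, i, c) \<or> x = (4, i, c) \<and> y = (2, i, c)"
      by (auto simp: fits_def)
    then show ?thesis
    proof
      assume xy: "x = (3, i, c) \<and> y = (1, i, c)"
      then have i: "i < ?n" "(True, cnf_vars F ! i) \<in> set (F ! c)" using x by (auto simp: set_cnf_items)
      \<comment> \<open>Token 1 at \<open>c\<close> lies in the clause bin, so the wheel bin at
        \<open>c\<close> was filled with token 2.\<close>
      have "neg i c" using wheel[OF i(1), of c] ps xy c by (auto simp: neg_def)
      then have "neg i 0" using all i(1) c by simp
      then show ?thesis using i \<sigma>[OF i(1)] by (intro bexI[OF _ i(2)]) simp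
    next
      assume xy: "x = (4, i, c) \<and> y = (2, i, c)"
      then have i: "i < ?n" "(False, cnf_vars F ! i) \<in> set (F ! c)" using x by (auto simp: set_cnf_items)
      have "\<not> neg i c" using ps xy by (auto simp: neg_def)
      then have "\<not> neg i 0" using all[of i 0 c] i(1) c by auto
      then show ?thesis using i \<sigma>[OF i(1)] by (intro bexI[OF _ i(2)]) simp
    qed
  qed
  then have "\<forall>C\<in>set F. \<exists>(b, v)\<in>set C. \<sigma> v = b" by (auto simp: in_set_conv_nth)
  then show ?thesis unfolding sat_def by blast
qed

lemma packs_if_sat:
  assumes "sat F"
  shows "packs (item_sizes F) (bin_sizes F)"
proof -
  let ?n = "length (cnf_vars F)" and ?m = "length F"
  let ?v = "\<lambda>i. cnf_vars F ! i"
  obtain \<sigma> where \<sigma>: "\<forall>C\<in>set F. \<exists>(b, v)\<in>set C. \<sigma> v = b" using assms unfolding sat_def by blast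
  have "\<exists>i. i < ?n \<and> (\<sigma> (?v i), ?v i) \<in> set (F ! c)" if c: "c < ?m" for c
  proof -
    obtain v where v: "(\<sigma> v, v) \<in> set (F ! c)" using \<sigma> nth_mem[OF c] by fastforce
    then have "v \<in> set (cnf_vars F)" using nth_mem[OF c] by (force simp: cnf_vars_def)
    then show ?thesis using v by (auto simp: in_set_conv_nth)
  qed
  then obtain pick where pick: "\<And>c. c < ?m \<Longrightarrow> pick c < ?n \<and> (\<sigma> (?v (pick c)), ?v (pick c)) \<in> set (F ! c)"
    by metis
  \<comment> \<open>Inverse of \<open>nxt\<close>: in the wheel of a true variable the hinge at
    \<open>d\<close> goes to the bin at \<open>prv d\<close>.\<close>
  define prv where "prv c = (if c = 0 then ?m + 1 else c - 1)" for c :: nat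
  have prv: "prv d = c \<longleftrightarrow> d = nxt ?m c" if "c < ?m + 2" "d < ?m + 2" for c d
    using that by (auto simp: prv_def nxt_def split: if_splits)
  define wheel clause where "wheel i c = Some (0 :: nat, i :: nat, c :: nat)"
    and "clause i c = (if c < ?m \<and> pick c = i then Some (1 :: nat, 0 :: nat, c :: nat) else None)" for i c
  \<comment> \<open>A true variable spends tokens 2 on its wheel, a false one tokens 1. The other
    tokens, and the connectors of the true literal, go to the clauses that have picked the variable;
    everything else is garbage.\<close>
  define \<psi> where "\<psi> = (\<lambda>(k :: nat, i, c).
    if k = 0 then wheel i (if \<sigma> (?v i) then prv c else c)
    else if k = 1 then (if \<sigma> (?v i) then clause i c else wheel i c)
    else if k = 2 then (if \<sigma> (?v i) then wheel i c else clause i c)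
    else if k = 3 \<longleftrightarrow> \<sigma> (?v i) then clause i c else None)"
  have "\<exists>x y. fits F b x y \<and> {z \<in> set (cnf_items F). \<psi> z = Some b} = {x, y}" if b: "b \<in> set (cnf_bins F)" for b
  proof -
    obtain kb i c where b': "b = (kb, i, c)" by (cases b)
    show ?thesis
    proof (cases "kb = 0")
      case True
      then have ic: "i < ?n" "c < ?m + 2" using b by (auto simp: set_cnf_bins b')
      define y where "y = (if \<sigma> (?v i) then (2 :: nat, i, c) else (1, i, c))"
      define x where "x = (0 :: nat, i, if \<sigma> (?v i) then nxt ?m c else c)"
      have "fits F b x y" using True by (simp add: fits_def b' x_def y_def)
      moreover have "z \<in> set (cnf_items F) \<and> \<psi> z = Some b \<longleftrightarrow> z = x \<or> z = y" for z
      proof -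
        obtain k j d where z: "z = (k, j, d)" by (cases z)
        show ?thesis
          using ic nxt_less[OF ic(2)] prv[OF ic(2), of d] True
          by (auto simp: z set_cnf_items \<psi>_def wheel_def clause_def x_def y_def b' split: if_splits)
      qed
      ultimately show ?thesis by (intro exI[of _ x] exI[of _ y]) auto
    next
      case False
      then have c: "kb = 1" "i = 0" "c < ?m" using b by (auto simp: set_cnf_bins b')
      let ?i = "pick c"
      define y where "y = (if \<sigma> (?v ?i) then (1 :: nat, ?i, c) else (2, ?i, c))"
      define x where "x = (if \<sigma> (?v ?i) then (3 :: nat, ?i, c) else (4, ?i, c))"
      have "fits F b x y" using c by (simp add: fits_def b' x_def y_def)
      moreover have "z \<in> set (cnf_items F) \<and> \<psi> z = Some b \<longleftrightarrow> z = x \<or> z = y" for z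
      proof -
        obtain k j d where z: "z = (k, j, d)" by (cases z)
        show ?thesis
          using pick[OF c(3)] c
          by (auto simp: z set_cnf_items \<psi>_def wheel_def clause_def x_def y_def b' split: if_splits)
      qed
      ultimately show ?thesis by (intro exI[of _ x] exI[of _ y]) auto
    qed
  qed
  then show ?thesis unfolding packs_iff_fitting by blast
qed

lemma item_sizes_pos: "a \<in> set (item_sizes F) \<Longrightarrow> a > 0"
  by (auto simp: item_sizes_def item_size_def radix3_def)

definition cnf_instance :: "'v cnf \<Rightarrow> (nat \<times> (nat \<times> nat) list) list" where
  "cnf_instance F = packing_instance (item_sizes F) (bin_sizes F)"

lemma schedulable_cnf_instance: "schedulable (task_set_of (cnf_instance F)) \<longleftrightarrow> sat F"
proof -
  have "schedulable (task_set_of (cnf_instance F)) \<longleftrightarrow> packs (item_sizes F) (bin_sizes F)"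
    unfolding cnf_instance_def by (rule schedulable_packing_instance) (rule item_sizes_pos)
  also have "\<dots> \<longleftrightarrow> sat F" using sat_if_packs packs_if_sat by blast
  finally show ?thesis .
qed

lemma small_cnf_instance: "small_instance (task_set_of (cnf_instance F))"
  unfolding cnf_instance_def packing_instance_def by (rule small_packing_tasks)

section \<open>The task set of a formula in polynomial time\<close>

lemma pt_product [pt_intros]:
  assumes "pt xs" "pt ys"
  shows "pt (\<lambda>x. List.product (xs x) (ys x))"
  unfolding product_concat_map by (intro pt_intros assms pt_comp[OF assms(2)])

lemma pt_cnf_vars [pt_intros]: "pt F \<Longrightarrow> pt (\<lambda>x. cnf_vars (F x))"
  unfolding cnf_vars_def by (intro pt_intros)

lemma pt_cnf_items: "pt cnf_items"
  unfolding cnf_items_def[abs_def] by (intro pt_intros)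

lemma pt_cnf_bins: "pt cnf_bins"
  unfolding cnf_bins_def[abs_def] by (intro pt_intros)

lemma pt_radix:
  assumes "pt n" "pt m"
  shows "pt (\<lambda>x. wsize (n x) (m x))" "pt (\<lambda>x. radix (n x) (m x))" "pt (\<lambda>x. radix2 (n x) (m x))"
    "pt (\<lambda>x. radix3 (n x) (m x))"
  unfolding radix3_def radix2_def radix_def wsize_def by (intro pt_intros assms)+

lemma pt_item_size: "pt (\<lambda>z. item_size (fst (fst z)) (snd (fst z)) (snd z))"
  unfolding item_size_def ident_def kind_def token_def pos_def nxt_def by (intro pt_intros pt_radix)

lemma pt_bin_size: "pt (\<lambda>z. bin_size (fst (fst z)) (snd (fst z)) (snd z))"
  unfolding bin_size_def bin_ident_def pos_def by (intro pt_intros pt_radix)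

lemma pt_cnf_instance: "pt cnf_instance"
proof -
  have "pt (\<lambda>F. map (item_size (length (cnf_vars F)) (length F)) (cnf_items F))"
    using pt_comp[OF pt_item_size, of "\<lambda>z. ((length (cnf_vars (fst z)), length (fst z)), snd z)"]
    by (intro pt_map pt_cnf_items) (simp add: pt_intros)
  moreover have "pt (\<lambda>F. map (bin_size (length (cnf_vars F)) (length F)) (cnf_bins F))"
    using pt_comp[OF pt_bin_size, of "\<lambda>z. ((length (cnf_vars (fst z)), length (fst z)), snd z)"]
    by (intro pt_map pt_cnf_bins) (simp add: pt_intros)
  ultimately show ?thesis
    unfolding cnf_instance_def[abs_def] item_sizes_def bin_sizes_def by (rule pt_packing_instance)
qed


section \<open>From Turing machines to satisfiability\<close>

definition sat_clause :: "('v \<Rightarrow> bool) \<Rightarrow> (bool \<times> 'v) list \<Rightarrow> bool" where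
  "sat_clause \<sigma> C \<longleftrightarrow> (\<exists>(b, v)\<in>set C. \<sigma> v = b)"

definition model :: "('v \<Rightarrow> bool) \<Rightarrow> 'v cnf \<Rightarrow> bool" where
  "model \<sigma> F \<longleftrightarrow> (\<forall>C\<in>set F. sat_clause \<sigma> C)"

lemma sat_clause_simps [simp]:
  "\<not> sat_clause \<sigma> []"
  "sat_clause \<sigma> ((b, v) # C) \<longleftrightarrow> \<sigma> v = b \<or> sat_clause \<sigma> C"
  by (auto simp: sat_clause_def)

lemma sat_clause_map: "sat_clause \<sigma> (map f xs) \<longleftrightarrow> (\<exists>x\<in>set xs. \<sigma> (snd (f x)) = fst (f x))"
  by (auto simp: sat_clause_def case_prod_beta)

lemma model_append [simp]: "model \<sigma> (F @ G) \<longleftrightarrow> model \<sigma> F \<and> model \<sigma> G"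
  by (auto simp: model_def)

lemma model_map: "model \<sigma> (map f xs) \<longleftrightarrow> (\<forall>x\<in>set xs. sat_clause \<sigma> (f x))"
  by (simp add: model_def)

lemma model_concat_map: "model \<sigma> (concat (map f xs)) \<longleftrightarrow> (\<forall>x\<in>set xs. model \<sigma> (f x))"
  by (auto simp: model_def)

lemma sat_iff_model: "sat F \<longleftrightarrow> (\<exists>\<sigma>. model \<sigma> F)"
  by (simp add: sat_def model_def sat_clause_def)

text \<open>
  The propositional variables: at time \<open>t\<close>, the state is \<open>q\<close>; the head of tape \<open>j\<close> is at \<open>i\<close>; cell \<open>i\<close>
  of tape \<open>j\<close> contains \<open>a\<close>; the head of tape \<open>j\<close> reads \<open>a\<close>.  Cell \<open>i\<close> in a formula for \<open>T\<close> steps is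
  the cell \<open>i - T\<close> of the machine.
\<close>

definition Vq :: "nat \<Rightarrow> nat \<Rightarrow> nat list" where "Vq t q = [0, t, q]"
definition Vh :: "nat \<Rightarrow> nat \<Rightarrow> nat \<Rightarrow> nat list" where "Vh t j i = [1, t, j, i]"
definition Vs :: "nat \<Rightarrow> nat \<Rightarrow> nat \<Rightarrow> nat \<Rightarrow> nat list" where "Vs t j i a = [2, t, j, i, a]"
definition Va :: "nat \<Rightarrow> nat \<Rightarrow> nat \<Rightarrow> nat list" where "Va t j a = [3, t, j, a]"

text \<open>Halting becomes a step that changes nothing, so every run can be followed for exactly
  \<open>T\<close> steps.\<close>

definition delta :: "tm \<Rightarrow> nat \<Rightarrow> nat list \<Rightarrow> nat \<times> (nat \<times> move) list" where
  "delta M q as = (if q = states M then (q, map (\<lambda>a. (a, Move_Stay)) as) else trans M q as)"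

text \<open>Shifted by 1 to stay within \<open>nat\<close>: the head goes from \<open>i\<close> to
  \<open>i + move_code m - 1\<close>.\<close>

fun move_code :: "move \<Rightarrow> nat" where
  "move_code Move_Left = 0"
| "move_code Move_Stay = 1"
| "move_code Move_Right = 2"

text \<open>The transition function is not a datum that \<open>pt\<close> can handle. Tabulated over
  its finitely many relevant arguments, it becomes a constant of the reduction.\<close>

definition row :: "tm \<Rightarrow> nat \<times> nat list \<Rightarrow> (nat \<times> (nat \<times> nat) list) \<times> nat \<times> (nat \<times> nat \<times> nat) list" where
  "row M = (\<lambda>(q, as). ((q, List.enumerate 0 as), fst (delta M q as),
     map (\<lambda>(j, b, m). (j, b, move_code m)) (List.enumerate 0 (snd (delta M q as)))))"

definition rows :: "tm \<Rightarrow> ((nat \<times> (nat \<times> nat) list) \<times> nat \<times> (nat \<times> nat \<times> nat) list) list" where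
  "rows M = map (row M) (List.product [0..<Suc (states M)] (List.n_lists (tapes M) [0..<symbols M]))"

text \<open>\<open>opts\<close> gives the symbols allowed in the cells from the initial head
  position on; the unknown part begins at offset \<open>lo\<close>. The final implications let a
  blank there be followed by blanks only, so that a word of unspecified length is guessed.\<close>

definition start_clauses :: "nat \<Rightarrow> nat \<Rightarrow> nat list list \<Rightarrow> nat \<Rightarrow> nat list cnf" where
  "start_clauses k T opts lo =
     [[(True, Vq 0 0)]] @
     map (\<lambda>j. [(True, Vh 0 j T)]) [0..<k] @
     concat (map (\<lambda>j. map (\<lambda>i. [(True, Vs 0 (Suc j) i 0)]) [0..<Suc (2 * T)]) [0..<k - 1]) @
     map (\<lambda>i. [(True, Vs 0 0 i 0)]) [0..<T] @
     map (\<lambda>p. map (\<lambda>a. (True, Vs 0 0 (T + fst p) a)) (snd p)) (List.enumerate 0 opts) @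
     map (\<lambda>l. [(False, Vs 0 0 (T + (lo + l)) 0), (True, Vs 0 0 (T + Suc (lo + l)) 0)]) [0..<T - lo]"

definition read_clauses :: "nat \<Rightarrow> nat \<Rightarrow> nat \<Rightarrow> nat list cnf" where
  "read_clauses k G T = concat (map (\<lambda>t. concat (map (\<lambda>j. concat (map (\<lambda>i. map (\<lambda>a.
     [(False, Vh t j i), (False, Vs t j i a), (True, Va t j a)])
     [0..<G]) [0..<Suc (2 * T)])) [0..<k])) [0..<Suc T])"

definition body :: "nat \<Rightarrow> nat \<times> (nat \<times> nat) list \<Rightarrow> (bool \<times> nat list) list" where
  "body t r = (False, Vq t (fst r)) # map (\<lambda>p. (False, Va t (fst p) (snd p))) (snd r)"

definition trans_clauses :: "((nat \<times> (nat \<times> nat) list) \<times> nat \<times> (nat \<times> nat \<times> nat) list) list \<Rightarrow> nat \<Rightarrow> nat list cnf" where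
  "trans_clauses rs T = concat (map (\<lambda>t. concat (map (\<lambda>r.
     ((True, Vq (Suc t) (fst (snd r))) # body t (fst r)) #
     concat (map (\<lambda>i. concat (map (\<lambda>u.
       [(True, Vs (Suc t) (fst u) i (fst (snd u))) # (False, Vh t (fst u) i) # body t (fst r),
        (True, Vh (Suc t) (fst u) (i + snd (snd u) - 1)) # (False, Vh t (fst u) i) # body t (fst r)])
       (snd (snd r)))) [0..<Suc (2 * T)])) rs)) [0..<T])"

text \<open>That the head is not at \<open>i\<close> is expressed by its being at another
  \<open>i'\<close>. The proposition for \<open>i\<close> might be asserted in addition, so its
  absence cannot serve as a premise.\<close>

definition frame_clauses :: "nat \<Rightarrow> nat \<Rightarrow> nat \<Rightarrow> nat list cnf" where
  "frame_clauses k G T = concat (map (\<lambda>t. concat (map (\<lambda>j. concat (map (\<lambda>i. concat (map (\<lambda>i'. map (\<lambda>a.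
     [(True, Vs (Suc t) j i a), (False, Vh t j i'), (False, Vs t j i a)])
     [0..<G]) (filter (\<lambda>i'. i' \<noteq> i) [0..<Suc (2 * T)]))) [0..<Suc (2 * T)])) [0..<k])) [0..<T])"

text \<open>Stated negatively: a model always asserts the symbol that is really read, so forbidding
  all symbols but 2, which stands for \<open>True\<close>, forces acceptance.\<close>

definition accept_clauses :: "nat \<Rightarrow> nat \<Rightarrow> nat list cnf" where
  "accept_clauses G T = map (\<lambda>a. [(False, Va T 0 a)]) (filter (\<lambda>a. a \<noteq> 2) [0..<G])"

definition run_cnf :: "tm \<Rightarrow> nat \<Rightarrow> nat list list \<Rightarrow> nat \<Rightarrow> nat list cnf" where
  "run_cnf M T opts lo = start_clauses (tapes M) T opts lo @ read_clauses (tapes M) (symbols M) T @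
     trans_clauses (rows M) T @ frame_clauses (tapes M) (symbols M) T @ accept_clauses (symbols M) T"

lemma model_start_clauses:
  "model \<sigma> (start_clauses k T opts lo) \<longleftrightarrow> \<sigma> (Vq 0 0) \<and> (\<forall>j<k. \<sigma> (Vh 0 j T)) \<and>
    (\<forall>j<k - 1. \<forall>i<Suc (2 * T). \<sigma> (Vs 0 (Suc j) i 0)) \<and> (\<forall>i<T. \<sigma> (Vs 0 0 i 0)) \<and>
    (\<forall>l<length opts. \<exists>a\<in>set (opts ! l). \<sigma> (Vs 0 0 (T + l) a)) \<and>
    (\<forall>l<T - lo. \<sigma> (Vs 0 0 (T + (lo + l)) 0) \<longrightarrow> \<sigma> (Vs 0 0 (T + Suc (lo + l)) 0))"
proof -
  have "(\<forall>p\<in>set (List.enumerate 0 opts). P (fst p) (snd p)) \<longleftrightarrow> (\<forall>l<length opts. P l (opts ! l))" for P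
  proof (intro iffI allI impI)
    fix l assume *: "\<forall>p\<in>set (List.enumerate 0 opts). P (fst p) (snd p)" and "l < length opts"
    then have "(l, opts ! l) \<in> set (List.enumerate 0 opts)" by (simp add: in_set_enumerate_eq)
    from bspec[OF * this] show "P l (opts ! l)" by simp
  qed (auto simp: in_set_enumerate_eq)
  note enum = this[of "\<lambda>l os. \<exists>a\<in>set os. \<sigma> (Vs 0 0 (T + l) a)"]
  show ?thesis
    unfolding start_clauses_def model_append model_map model_concat_map sat_clause_map fst_conv snd_conv
      enum eq_True
    by (auto simp: model_def simp del: upt_Suc)
qed

lemma ball_upt_filter:
  "(\<forall>i\<in>{0..<n}. P i) \<longleftrightarrow> (\<forall>i<n :: nat. P i)" "(\<forall>x\<in>{x \<in> A. Q x}. R x) \<longleftrightarrow> (\<forall>x\<in>A. Q x \<longrightarrow> R x)"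
  by auto

lemma model_read_clauses:
  "model \<sigma> (read_clauses k G T) \<longleftrightarrow> (\<forall>t<Suc T. \<forall>j<k. \<forall>i<Suc (2 * T). \<forall>a<G.
     \<sigma> (Vh t j i) \<longrightarrow> \<sigma> (Vs t j i a) \<longrightarrow> \<sigma> (Va t j a))"
  unfolding read_clauses_def model_map model_concat_map by (auto simp del: upt_Suc)

lemma sat_clause_body:
  "sat_clause \<sigma> (body t r) \<longleftrightarrow> (\<sigma> (Vq t (fst r)) \<longrightarrow> \<not> (\<forall>p\<in>set (snd r). \<sigma> (Va t (fst p) (snd p))))"
  by (auto simp: body_def sat_clause_map)

lemma model_trans_clauses:
  "model \<sigma> (trans_clauses rs T) \<longleftrightarrow> (\<forall>t<T. \<forall>r\<in>set rs.
     \<sigma> (Vq t (fst (fst r))) \<longrightarrow> (\<forall>p\<in>set (snd (fst r)). \<sigma> (Va t (fst p) (snd p))) \<longrightarrow>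
     \<sigma> (Vq (Suc t) (fst (snd r))) \<and>
     (\<forall>i<Suc (2 * T). \<forall>u\<in>set (snd (snd r)). \<sigma> (Vh t (fst u) i) \<longrightarrow>
        \<sigma> (Vs (Suc t) (fst u) i (fst (snd u))) \<and> \<sigma> (Vh (Suc t) (fst u) (i + snd (snd u) - 1))))"
proof -
  have Cons: "model \<sigma> (C # F) \<longleftrightarrow> sat_clause \<sigma> C \<and> model \<sigma> F" "model \<sigma> [] \<longleftrightarrow> True" for C F
    by (auto simp: model_def)
  have aux: "(a \<or> (q \<longrightarrow> \<not> p)) \<and> (\<forall>i<l. \<forall>u\<in>U. (b i u \<or> \<not> h i u \<or> (q \<longrightarrow> \<not> p)) \<and>
      (c i u \<or> \<not> h i u \<or> (q \<longrightarrow> \<not> p)) \<and> True) \<longleftrightarrow>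
    (q \<longrightarrow> p \<longrightarrow> a \<and> (\<forall>i<l. \<forall>u\<in>U. h i u \<longrightarrow> b i u \<and> c i u))"
    for a q p and l :: nat and U :: "(nat \<times> nat \<times> nat) set" and b c h
    by (cases q; cases p) auto
  show ?thesis
    unfolding trans_clauses_def model_concat_map Cons sat_clause_simps sat_clause_body set_upt ball_upt_filter
      eq_True eq_False aux ..
qed

lemma model_frame_clauses:
  "model \<sigma> (frame_clauses k G T) \<longleftrightarrow> (\<forall>t<T. \<forall>j<k. \<forall>i<Suc (2 * T). \<forall>i'<Suc (2 * T). i' \<noteq> i \<longrightarrow> (\<forall>a<G.
     \<sigma> (Vh t j i') \<longrightarrow> \<sigma> (Vs t j i a) \<longrightarrow> \<sigma> (Vs (Suc t) j i a)))"
proof -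
  have aux: "(\<forall>a<l. p a \<or> \<not> q \<or> \<not> r a \<or> sat_clause \<sigma> []) \<longleftrightarrow> (\<forall>a<l. q \<longrightarrow> r a \<longrightarrow> p a)"
    for l :: nat and p q r by auto
  show ?thesis
    unfolding frame_clauses_def model_map model_concat_map set_filter set_upt sat_clause_simps(2) ball_upt_filter
      eq_True eq_False aux ..
qed

lemma model_accept_clauses:
  "model \<sigma> (accept_clauses G T) \<longleftrightarrow> (\<forall>a<G. a \<noteq> 2 \<longrightarrow> \<not> \<sigma> (Va T 0 a))"
  unfolding accept_clauses_def model_map by auto


subsection \<open>Runs\<close>

context
  fixes M :: tm and z :: "bool list"
  assumes wf: "wf_tm M"
begin

definition conf :: "nat \<Rightarrow> config" where
  "conf t = (step M ^^ t) (init_config M z)"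

definition content :: "nat \<Rightarrow> nat \<Rightarrow> int \<Rightarrow> nat" where
  "content t j = fst (snd (conf t) ! j)"

definition head :: "nat \<Rightarrow> nat \<Rightarrow> int" where
  "head t j = snd (snd (conf t) ! j)"

definition reads :: "nat \<Rightarrow> nat list" where
  "reads t = map (\<lambda>j. content t j (head t j)) [0..<tapes M]"

definition good_conf :: "nat \<Rightarrow> config \<Rightarrow> bool" where
  "good_conf t C \<longleftrightarrow> fst C \<le> states M \<and> length (snd C) = tapes M \<and>
     (\<forall>j<tapes M. \<bar>snd (snd C ! j)\<bar> \<le> int t \<and> (\<forall>i. fst (snd C ! j) i < symbols M))"

lemma reads_eq: "length (snd (conf t)) = tapes M \<Longrightarrow> map (\<lambda>(c, h). c h) (snd (conf t)) = reads t"
  by (rule nth_equalityI) (auto simp: reads_def content_def head_def case_prod_beta)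

lemma step_delta:
  assumes "length ts = tapes M"
  shows "step M (q, ts) = (fst (delta M q (map (\<lambda>(c, h). c h) ts)),
    map2 act (snd (delta M q (map (\<lambda>(c, h). c h) ts))) ts)"
  by (simp add: delta_def step.simps case_prod_beta map2_act_stay[unfolded map_map] split: prod.splits)

lemma delta_wf:
  assumes "q \<le> states M" "length as = tapes M" "\<forall>a\<in>set as. a < symbols M"
  shows "fst (delta M q as) \<le> states M" "length (snd (delta M q as)) = tapes M"
    "\<And>u. u \<in> set (snd (delta M q as)) \<Longrightarrow> fst u < symbols M"
proof -
  have "fst (delta M q as) \<le> states M \<and> length (snd (delta M q as)) = tapes M \<and>
    (\<forall>u\<in>set (snd (delta M q as)). fst u < symbols M)"
  proof (cases "q = states M")
    case True
    then show ?thesis using assms by (auto simp: delta_def)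
  next
    case False
    then have "case trans M q as of (q', acts) \<Rightarrow> q' \<le> states M \<and> length acts = tapes M \<and>
        (\<forall>(a, m)\<in>set acts. a < symbols M)"
      using wf assms unfolding wf_tm_def by auto
    then show ?thesis using False by (auto simp: delta_def case_prod_beta)
  qed
  then show "fst (delta M q as) \<le> states M" "length (snd (delta M q as)) = tapes M"
    "\<And>u. u \<in> set (snd (delta M q as)) \<Longrightarrow> fst u < symbols M" by auto
qed

lemma act_eq: "fst (act u T) = (fst T)(snd T := fst u)" "snd (act u T) = move_head (snd u) (snd T)"
  by (cases u; cases T; simp)+

lemma good_conf: "good_conf t (conf t)"
proof (induction t)
  case 0
  have "bit_symbol b < symbols M" for b using wf by (simp add: wf_tm_def bit_symbol_def)
  moreover have "0 < symbols M" "tapes M \<ge> 1" using wf by (auto simp: wf_tm_def)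
  ultimately show ?case
    by (auto simp: good_conf_def conf_def init_config_def input_tape_def nth_Cons')
next
  case (Suc t)
  obtain q ts where c: "conf t = (q, ts)" by force
  have q: "q \<le> states M" and len: "length ts = tapes M"
    and b: "\<And>j. j < tapes M \<Longrightarrow> \<bar>snd (ts ! j)\<bar> \<le> int t \<and> (\<forall>i. fst (ts ! j) i < symbols M)"
    using Suc by (auto simp: good_conf_def c)
  let ?as = "map (\<lambda>(c, h). c h) ts"
  have as: "length ?as = tapes M" "\<forall>a\<in>set ?as. a < symbols M"
    using len b by (auto simp: all_set_conv_all_nth case_prod_beta simp del: set_map)
  note d = delta_wf[OF q as]
  have conf: "conf (Suc t) = (fst (delta M q ?as), map2 act (snd (delta M q ?as)) ts)"
    using step_delta[OF len, of q] c by (simp add: conf_def)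
  have mh: "\<bar>move_head m h\<bar> \<le> 1 + int t" if "\<bar>h\<bar> \<le> int t" for m h
    using that by (cases m) auto
  have "\<bar>snd (snd (conf (Suc t)) ! j)\<bar> \<le> int (Suc t) \<and> (\<forall>i. fst (snd (conf (Suc t)) ! j) i < symbols M)"
    if j: "j < tapes M" for j
  proof -
    have "snd (conf (Suc t)) ! j = act (snd (delta M q ?as) ! j) (ts ! j)"
      using j d(2) len by (simp add: conf)
    moreover have "fst (snd (delta M q ?as) ! j) < symbols M" using d(2) j by (intro d(3) nth_mem) simp
    ultimately show ?thesis using b[OF j] mh by (simp add: act_eq)
  qed
  then show ?case using d(1,2) len unfolding good_conf_def by (simp add: conf)
qed

lemma conf_bounds:
  "fst (conf t) \<le> states M" "length (snd (conf t)) = tapes M"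
  "j < tapes M \<Longrightarrow> \<bar>head t j\<bar> \<le> int t" "j < tapes M \<Longrightarrow> content t j i < symbols M"
  using good_conf[of t] by (auto simp: good_conf_def head_def content_def)

lemma reads_bounds: "length (reads t) = tapes M" "\<forall>a\<in>set (reads t). a < symbols M"
  using conf_bounds by (auto simp: reads_def)

lemma conf_Suc:
  defines "d \<equiv> \<lambda>t. delta M (fst (conf t)) (reads t)"
  shows "fst (conf (Suc t)) = fst (d t)"
    and "j < tapes M \<Longrightarrow> content (Suc t) j = (content t j)(head t j := fst (snd (d t) ! j))"
    and "j < tapes M \<Longrightarrow> head (Suc t) j = move_head (snd (snd (d t) ! j)) (head t j)"
proof -
  have conf: "conf (Suc t) = (fst (d t), map2 act (snd (d t)) (snd (conf t)))"
    using step_delta[OF conf_bounds(2)[of t], of "fst (conf t)"] reads_eq[OF conf_bounds(2), of t]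
    by (simp add: conf_def d_def)
  show "fst (conf (Suc t)) = fst (d t)" by (simp add: conf)
  assume j: "j < tapes M"
  have "length (snd (d t)) = tapes M"
    unfolding d_def by (rule delta_wf(2)[OF conf_bounds(1) reads_bounds])
  then have "snd (conf (Suc t)) ! j = act (snd (d t) ! j) (snd (conf t) ! j)"
    using j conf_bounds(2)[of t] by (simp add: conf)
  then show "content (Suc t) j = (content t j)(head t j := fst (snd (d t) ! j))"
    "head (Suc t) j = move_head (snd (snd (d t) ! j)) (head t j)"
    by (simp_all add: content_def head_def act_eq)
qed

lemma conf_0:
  "fst (conf 0) = 0" "j < tapes M \<Longrightarrow> head 0 j = 0"
  "j < tapes M \<Longrightarrow> content 0 j i =
    (if j = 0 \<and> 0 \<le> i \<and> i < int (length z) then bit_symbol (z ! nat i) else 0)"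
  by (auto simp: conf_def head_def content_def init_config_def input_tape_def nth_Cons')

lemma move_head_code: "h + int T \<ge> 1 \<Longrightarrow> nat (move_head m h + int T) = nat (h + int T) + move_code m - 1"
  by (cases m) auto

lemma row_in_rows: "row M (fst (conf t), reads t) \<in> set (rows M)"
proof -
  have "(fst (conf t), reads t) \<in> set (List.product [0..<Suc (states M)] (List.n_lists (tapes M) [0..<symbols M]))"
    using conf_bounds(1)[of t] reads_bounds[of t] by (auto simp: set_n_lists less_Suc_eq_le simp del: upt_Suc)
  then show ?thesis unfolding rows_def by simp
qed

text \<open>One inclusion only: the facts of the run hold in the model. Excess facts do no harm,
  because each clause used derives facts of the next configuration from facts of the present
  one.\<close>

lemma model_covers_run:
  assumes mod: "model \<sigma> (run_cnf M T opts lo)"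
    and start: "\<And>i. i < Suc (2 * T) \<Longrightarrow> \<sigma> (Vs 0 0 i (content 0 0 (int i - int T)))"
    and "t \<le> T"
  shows "\<sigma> (Vq t (fst (conf t))) \<and> (\<forall>j<tapes M. \<sigma> (Vh t j (nat (head t j + int T))) \<and>
    (\<forall>i<Suc (2 * T). \<sigma> (Vs t j i (content t j (int i - int T)))))"
  using assms(3)
proof (induction t)
  case 0
  have st: "\<sigma> (Vq 0 0)" "\<forall>j<tapes M. \<sigma> (Vh 0 j T)" "\<forall>j<tapes M - 1. \<forall>i<Suc (2 * T). \<sigma> (Vs 0 (Suc j) i 0)"
    using mod unfolding run_cnf_def model_append model_start_clauses by blast+
  have "\<sigma> (Vs 0 j i (content 0 j (int i - int T)))" if "j < tapes M" "i < Suc (2 * T)" for i j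
  proof (cases j)
    case 0
    then show ?thesis using start that by simp
  next
    case (Suc j')
    then show ?thesis using st(3) that by (simp add: conf_0)
  qed
  then show ?case using st(1,2) by (simp add: conf_0)
next
  case (Suc t)
  then have t: "t < T" "t < Suc T" by auto
  let ?d = "delta M (fst (conf t)) (reads t)"
  have q: "\<sigma> (Vq t (fst (conf t)))"
    and h: "\<And>j. j < tapes M \<Longrightarrow> \<sigma> (Vh t j (nat (head t j + int T)))"
    and c: "\<And>j i. j < tapes M \<Longrightarrow> i < Suc (2 * T) \<Longrightarrow> \<sigma> (Vs t j i (content t j (int i - int T)))"
    using Suc by auto
  \<comment> \<open>Before time \<open>T\<close> a head is strictly to the right of cell 0, so a
    move to the left is not truncated.\<close>
  have hb: "nat (head t j + int T) < Suc (2 * T)" "head t j + int T \<ge> 1" if "j < tapes M" for j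
    using conf_bounds(3)[OF that, of t] t by linarith+
  have rd: "\<sigma> (Va t j (content t j (head t j)))" if j: "j < tapes M" for j
  proof -
    have "\<sigma> (Vs t j (nat (head t j + int T)) (content t j (head t j)))"
      using c[OF j hb(1)[OF j]] hb(2)[OF j] by simp
    moreover have "content t j (head t j) < symbols M" by (rule conf_bounds(4)[OF j])
    ultimately show ?thesis
      using mod h[OF j] hb(1)[OF j] j t(2) unfolding run_cnf_def model_append model_read_clauses by blast
  qed
  let ?r = "row M (fst (conf t), reads t)"
  have ra: "\<forall>p\<in>set (snd (fst ?r)). \<sigma> (Va t (fst p) (snd p))"
    using rd by (auto simp: row_def in_set_enumerate_eq reads_def)
  have rq: "\<sigma> (Vq t (fst (fst ?r)))" using q by (simp add: row_def)
  have tr: "\<sigma> (Vq (Suc t) (fst (snd ?r)))"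
      "\<forall>i<Suc (2 * T). \<forall>u\<in>set (snd (snd ?r)). \<sigma> (Vh t (fst u) i) \<longrightarrow>
        \<sigma> (Vs (Suc t) (fst u) i (fst (snd u))) \<and> \<sigma> (Vh (Suc t) (fst u) (i + snd (snd u) - 1))"
    using mod t(1) row_in_rows[of t] rq ra unfolding run_cnf_def model_append model_trans_clauses
    by blast+
  have "\<sigma> (Vh (Suc t) j (nat (head (Suc t) j + int T))) \<and>
      (\<forall>i<Suc (2 * T). \<sigma> (Vs (Suc t) j i (content (Suc t) j (int i - int T))))" if j: "j < tapes M" for j
  proof -
    have len: "length (snd ?d) = tapes M" by (rule delta_wf(2)[OF conf_bounds(1) reads_bounds])
    let ?u = "(j, fst (snd ?d ! j), move_code (snd (snd ?d ! j)))"
    have "?u \<in> set (snd (snd ?r))"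
    proof -
      have "(j, snd ?d ! j) \<in> set (List.enumerate 0 (snd ?d))" using j len by (simp add: in_set_enumerate_eq)
      from imageI[OF this, of "\<lambda>(j, b, m). (j, b, move_code m)"] show ?thesis
        by (simp add: row_def case_prod_beta)
    qed
    from tr(2)[rule_format, OF hb(1)[OF j] this] h[OF j] have
      *: "\<sigma> (Vs (Suc t) j (nat (head t j + int T)) (fst (snd ?d ! j)))"
        "\<sigma> (Vh (Suc t) j (nat (head t j + int T) + move_code (snd (snd ?d ! j)) - 1))" by auto
    have "\<sigma> (Vs (Suc t) j i (content (Suc t) j (int i - int T)))" if i: "i < Suc (2 * T)" for i
    proof (cases "i = nat (head t j + int T)")
      case True
      then have "int i - int T = head t j" using hb(2)[OF j] by simp
      then show ?thesis using *(1) True by (simp add: conf_Suc(2)[OF j])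
    next
      case False
      then have "int i - int T \<noteq> head t j" using hb(2)[OF j] by auto
      then have eq: "content (Suc t) j (int i - int T) = content t j (int i - int T)"
        by (simp add: conf_Suc(2)[OF j])
      have "content t j (int i - int T) < symbols M" by (rule conf_bounds(4)[OF j])
      then show ?thesis
        using mod c[OF j i] h[OF j] hb(1)[OF j] False i j t(1) eq
        unfolding run_cnf_def model_append model_frame_clauses by auto
    qed
    then show ?thesis using *(2) by (simp add: conf_Suc(3)[OF j] move_head_code[OF hb(2)[OF j]])
  qed
  then show ?case using tr(1) by (simp add: row_def conf_Suc(1))
qed

definition run_assignment :: "nat \<Rightarrow> nat list \<Rightarrow> bool" where
  "run_assignment T v \<longleftrightarrow> (if v ! 0 = 0 then v ! 2 = fst (conf (v ! 1))
     else if v ! 0 = 1 then int (v ! 3) = head (v ! 1) (v ! 2) + int T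
     else if v ! 0 = 2 then v ! 4 = content (v ! 1) (v ! 2) (int (v ! 3) - int T)
     else v ! 3 = content (v ! 1) (v ! 2) (head (v ! 1) (v ! 2)))"

lemma run_assignment_simps:
  "run_assignment T (Vq t q) \<longleftrightarrow> q = fst (conf t)"
  "run_assignment T (Vh t j i) \<longleftrightarrow> int i = head t j + int T"
  "run_assignment T (Vs t j i a) \<longleftrightarrow> a = content t j (int i - int T)"
  "run_assignment T (Va t j a) \<longleftrightarrow> a = content t j (head t j)"
  by (simp_all add: run_assignment_def Vq_def Vh_def Vs_def Va_def)

lemma run_is_model:
  assumes opts: "\<And>l. l < length opts \<Longrightarrow> content 0 0 (int l) \<in> set (opts ! l)"
    and accept: "content T 0 (head T 0) = 2"
  shows "model (run_assignment T) (run_cnf M T opts lo)"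
proof -
  have k: "0 < tapes M" using wf by (simp add: wf_tm_def)
  have "model (run_assignment T) (start_clauses (tapes M) T opts lo)"
    unfolding model_start_clauses run_assignment_simps
  proof (intro conjI allI impI)
    fix l assume "l < length opts"
    then show "\<exists>a\<in>set (opts ! l). a = content 0 0 (int (T + l) - int T)" using opts by simp
  next
    fix l assume "0 = content 0 0 (int (T + (lo + l)) - int T)"
    \<comment> \<open>Bits are written as 1 and 2, so a blank lies behind the input, and then so
      does its right neighbour.\<close>
    then have "\<not> lo + l < length z"
      using k by (auto simp: conf_0 bit_symbol_def split: if_splits)
    then show "0 = content 0 0 (int (T + Suc (lo + l)) - int T)" using k by (simp add: conf_0)
  qed (use k in \<open>auto simp: conf_0\<close>)
  moreover have "model (run_assignment T) (read_clauses (tapes M) (symbols M) T)"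
    unfolding model_read_clauses run_assignment_simps by auto
  moreover have "model (run_assignment T) (trans_clauses (rows M) T)"
    unfolding model_trans_clauses run_assignment_simps
  proof (intro allI impI ballI)
    fix t r
    assume t: "t < T" and r: "r \<in> set (rows M)" "fst (fst r) = fst (conf t)"
      "\<forall>p\<in>set (snd (fst r)). snd p = content t (fst p) (head t (fst p))"
    obtain q as where as: "r = row M (q, as)" "length as = tapes M"
      using r(1) by (auto simp: rows_def set_n_lists)
    have "as = reads t"
    proof (rule nth_equalityI)
      fix j assume j: "j < length as"
      then have "(j, as ! j) \<in> set (snd (fst r))" by (simp add: as row_def in_set_enumerate_eq)
      then show "as ! j = reads t ! j" using r(3) j as(2) by (fastforce simp: reads_def)
    qed (simp add: as(2) reads_bounds)
    moreover have "q = fst (conf t)" using r(2) by (simp add: as row_def)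
    ultimately have r: "r = row M (fst (conf t), reads t)" using as(1) by simp
    let ?d = "delta M (fst (conf t)) (reads t)"
    have len: "length (snd ?d) = tapes M" by (rule delta_wf(2)[OF conf_bounds(1) reads_bounds])
    show "fst (snd r) = fst (conf (Suc t)) \<and> (\<forall>i<Suc (2 * T). \<forall>u\<in>set (snd (snd r)).
        int i = head t (fst u) + int T \<longrightarrow>
        fst (snd u) = content (Suc t) (fst u) (int i - int T) \<and>
        int (i + snd (snd u) - 1) = head (Suc t) (fst u) + int T)"
    proof (intro conjI allI impI ballI)
      show "fst (snd r) = fst (conf (Suc t))" by (simp add: r row_def conf_Suc(1))
      fix i u assume "i < Suc (2 * T)" and u: "u \<in> set (snd (snd r))" and i: "int i = head t (fst u) + int T"
      obtain j where j: "j < tapes M" "u = (j, fst (snd ?d ! j), move_code (snd (snd ?d ! j)))"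
        using u len by (auto simp: r row_def in_set_enumerate_eq case_prod_beta)
      have h: "head t j + int T \<ge> 1" using conf_bounds(3)[OF j(1), of t] t by linarith
      have i': "int i = head t j + int T" "i = nat (head t j + int T)" using i j(2) by auto
      show "fst (snd u) = content (Suc t) (fst u) (int i - int T)"
        using i'(1) by (simp add: j(2) conf_Suc(2)[OF j(1)])
      have "\<bar>head (Suc t) j\<bar> \<le> int (Suc t)" by (rule conf_bounds(3)[OF j(1)])
      then have "head (Suc t) j + int T \<ge> 0" using t by linarith
      then show "int (i + snd (snd u) - 1) = head (Suc t) (fst u) + int T"
        using move_head_code[OF h, of "snd (snd ?d ! j)"]
        by (simp add: j(2) i'(2) conf_Suc(3)[OF j(1)])
    qed
  qed
  moreover have "model (run_assignment T) (frame_clauses (tapes M) (symbols M) T)"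
    unfolding model_frame_clauses run_assignment_simps by (auto simp: conf_Suc(2))
  moreover have "model (run_assignment T) (accept_clauses (symbols M) T)"
    unfolding model_accept_clauses run_assignment_simps using accept by auto
  ultimately show ?thesis unfolding run_cnf_def by simp
qed

lemma accept_if_model:
  assumes mod: "model \<sigma> (run_cnf M T opts lo)"
    and start: "\<And>i. i < Suc (2 * T) \<Longrightarrow> \<sigma> (Vs 0 0 i (content 0 0 (int i - int T)))"
  shows "content T 0 (head T 0) = 2"
proof -
  have k: "0 < tapes M" using wf by (simp add: wf_tm_def)
  let ?i = "nat (head T 0 + int T)"
  have cov: "\<sigma> (Vh T 0 ?i)" "\<forall>i<Suc (2 * T). \<sigma> (Vs T 0 i (content T 0 (int i - int T)))"
    using model_covers_run[OF mod start order_refl] k by auto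
  have hb: "?i < Suc (2 * T)" "int ?i - int T = head T 0" using conf_bounds(3)[OF k, of T] by linarith+
  then have "\<sigma> (Vs T 0 ?i (content T 0 (head T 0)))" using cov(2) by auto
  then have "\<sigma> (Va T 0 (content T 0 (head T 0)))"
    using mod cov(1) hb(1) k conf_bounds(4)[OF k, of T "head T 0"]
    unfolding run_cnf_def model_append model_read_clauses by blast
  then show ?thesis
    using mod conf_bounds(4)[OF k, of T "head T 0"] unfolding run_cnf_def model_append model_accept_clauses by blast
qed

text \<open>The halted configuration persists until \<open>T\<close>, and its output, a single bit,
  starts under the head of the first tape.\<close>

lemma accept_iff_output:
  assumes "t \<le> T" "halts_with M (conf t) [b]"
  shows "content T 0 (head T 0) = 2 \<longleftrightarrow> b"
proof -
  have stay: "step M C = C" if "fst C = states M" for C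
    using that by (cases C) (simp add: step.simps)
  have "(step M ^^ d) (conf t) = conf t" for d
    using assms(2) by (induction d) (auto simp: halts_with_def case_prod_beta stay)
  from this[of "T - t"] have "conf T = conf t"
    using assms(1) by (simp add: conf_def flip: funpow_add_app)
  moreover have "snd (conf t) \<noteq> []"
    using conf_bounds(2)[of t] wf by (auto simp: wf_tm_def)
  ultimately have "content T 0 (head T 0) = bit_symbol b"
    using assms(2) unfolding halts_with_def has_output_def content_def head_def
    by (auto simp: case_prod_beta hd_conv_nth)
  then show ?thesis by (simp add: bit_symbol_def)
qed

end


subsection \<open>The formula of an input\<close>

text \<open>The known part of the pair, then \<open>P\<close> cells to be guessed, then blanks up to
  the last cell. The blank among the guessed symbols allows witnesses shorter than
  \<open>P\<close>.\<close>

definition input_opts :: "nat \<Rightarrow> nat \<Rightarrow> bool list \<Rightarrow> nat list list" where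
  "input_opts T P x = map (\<lambda>b. [if b then 2 else 1]) (enc_list (\<lambda>b. [b]) x) @
     replicate P [0, 1, 2] @ replicate (Suc T - (2 * length x + 1 + P)) [0]"

lemma sat_run_cnf:
  assumes wf: "wf_tm M" and T: "2 * length x + 1 + P \<le> T"
    and dec: "\<And>w. length w \<le> P \<Longrightarrow>
      \<exists>t\<le>T. halts_with M ((step M ^^ t) (init_config M (enc_pair x w))) [enc_pair x w \<in> R]"
  shows "sat (run_cnf M T (input_opts T P x) (2 * length x + 1)) \<longleftrightarrow> (\<exists>w. length w \<le> P \<and> enc_pair x w \<in> R)"
proof -
  let ?lo = "2 * length x + 1"
  let ?opts = "input_opts T P x"
  let ?pre = "enc_list (\<lambda>b. [b]) x"
  have k: "0 < tapes M" using wf by (simp add: wf_tm_def)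
  have lpre: "length ?pre = ?lo" by (simp add: length_enc_list sum_list_triv)
  have len: "length ?opts = Suc T" using T by (simp add: input_opts_def lpre)
  have opt: "?opts ! l = (if l < ?lo then [bit_symbol (?pre ! l)] else if l < ?lo + P then [0, 1, 2] else [0])"
    if "l < Suc T" for l
    using that T by (auto simp: input_opts_def nth_append lpre bit_symbol_def)
  have lz: "length (enc_pair x w) = ?lo + length w" for w by (simp add: enc_pair_def lpre)
  have nth_z: "enc_pair x w ! l = (if l < ?lo then ?pre ! l else w ! (l - ?lo))" for w l
    by (simp add: enc_pair_def nth_append lpre)
  have cont: "content M (enc_pair x w) 0 0 (int l) = (if l < ?lo then bit_symbol (?pre ! l)
      else if l < ?lo + length w then bit_symbol (w ! (l - ?lo)) else 0)" for w l
    using k by (auto simp: conf_0[OF wf] lz nth_z)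
  show ?thesis
  proof
    assume "sat (run_cnf M T ?opts ?lo)"
    then obtain \<sigma> where \<sigma>: "model \<sigma> (run_cnf M T ?opts ?lo)" unfolding sat_iff_model by blast
    define cell where "cell l a = \<sigma> (Vs 0 0 (T + l) a)" for l a
    have ini: "\<And>i. i < T \<Longrightarrow> \<sigma> (Vs 0 0 i 0)" "\<And>l. l < Suc T \<Longrightarrow> \<exists>a\<in>set (?opts ! l). cell l a"
        "\<And>l. l < T - ?lo \<Longrightarrow> cell (?lo + l) 0 \<Longrightarrow> cell (Suc (?lo + l)) 0"
      using \<sigma> unfolding run_cnf_def model_append model_start_clauses len cell_def by auto
    \<comment> \<open>The length of the witness: the first cell that may be blank, or
      \<open>P\<close> if all guessed cells are filled.\<close>
    define p where "p = (LEAST p. p = P \<or> cell (?lo + p) 0)"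
    have p: "p \<le> P" unfolding p_def by (rule Least_le) simp
    have p0: "cell (?lo + p) 0"
    proof (cases "p = P")
      case True
      have "\<exists>a\<in>set (?opts ! (?lo + P)). cell (?lo + P) a" using T by (intro ini(2)) simp
      then show ?thesis using True opt[of "?lo + P"] T by simp
    next
      case False
      have "p = P \<or> cell (?lo + p) 0" unfolding p_def by (rule LeastI[of _ P]) simp
      then show ?thesis using False by simp
    qed
    have before: "\<not> cell (?lo + l) 0" if "l < p" for l
      using not_less_Least[of l "\<lambda>p. p = P \<or> cell (?lo + p) 0"] that by (simp add: p_def)
    have after: "cell (?lo + l) 0" if "p \<le> l" "?lo + l \<le> T" for l
      using that
    proof (induction rule: dec_induct)
      case (step l)
      then show ?case using ini(3)[of l] by simp
    qed (rule p0)
    \<comment> \<open>Where the model claims both 1 and 2 for a cell, this settles on 2; it matters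
      only that the chosen symbol is asserted. Blanks are excluded by the minimality of
      \<open>p\<close>.\<close>
    define w where "w = map (\<lambda>l. cell (?lo + l) 2) [0..<p]"
    let ?z = "enc_pair x w"
    have lw: "length w = p" by (simp add: w_def)
    have cells: "cell l (content M ?z 0 0 (int l))" if l: "l < Suc T" for l
    proof -
      consider "l < ?lo" | "?lo \<le> l" "l < ?lo + p" | "?lo + p \<le> l" by linarith
      then show ?thesis
      proof cases
        case 1
        then show ?thesis using ini(2)[OF l] opt[OF l] by (simp add: cont)
      next
        case 2
        define l' where "l' = l - ?lo"
        have l': "l = ?lo + l'" "l' < p" using 2 by (auto simp: l'_def)
        have "cell l 0 \<or> cell l 1 \<or> cell l 2" using ini(2)[OF l] opt[OF l] 2 p by auto
        then have "cell l 1 \<or> cell l 2" using before[OF l'(2)] l'(1) by simp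
        then have "cell l (bit_symbol (w ! l'))" using l' by (auto simp: w_def bit_symbol_def)
        then show ?thesis unfolding cont using l' lw by simp
      next
        case 3
        then show ?thesis using after[of "l - ?lo"] l lw by (simp add: cont)
      qed
    qed
    have "\<sigma> (Vs 0 0 i (content M ?z 0 0 (int i - int T)))" if i: "i < Suc (2 * T)" for i
    proof (cases "i < T")
      case True
      then show ?thesis using ini(1) k by (simp add: conf_0[OF wf])
    next
      case False
      then show ?thesis using cells[of "i - T"] i by (simp add: cell_def of_nat_diff)
    qed
    from accept_if_model[OF wf \<sigma> this] have acc: "content M ?z T 0 (head M ?z T 0) = 2" .
    obtain t where "t \<le> T" "halts_with M (conf M ?z t) [?z \<in> R]"
      using dec[of w] p lw unfolding conf_def[OF wf] by auto
    from accept_iff_output[OF wf this] acc have "?z \<in> R" by simp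
    then show "\<exists>w. length w \<le> P \<and> enc_pair x w \<in> R" using p lw by auto
  next
    assume "\<exists>w. length w \<le> P \<and> enc_pair x w \<in> R"
    then obtain w where w: "length w \<le> P" "enc_pair x w \<in> R" by blast
    let ?z = "enc_pair x w"
    obtain t where "t \<le> T" "halts_with M (conf M ?z t) [?z \<in> R]"
      using dec[OF w(1)] unfolding conf_def[OF wf] by auto
    from accept_iff_output[OF wf this] w(2) have acc: "content M ?z T 0 (head M ?z T 0) = 2" by simp
    have "content M ?z 0 0 (int l) \<in> set (?opts ! l)" if "l < length ?opts" for l
      using that opt[of l] w(1) unfolding len cont by (auto simp: bit_symbol_def)
    from run_is_model[OF wf this acc] show "sat (run_cnf M T ?opts ?lo)"
      unfolding sat_iff_model by blast
  qed
qed


section \<open>The formula in polynomial time\<close>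

lemma pt_propositions [pt_intros]:
  assumes "pt t"
  shows "pt q \<Longrightarrow> pt (\<lambda>x. Vq (t x) (q x))"
    "pt j \<Longrightarrow> pt i \<Longrightarrow> pt (\<lambda>x. Vh (t x) (j x) (i x))"
    "pt j \<Longrightarrow> pt i \<Longrightarrow> pt a \<Longrightarrow> pt (\<lambda>x. Vs (t x) (j x) (i x) (a x))"
    "pt j \<Longrightarrow> pt a \<Longrightarrow> pt (\<lambda>x. Va (t x) (j x) (a x))"
  unfolding Vq_def Vh_def Vs_def Va_def by (intro pt_intros assms; assumption)+

lemma pt_body [pt_intros]:
  assumes "pt t" "pt r"
  shows "pt (\<lambda>x. body (t x) (r x))"
  unfolding body_def by (intro pt_intros assms pt_comp[OF assms(1)])

lemma pt_start_clauses [pt_intros]: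
  assumes "pt T" "pt opts" "pt lo"
  shows "pt (\<lambda>x. start_clauses k (T x) (opts x) (lo x))"
  unfolding start_clauses_def
  by (intro pt_intros assms pt_comp[OF assms(1)] pt_comp[OF assms(3)])

lemma pt_read_clauses [pt_intros]:
  assumes "pt T"
  shows "pt (\<lambda>x. read_clauses k G (T x))"
  unfolding read_clauses_def by (intro pt_intros assms pt_comp[OF assms])

lemma pt_trans_clauses [pt_intros]:
  assumes "pt T"
  shows "pt (\<lambda>x. trans_clauses rs (T x))"
  unfolding trans_clauses_def by (intro pt_intros assms pt_comp[OF assms])

lemma pt_frame_clauses [pt_intros]:
  assumes "pt T"
  shows "pt (\<lambda>x. frame_clauses k G (T x))"
  unfolding frame_clauses_def by (intro pt_intros assms pt_comp[OF assms])

lemma pt_accept_clauses [pt_intros]: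
  assumes "pt T"
  shows "pt (\<lambda>x. accept_clauses G (T x))"
  unfolding accept_clauses_def by (intro pt_intros assms pt_comp[OF assms])

lemma pt_run_cnf [pt_intros]:
  assumes "pt T" "pt opts" "pt lo"
  shows "pt (\<lambda>x. run_cnf M (T x) (opts x) (lo x))"
  unfolding run_cnf_def by (intro pt_intros assms)

lemma pt_input_opts [pt_intros]:
  assumes "pt T" "pt P" "pt x"
  shows "pt (\<lambda>y. input_opts (T y) (P y) (x y))"
  unfolding input_opts_def by (intro pt_intros assms)


text \<open>Stated as a sandwich: a yes-input lands in the smaller language, and landing in the
  larger one implies a yes-input. The same \<open>f\<close> thus reduces to both.\<close>

lemma reduction_to_scheduling:
  assumes "in_NP L"
  obtains f where "polytime_computable f"
    "\<forall>x. (x \<in> L \<longrightarrow> f x \<in> enc_task_set ` {I. schedulable I \<and> small_instance I}) \<and>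
      (f x \<in> enc_task_set ` {I. schedulable I} \<longrightarrow> x \<in> L)"
proof -
  obtain R and p :: "nat poly" where R: "polytime_decidable R"
    and L: "\<And>x. x \<in> L \<longleftrightarrow> (\<exists>w. length w \<le> poly p (length x) \<and> enc_pair x w \<in> R)"
    using assms unfolding in_NP_def by blast
  obtain M and q :: "nat poly" where wf: "wf_tm M"
    and M: "\<And>z. \<exists>t\<le>poly q (length z). halts_with M ((step M ^^ t) (init_config M z)) [z \<in> R]"
    using R unfolding polytime_decidable_def polytime_computable_def by blast
  define P where "P x = poly p (length x)" for x :: "bool list"
  define N where "N x = 2 * length x + 1 + P x" for x
  \<comment> \<open>\<open>N x\<close> bounds the length of every pair to be considered, so the
    first summand covers the running time; the second makes the whole word fit into the cells to the
    right of the initial head position.\<close>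
  define T where "T x = poly q (N x) + N x" for x
  define F where "F x = run_cnf M (T x) (input_opts (T x) (P x) x) (2 * length x + 1)" for x
  have sat: "sat (F x) \<longleftrightarrow> x \<in> L" for x
    unfolding F_def L P_def[symmetric]
  proof (rule sat_run_cnf[OF wf])
    show "2 * length x + 1 + P x \<le> T x" by (simp add: T_def N_def)
    fix w :: "bool list" assume w: "length w \<le> P x"
    have "length (enc_pair x w) \<le> N x"
      using w by (simp add: enc_pair_def length_enc_list sum_list_triv N_def)
    then have "poly q (length (enc_pair x w)) \<le> T x"
      using poly_nat_mono[of _ "N x" q] by (simp add: T_def trans_le_add1)
    then show "\<exists>t\<le>T x. halts_with M ((step M ^^ t) (init_config M (enc_pair x w))) [enc_pair x w \<in> R]"
      using M[of "enc_pair x w"] le_trans by blast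
  qed
  have "pt P" unfolding P_def by (intro pt_intros)
  then have "pt N" unfolding N_def by (intro pt_intros)
  then have "pt T" unfolding T_def by (intro pt_intros)
  then have "pt F" unfolding F_def using \<open>pt P\<close> by (intro pt_intros)
  from pt_enc_task_set_of[OF pt_comp[OF pt_cnf_instance this]]
  have comp: "polytime_computable (\<lambda>x. enc_task_set (task_set_of (cnf_instance (F x))))"
    by (rule polytime_computable_if_pt)
  show ?thesis
  proof (rule that[OF comp], intro allI conjI impI)
    fix x assume "x \<in> L"
    then show "enc_task_set (task_set_of (cnf_instance (F x))) \<in> enc_task_set ` {I. schedulable I \<and> small_instance I}"
      using sat[of x] schedulable_cnf_instance[of "F x"] small_cnf_instance[of "F x"] by simp
  next
    fix x assume "enc_task_set (task_set_of (cnf_instance (F x))) \<in> enc_task_set ` {I. schedulable I}"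
    then have "schedulable (task_set_of (cnf_instance (F x)))"
      unfolding inj_image_mem_iff[OF inj_enc_task_set] by simp
    then show "x \<in> L" using sat[of x] schedulable_cnf_instance[of "F x"] by simp
  qed
qed

theorem theorem2:
  "strongly_NP_complete enc_task_set length numbers {I :: task_set. schedulable I}"
proof -
  let ?Y = "{I. schedulable I}" and ?S = "{I. schedulable I \<and> small_instance I}"
  have hard: "NP_hard (enc_task_set ` ?Y) \<and> NP_hard (enc_task_set ` ?S)"
    unfolding NP_hard_def polytime_reducible_def
  proof (intro conjI allI impI)
    fix L assume "in_NP L"
    then obtain f where f: "polytime_computable f"
      "\<forall>x. (x \<in> L \<longrightarrow> f x \<in> enc_task_set ` ?S) \<and> (f x \<in> enc_task_set ` ?Y \<longrightarrow> x \<in> L)"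
      by (rule reduction_to_scheduling)
    have "enc_task_set ` ?S \<subseteq> enc_task_set ` ?Y" by (intro image_mono) auto
    then show "\<exists>f. polytime_computable f \<and> (\<forall>x. (x \<in> L) = (f x \<in> enc_task_set ` ?Y))"
      "\<exists>f. polytime_computable f \<and> (\<forall>x. (x \<in> L) = (f x \<in> enc_task_set ` ?S))"
      using f by blast+
  qed
  \<comment> \<open>The bounding polynomial is the identity: the padding tasks make the number of
    tasks itself a bound for all numbers.\<close>
  have small: "{I \<in> ?Y. \<forall>a\<in>numbers I. a \<le> poly [:0, 1:] (length I)} = ?S"
    by (simp add: small_instance_def)
  have "NP_complete (enc_task_set ` ?Y)"
    using in_NP_scheduling[of False] hard by (simp add: NP_complete_def)
  moreover have "NP_complete (enc_task_set ` {I \<in> ?Y. \<forall>a\<in>numbers I. a \<le> poly [:0, 1:] (length I)})"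
    unfolding small using in_NP_scheduling[of True] hard by (simp add: NP_complete_def)
  ultimately show ?thesis unfolding strongly_NP_complete_def by blast
qed

end
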